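(* Let $d\ge3$ be fixed, $p(n)\sim c/n^{d-1}$ with $0<c<(d-2)!$, and let $H\in\mathcal U$. Then $$\lim_{n\to\infty}\mathbf{P}(\mathrm{Frag}_n\simeq H)=e^{-f(c)}\frac{\big(e^{-c/(d-2)!}c\big)^{|H|}}{\mathrm{aut}(H)},$$ where $f(c)=\frac12\ln\frac{1}{1-\frac{c}{(d-2)!}}-\frac{c}{2(d-2)!}$.
   Context: $G^d_n=G^d(n,p)$ is the random $d$-uniform hypergraph on $\{1,\dots,n\}$ with each $d$-element edge present independently with probability $p$. For a hypergraph $H$, $|H|$ is its number of edges, $\mathrm{ex}(H)=(d-1)|H|-|V(H)|$ its excess, and $\mathrm{aut}(H)$ its number of automorphisms (vertex permutations preserving the edge set). A unicycle is a connected hypergraph of excess $0$. $\mathcal U$ is the family of unlabeled $d$-uniform hypergraphs all of whose connected components are unicycles (including the empty hypergraph). The fragment $\mathrm{Frag}_n$ is the union of the connected components of $G^d_n$ that are unicycles; $\simeq$ is isomorphism. *)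

theory Defs
  imports "HOL-Probability.Product_PMF" "HOL-Library.Landau_Symbols" "HOL-Combinatorics.Permutations"
begin

datatype 'a hypergraph = Hypergraph (verts: "'a set") (edges: "'a set set")

definition uniform :: "nat \<Rightarrow> 'a hypergraph \<Rightarrow> bool" where
  "uniform d H \<longleftrightarrow> finite (verts H) \<and> (\<forall>e\<in>edges H. e \<subseteq> verts H \<and> card e = d)"

definition excess :: "nat \<Rightarrow> 'a hypergraph \<Rightarrow> int" where
  "excess d H = (int d - 1) * int (card (edges H)) - int (card (verts H))"

definition aut :: "'a hypergraph \<Rightarrow> nat" where
  "aut H = card {\<pi>. \<pi> permutes verts H \<and> (\<lambda>e. \<pi> ` e) ` edges H = edges H}"

definition iso :: "'a hypergraph \<Rightarrow> 'b hypergraph \<Rightarrow> bool" (infix "\<simeq>" 50) where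
  "G \<simeq> H \<longleftrightarrow> (\<exists>f. bij_betw f (verts G) (verts H) \<and> (\<lambda>e. f ` e) ` edges G = edges H)"

definition adj :: "'a hypergraph \<Rightarrow> ('a \<times> 'a) set" where
  "adj H = {(u, v). \<exists>e\<in>edges H. u \<in> e \<and> v \<in> e}"

definition connected_hg :: "'a hypergraph \<Rightarrow> bool" where
  "connected_hg H \<longleftrightarrow> verts H \<noteq> {} \<and> (\<forall>u\<in>verts H. \<forall>v\<in>verts H. (u, v) \<in> (adj H)\<^sup>*)"

definition component_of :: "'a hypergraph \<Rightarrow> 'a \<Rightarrow> 'a hypergraph" where
  "component_of H v =
     (let C = {w \<in> verts H. (v, w) \<in> (adj H)\<^sup>*} in Hypergraph C {e \<in> edges H. e \<subseteq> C})"

definition components :: "'a hypergraph \<Rightarrow> 'a hypergraph set" where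
  "components H = component_of H ` verts H"

definition unicycle :: "nat \<Rightarrow> 'a hypergraph \<Rightarrow> bool" where
  "unicycle d H \<longleftrightarrow> uniform d H \<and> connected_hg H \<and> excess d H = 0"

text \<open>The family of unlabeled hypergraphs all of whose components are unicycles is represented by
  its labeled members, over an arbitrary vertex type. The hypergraph without vertices has no
  components, hence belongs to it.\<close>
definition unicyclic_family :: "nat \<Rightarrow> 'a hypergraph set" where
  "unicyclic_family d = {H. uniform d H \<and> (\<forall>C\<in>components H. unicycle d C)}"

definition fragment :: "nat \<Rightarrow> 'a hypergraph \<Rightarrow> 'a hypergraph" where
  "fragment d G =
     Hypergraph (\<Union>C\<in>{C \<in> components G. unicycle d C}. verts C)
                (\<Union>C\<in>{C \<in> components G. unicycle d C}. edges C)"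

definition d_subsets :: "nat \<Rightarrow> nat \<Rightarrow> nat set set" where
  "d_subsets d n = {e. e \<subseteq> {1..n} \<and> card e = d}"

definition binomial_hypergraph :: "nat \<Rightarrow> nat \<Rightarrow> real \<Rightarrow> nat hypergraph pmf" where
  "binomial_hypergraph d n p =
     map_pmf (\<lambda>present. Hypergraph {1..n} {e \<in> d_subsets d n. present e})
       (Pi_pmf (d_subsets d n) False (\<lambda>_. bernoulli_pmf p))"

definition f_const :: "nat \<Rightarrow> real \<Rightarrow> real" where
  "f_const d c = 1 / 2 * ln (1 / (1 - c / fact (d - 2))) - c / (2 * fact (d - 2))"

end

theory Submission
  imports Defs
begin

text \<open>
  Summing over the labeled copies of \<open>H\<close> reduces the statement to the case where \<open>H\<close> is empty: given a
  copy with \<open>v\<close> vertices, the fragment equals it iff its edges are present, all other edges meeting it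
  are absent, and the rest, a random hypergraph on \<open>n - v\<close> vertices, has no unicyclic component.

  The excess of an edge set is supermodular, so its minimal nonempty sets of excess \<open>0\<close> behave like the
  circuits of a matroid. A hypergraph without nonempty edge sets of nonnegative excess has no unicyclic
  component. The probability \<open>F\<close> of this event satisfies, by Russo's formula, Harris' inequality and the
  bound \<open>O(1/n)\<close> on the probability that two vertices are connected, a differential inequality whose
  solution is the lower bound \<open>exp (- f c)\<close>. For the upper bound, Janson's inequality is applied to the
  circuits with at most \<open>K\<close> edges: two distinct circuits sharing an edge have a union of positive excess,
  hence contribute \<open>O(1/n)\<close>, and the number of loose cycles of length \<open>k\<close> gives the \<open>k\<close>-th term
  \<open>x ^ k / (2 * k)\<close> of the series of \<open>f\<close>, where \<open>x = c / (d - 2)!\<close>. A circuit present in a hypergraph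
  without unicyclic component lies in a component that contains a small edge set of positive excess or is
  large; both are unlikely.
\<close>

text \<open>The two bounds meet although neither counts unicycles; the trees attached to a cycle
  never have to be enumerated. Janson's inequality needs only enough short circuits, that is, a
  lower bound on the number of loose cycles and hence an upper bound on their automorphisms. No
  classification of circuits is required, because the differential inequality supplies the matching
  bound from the other side. Both sides produce \<open>(- ln (1 - x) - x) / 2\<close>: one as the
  sum of \<open>x ^ k / (2 * k)\<close> over \<open>k >= 2\<close>, as a single edge has excess -1
  and there is no term for \<open>k = 1\<close>; the other as the integral of
  \<open>y / (2 * (1 - y))\<close>. The condition \<open>c < fact (d - 2)\<close> says
  \<open>x < 1\<close>, where \<open>x\<close> is the limit of the expected number of neighbours of
  a vertex, counted with multiplicity; it makes the recursions for component sizes converge. The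
  factor \<open>exp (- c / fact (d - 2))\<close> per edge of \<open>H\<close> comes from absent
  edges: \<open>H\<close> has \<open>d - 1\<close> vertices per edge, each in about
  \<open>n ^ (d - 1) / fact (d - 1)\<close> potential edges. The same relation makes the powers of
  \<open>n\<close> cancel in the number of copies times the probability of their edges.\<close>

section \<open>Random subsets\<close>

text \<open>The expectation of \<open>f R\<close> for a random subset \<open>R\<close> of \<open>\<Omega>\<close> that contains each element independently
  with probability \<open>p\<close>.\<close>
definition bexp :: "'a set \<Rightarrow> real \<Rightarrow> ('a set \<Rightarrow> real) \<Rightarrow> real" where
  "bexp \<Omega> p f = (\<Sum>R\<in>Pow \<Omega>. p ^ card R * (1 - p) ^ card (\<Omega> - R) * f R)"

lemma bexp_empty [simp]: "bexp {} p f = f {}"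
  by (simp add: bexp_def)

text \<open>Conditioning on the presence of \<open>e\<close>. Most facts about \<open>bexp\<close>
  are inductions over this recursion.\<close>

lemma bexp_insert:
  assumes "finite \<Omega>" "e \<notin> \<Omega>"
  shows "bexp (insert e \<Omega>) p f = p * bexp \<Omega> p (\<lambda>R. f (insert e R)) + (1 - p) * bexp \<Omega> p f"
proof -
  let ?w = "\<lambda>R. p ^ card R * (1 - p) ^ card (insert e \<Omega> - R) * f R"
  have inj: "inj_on (insert e) (Pow \<Omega>)"
    using assms(2) by (auto simp: inj_on_def)
  have "bexp (insert e \<Omega>) p f = sum ?w (Pow \<Omega>) + sum ?w (insert e ` Pow \<Omega>)"
    unfolding bexp_def Pow_insert using assms by (intro sum.union_disjoint) auto
  also have "sum ?w (insert e ` Pow \<Omega>) = (\<Sum>R\<in>Pow \<Omega>. ?w (insert e R))"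
    by (simp add: sum.reindex[OF inj])
  also have "\<dots> = p * bexp \<Omega> p (\<lambda>R. f (insert e R))"
    unfolding bexp_def sum_distrib_left
  proof (intro sum.cong refl)
    fix R assume "R \<in> Pow \<Omega>"
    then have "finite R" "e \<notin> R" "insert e \<Omega> - insert e R = \<Omega> - R"
      using assms finite_subset by auto
    then show "?w (insert e R) = p * (p ^ card R * (1 - p) ^ card (\<Omega> - R) * f (insert e R))"
      by simp
  qed
  also have "sum ?w (Pow \<Omega>) = (1 - p) * bexp \<Omega> p f"
    unfolding bexp_def sum_distrib_left
  proof (intro sum.cong refl)
    fix R assume "R \<in> Pow \<Omega>"
    then have "insert e \<Omega> - R = insert e (\<Omega> - R)" "e \<notin> \<Omega> - R" "finite (\<Omega> - R)"
      using assms by auto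
    then show "?w R = (1 - p) * (p ^ card R * (1 - p) ^ card (\<Omega> - R) * f R)"
      by simp
  qed
  finally show ?thesis by simp
qed

lemma bexp_remove:
  assumes "finite \<Omega>" "e \<in> \<Omega>"
  shows "bexp \<Omega> p f = p * bexp (\<Omega> - {e}) p (\<lambda>R. f (insert e R)) + (1 - p) * bexp (\<Omega> - {e}) p f"
  using bexp_insert[of "\<Omega> - {e}" e p f] assms by (simp add: insert_absorb)

section \<open>Elementary rules for the expectation\<close>

lemma bexp_cong:
  assumes "\<And>R. R \<subseteq> \<Omega> \<Longrightarrow> f R = g R"
  shows "bexp \<Omega> p f = bexp \<Omega> p g"
  unfolding bexp_def using assms by (intro sum.cong) auto

lemma bexp_mono:
  assumes "0 \<le> p" "p \<le> 1" "\<And>R. R \<subseteq> \<Omega> \<Longrightarrow> f R \<le> g R"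
  shows "bexp \<Omega> p f \<le> bexp \<Omega> p g"
  unfolding bexp_def using assms by (intro sum_mono mult_left_mono) auto

lemma bexp_add: "bexp \<Omega> p (\<lambda>R. f R + g R) = bexp \<Omega> p f + bexp \<Omega> p g"
  by (simp add: bexp_def algebra_simps sum.distrib)

lemma bexp_diff: "bexp \<Omega> p (\<lambda>R. f R - g R) = bexp \<Omega> p f - bexp \<Omega> p g"
  by (simp add: bexp_def algebra_simps sum_subtractf)

lemma bexp_cmult: "bexp \<Omega> p (\<lambda>R. a * f R) = a * bexp \<Omega> p f"
  by (simp add: bexp_def sum_distrib_left algebra_simps)

lemma bexp_sum: "bexp \<Omega> p (\<lambda>R. \<Sum>i\<in>I. f i R) = (\<Sum>i\<in>I. bexp \<Omega> p (f i))"
  unfolding bexp_def sum_distrib_left by (rule sum.swap)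

lemma bexp_const [simp]: "finite \<Omega> \<Longrightarrow> bexp \<Omega> p (\<lambda>_. a) = a"
  by (induction \<Omega> rule: finite_induct) (auto simp: bexp_insert algebra_simps)

lemma bexp_nonneg:
  assumes "0 \<le> p" "p \<le> 1" "\<And>R. R \<subseteq> \<Omega> \<Longrightarrow> 0 \<le> f R"
  shows "0 \<le> bexp \<Omega> p f"
  unfolding bexp_def using assms by (intro sum_nonneg) auto

lemma bexp_zero_prob: "finite \<Omega> \<Longrightarrow> bexp \<Omega> 0 f = f {}"
  by (induction \<Omega> arbitrary: f rule: finite_induct) (auto simp: bexp_insert)

lemma bexp_superset:
  assumes "finite \<Omega>" "T \<subseteq> \<Omega>"
  shows "bexp \<Omega> p (\<lambda>R. of_bool (T \<subseteq> R) * f R) = p ^ card T * bexp (\<Omega> - T) p (\<lambda>R. f (R \<union> T))"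
proof -
  have "finite T" using assms finite_subset by auto
  then show ?thesis using assms
  proof (induction T arbitrary: \<Omega> f rule: finite_induct)
    case (insert e T)
    have "bexp \<Omega> p (\<lambda>R. of_bool (insert e T \<subseteq> R) * f R) =
        p * bexp (\<Omega> - {e}) p (\<lambda>R. of_bool (insert e T \<subseteq> insert e R) * f (insert e R))
        + (1 - p) * bexp (\<Omega> - {e}) p (\<lambda>R. of_bool (insert e T \<subseteq> R) * f R)"
      using insert.prems by (intro bexp_remove) auto
    also have "bexp (\<Omega> - {e}) p (\<lambda>R. of_bool (insert e T \<subseteq> R) * f R) = bexp (\<Omega> - {e}) p (\<lambda>_. 0)"
      by (rule bexp_cong) auto
    also have "bexp (\<Omega> - {e}) p (\<lambda>R. of_bool (insert e T \<subseteq> insert e R) * f (insert e R)) =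
       bexp (\<Omega> - {e}) p (\<lambda>R. of_bool (T \<subseteq> R) * f (insert e R))"
      using insert.hyps by (intro bexp_cong) auto
    also have "\<dots> = p ^ card T * bexp (\<Omega> - {e} - T) p (\<lambda>R. f (insert e (R \<union> T)))"
      using insert.prems insert.hyps by (intro insert.IH) auto
    also have "\<Omega> - {e} - T = \<Omega> - insert e T" by auto
    finally show ?case using insert.hyps insert.prems by simp
  qed simp
qed

lemma bexp_avoid:
  assumes "finite \<Omega>" "D \<subseteq> \<Omega>"
  shows "bexp \<Omega> p (\<lambda>R. of_bool (R \<inter> D = {}) * f R) = (1 - p) ^ card D * bexp (\<Omega> - D) p f"
proof -
  have "finite D" using assms finite_subset by auto
  then show ?thesis using assms
  proof (induction D arbitrary: \<Omega> f rule: finite_induct)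
    case (insert e D)
    have "bexp \<Omega> p (\<lambda>R. of_bool (R \<inter> insert e D = {}) * f R) =
        p * bexp (\<Omega> - {e}) p (\<lambda>R. of_bool (insert e R \<inter> insert e D = {}) * f (insert e R))
        + (1 - p) * bexp (\<Omega> - {e}) p (\<lambda>R. of_bool (R \<inter> insert e D = {}) * f R)"
      using insert.prems by (intro bexp_remove) auto
    also have "bexp (\<Omega> - {e}) p (\<lambda>R. of_bool (R \<inter> insert e D = {}) * f R) =
        bexp (\<Omega> - {e}) p (\<lambda>R. of_bool (R \<inter> D = {}) * f R)"
      by (rule bexp_cong) auto
    also have "\<dots> = (1 - p) ^ card D * bexp (\<Omega> - {e} - D) p f"
      using insert.prems insert.hyps by (intro insert.IH) auto
    also have "\<Omega> - {e} - D = \<Omega> - insert e D" by auto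
    finally show ?case using insert.hyps insert.prems by simp
  qed simp
qed

lemma bexp_remove_irrelevant:
  assumes "finite \<Omega>" "T \<subseteq> \<Omega>" "\<And>R. R \<subseteq> \<Omega> \<Longrightarrow> f R = f (R - T)"
  shows "bexp \<Omega> p f = bexp (\<Omega> - T) p f"
proof -
  have "finite T" using assms finite_subset by auto
  then show ?thesis using assms
  proof (induction T arbitrary: \<Omega> rule: finite_induct)
    case (insert e T)
    have irr: "f R = f (R - insert e T)" if "R \<subseteq> \<Omega>" for R
      using insert.prems(3)[OF that] .
    have ins: "f (insert e R) = f R" if "R \<subseteq> \<Omega> - {e}" for R
    proof -
      have "f (insert e R) = f (insert e R - insert e T)" "f R = f (R - insert e T)"
        using that insert.prems(2) by (intro irr, auto)+
      then show ?thesis by simp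
    qed
    have e: "e \<in> \<Omega>" using insert.prems by auto
    have "bexp \<Omega> p f = p * bexp (\<Omega> - {e}) p (\<lambda>R. f (insert e R)) + (1 - p) * bexp (\<Omega> - {e}) p f"
      using insert.prems e by (intro bexp_remove) auto
    also have "bexp (\<Omega> - {e}) p (\<lambda>R. f (insert e R)) = bexp (\<Omega> - {e}) p f"
      by (rule bexp_cong) (use ins in auto)
    also have "bexp (\<Omega> - {e}) p f = bexp (\<Omega> - {e} - T) p f"
    proof (rule insert.IH)
      fix R assume R: "R \<subseteq> \<Omega> - {e}"
      then have "R - insert e T = R - T" by auto
      then show "f R = f (R - T)" using irr[of R] R by auto
    qed (use insert.prems insert.hyps in auto)
    also have "\<Omega> - {e} - T = \<Omega> - insert e T" by auto
    finally show ?case by (simp add: algebra_simps)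
  qed simp
qed

text \<open>The case of Harris' inequality that Janson's inequality needs. It follows without
  induction on \<open>f\<close>: conditioning on \<open>T\<close> replaces \<open>f R\<close> by
  \<open>f ((R - T) \<union> T)\<close>, which is at most \<open>f R\<close>.\<close>

lemma bexp_subset_le:
  assumes "finite \<Omega>" "0 \<le> p" "p \<le> 1" "T \<subseteq> \<Omega>"
    and anti: "\<And>R S. R \<subseteq> S \<Longrightarrow> S \<subseteq> \<Omega> \<Longrightarrow> f S \<le> f R"
  shows "bexp \<Omega> p (\<lambda>R. of_bool (T \<subseteq> R) * f R) \<le> p ^ card T * bexp \<Omega> p f"
proof -
  have "bexp (\<Omega> - T) p (\<lambda>R. f (R \<union> T)) = bexp (\<Omega> - T) p (\<lambda>R. f ((R - T) \<union> T))"
    by (rule bexp_cong) (auto simp: Un_commute)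
  also have "\<dots> = bexp \<Omega> p (\<lambda>R. f ((R - T) \<union> T))"
    using assms by (intro bexp_remove_irrelevant[symmetric]) auto
  also have "\<dots> \<le> bexp \<Omega> p f"
    using assms by (intro bexp_mono anti) auto
  finally show ?thesis
    using assms by (simp add: bexp_superset mult_left_mono)
qed

lemma bexp_superset_indicator:
  assumes "finite \<Omega>" "T \<subseteq> \<Omega>"
  shows "bexp \<Omega> p (\<lambda>R. of_bool (T \<subseteq> R)) = p ^ card T"
  using bexp_superset[of \<Omega> T p "\<lambda>_. 1"] assms by simp

text \<open>After conditioning on one element, the two induction hypotheses leave the term
  \<open>p * (1 - p) * ((F0 - F1) * (G1 - G0))\<close>, which is nonnegative because
  \<open>f\<close> and \<open>g\<close> are monotone in opposite directions.\<close>

lemma harris: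
  assumes "finite \<Omega>" "0 \<le> p" "p \<le> 1"
    and "\<And>R S. R \<subseteq> S \<Longrightarrow> S \<subseteq> \<Omega> \<Longrightarrow> f S \<le> f R"
    and "\<And>R S. R \<subseteq> S \<Longrightarrow> S \<subseteq> \<Omega> \<Longrightarrow> g R \<le> g S"
  shows "bexp \<Omega> p (\<lambda>R. f R * g R) \<le> bexp \<Omega> p f * bexp \<Omega> p g"
  using assms
proof (induction \<Omega> arbitrary: f g rule: finite_induct)
  case (insert e \<Omega>)
  define F1 F0 G1 G0 where "F1 = bexp \<Omega> p (\<lambda>R. f (insert e R))" and "F0 = bexp \<Omega> p f"
    and "G1 = bexp \<Omega> p (\<lambda>R. g (insert e R))" and "G0 = bexp \<Omega> p g"
  note defs = this
  have F: "F1 \<le> F0" unfolding defs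
    using insert.prems(1,2) by (intro bexp_mono insert.prems(3)) auto
  have G: "G0 \<le> G1" unfolding defs
    using insert.prems(1,2) by (intro bexp_mono insert.prems(4)) auto
  have 1: "bexp \<Omega> p (\<lambda>R. f (insert e R) * g (insert e R)) \<le> F1 * G1"
    unfolding defs using insert.prems(1,2) by (intro insert.IH insert.prems(3,4)) auto
  have 0: "bexp \<Omega> p (\<lambda>R. f R * g R) \<le> F0 * G0"
    unfolding defs using insert.prems(1,2) by (intro insert.IH insert.prems(3,4)) auto
  have "0 \<le> p * (1 - p) * ((F0 - F1) * (G1 - G0))"
    using F G insert.prems by simp
  moreover have "(p * F1 + (1 - p) * F0) * (p * G1 + (1 - p) * G0) =
      p * (F1 * G1) + (1 - p) * (F0 * G0) + p * (1 - p) * ((F0 - F1) * (G1 - G0))"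
    by algebra
  ultimately have "p * (F1 * G1) + (1 - p) * (F0 * G0) \<le> (p * F1 + (1 - p) * F0) * (p * G1 + (1 - p) * G0)"
    by linarith
  moreover have "p * bexp \<Omega> p (\<lambda>R. f (insert e R) * g (insert e R)) \<le> p * (F1 * G1)"
    "(1 - p) * bexp \<Omega> p (\<lambda>R. f R * g R) \<le> (1 - p) * (F0 * G0)"
    using 0 1 insert.prems by (auto intro: mult_left_mono)
  ultimately show ?case
    using insert.hyps unfolding bexp_insert[OF insert.hyps] defs[symmetric] by linarith
qed simp

text \<open>Differentiate \<open>bexp_insert\<close>: the explicit factors \<open>p\<close> and
  \<open>1 - p\<close> give the summand of the new element, the induction hypothesis the others. As
  \<open>f\<close> is arbitrary, the hypothesis also applies to \<open>f\<close> shifted by an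
  insertion.\<close>

lemma russo:
  assumes "finite \<Omega>"
  shows "((\<lambda>p. bexp \<Omega> p f) has_real_derivative
           (\<Sum>e\<in>\<Omega>. bexp (\<Omega> - {e}) p (\<lambda>R. f (insert e R) - f R))) (at p)"
  using assms
proof (induction \<Omega> arbitrary: f rule: finite_induct)
  case (insert e \<Omega>)
  let ?f1 = "\<lambda>R. f (insert e R)"
  let ?D = "\<lambda>f. \<Sum>e\<in>\<Omega>. bexp (\<Omega> - {e}) p (\<lambda>R. f (insert e R) - f R)"
  have "((\<lambda>p. p * bexp \<Omega> p ?f1 + (1 - p) * bexp \<Omega> p f) has_real_derivative
      (bexp \<Omega> p ?f1 + p * ?D ?f1) + (- bexp \<Omega> p f + (1 - p) * ?D f)) (at p)"
    by (auto intro!: derivative_eq_intros insert.IH[THEN DERIV_cong])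
  moreover have "(bexp \<Omega> p ?f1 + p * ?D ?f1) + (- bexp \<Omega> p f + (1 - p) * ?D f) =
      (\<Sum>e'\<in>insert e \<Omega>. bexp (insert e \<Omega> - {e'}) p (\<lambda>R. f (insert e' R) - f R))"
  proof -
    have "bexp (insert e \<Omega> - {e'}) p (\<lambda>R. f (insert e' R) - f R) =
        p * bexp (\<Omega> - {e'}) p (\<lambda>R. ?f1 (insert e' R) - ?f1 R)
        + (1 - p) * bexp (\<Omega> - {e'}) p (\<lambda>R. f (insert e' R) - f R)" if "e' \<in> \<Omega>" for e'
    proof -
      have "insert e \<Omega> - {e'} = insert e (\<Omega> - {e'})" using that insert.hyps by auto
      then show ?thesis
        using insert.hyps by (simp add: bexp_insert insert_commute)
    qed
    then have "(\<Sum>e'\<in>\<Omega>. bexp (insert e \<Omega> - {e'}) p (\<lambda>R. f (insert e' R) - f R)) = p * ?D ?f1 + (1 - p) * ?D f"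
      by (simp add: sum.distrib sum_distrib_left)
    then show ?thesis
      using insert.hyps by (simp add: bexp_diff)
  qed
  ultimately show ?case
    by (simp add: bexp_insert[OF insert.hyps])
qed simp

lemma bexp_image:
  assumes "finite \<Omega>" "inj_on h \<Omega>"
  shows "bexp (h ` \<Omega>) p f = bexp \<Omega> p (\<lambda>R. f (h ` R))"
  using assms
proof (induction \<Omega> arbitrary: f rule: finite_induct)
  case (insert e \<Omega>)
  have "h e \<notin> h ` \<Omega>" using insert by auto
  then show ?case using insert by (simp add: bexp_insert)
qed simp

text \<open>The bridge from the product measure to finite sums; the probabilistic arguments are
  carried out with \<open>bexp\<close>.\<close>

lemma expectation_Pi_bernoulli:
  assumes "finite \<Omega>" "0 \<le> p" "p \<le> 1"
  shows "measure_pmf.expectation (Pi_pmf \<Omega> False (\<lambda>_. bernoulli_pmf p)) (\<lambda>b. f {e \<in> \<Omega>. b e}) = bexp \<Omega> p f"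
  using assms
proof (induction \<Omega> arbitrary: f rule: finite_induct)
  case (insert e \<Omega>)
  let ?P = "Pi_pmf \<Omega> False (\<lambda>_. bernoulli_pmf p)"
  have fin: "finite (set_pmf ?P)"
    by (rule finite_subset[OF set_Pi_pmf_subset']) (use insert.hyps in \<open>auto intro!: finite_PiE_dflt\<close>)
  have eq: "{x \<in> insert e \<Omega>. (b(e := True)) x} = insert e {x \<in> \<Omega>. b x}"
    "{x \<in> insert e \<Omega>. (b(e := False)) x} = {x \<in> \<Omega>. b x}" for b
    using insert.hyps by auto
  have "measure_pmf.expectation (Pi_pmf (insert e \<Omega>) False (\<lambda>_. bernoulli_pmf p)) (\<lambda>b. f {x \<in> insert e \<Omega>. b x})
     = measure_pmf.expectation (pair_pmf (bernoulli_pmf p) ?P) (\<lambda>(y, b). f {x \<in> insert e \<Omega>. (b(e := y)) x})"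
    by (simp add: Pi_pmf_insert[OF insert.hyps] case_prod_unfold)
  also have "\<dots> = measure_pmf.expectation (bernoulli_pmf p) (\<lambda>y. measure_pmf.expectation ?P (\<lambda>b. f {x \<in> insert e \<Omega>. (b(e := y)) x}))"
    unfolding pair_pmf_def
    by (subst pmf_expectation_bind[where A = "UNIV :: bool set"], simp, simp add: fin, simp)
       (simp add: bind_return_pmf integral_measure_pmf[of UNIV] fin map_pmf_def[symmetric])
  also have "\<dots> = p * bexp \<Omega> p (\<lambda>R. f (insert e R)) + (1 - p) * bexp \<Omega> p f"
    using insert.prems insert.IH[of f] insert.IH[of "\<lambda>R. f (insert e R)"]
    by (subst integral_bernoulli_pmf) (simp_all only: eq mult.commute)
  finally show ?case by (simp add: bexp_insert[OF insert.hyps])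
qed simp

section \<open>Connection probabilities\<close>

text \<open>\<open>adj\<close> as a function of the edge set alone, since edges are added and
  removed while the vertices stay.\<close>

definition link :: "'a set set \<Rightarrow> ('a \<times> 'a) set" where
  "link R = {(u, v). \<exists>e\<in>R. u \<in> e \<and> v \<in> e}"

lemma adj_link: "adj H = link (edges H)"
  by (simp add: adj_def link_def)

text \<open>An arbitrary vertex set is allowed because the hypergraph left after removing a copy of
  \<open>H\<close> lives on \<open>V - verts H\<close>.\<close>

definition dsub :: "nat \<Rightarrow> 'a set \<Rightarrow> 'a set set" where
  "dsub d V = {e. e \<subseteq> V \<and> card e = d}"

lemma finite_dsub [simp]: "finite V \<Longrightarrow> finite (dsub d V)"
  by (rule finite_subset[of _ "Pow V"]) (auto simp: dsub_def)

lemma d_subsets_eq_dsub: "d_subsets d n = dsub d {1..n}"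
  by (simp add: d_subsets_def dsub_def)

lemma link_mono: "R \<subseteq> S \<Longrightarrow> link R \<subseteq> link S"
  by (auto simp: link_def)

lemma rtrancl_link_mono: "(u, v) \<in> (link R)\<^sup>* \<Longrightarrow> R \<subseteq> S \<Longrightarrow> (u, v) \<in> (link S)\<^sup>*"
  using rtrancl_mono[OF link_mono] by blast

lemma rtrancl_link_sym: "(u, v) \<in> (link R)\<^sup>* \<Longrightarrow> (v, u) \<in> (link R)\<^sup>*"
  by (rule symD[OF sym_rtrancl]) (auto simp: link_def sym_def)

text \<open>Take the last edge of the path that contains \<open>u\<close>. Everything after it uses
  only edges that avoid \<open>u\<close>, in particular not \<open>e\<close>; this stronger claim is
  what the induction proves.\<close>

lemma rtrancl_link_first_edge:
  assumes "(u, v) \<in> (link R)\<^sup>*" "u \<noteq> v"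
  shows "\<exists>e\<in>R. u \<in> e \<and> (\<exists>w\<in>e - {u}. (w, v) \<in> (link (R - {e}))\<^sup>*)"
proof -
  let ?R = "{e \<in> R. u \<notin> e}"
  have "v = u \<or> (\<exists>e\<in>R. u \<in> e \<and> (\<exists>w\<in>e - {u}. (w, v) \<in> (link ?R)\<^sup>*))"
    using assms(1)
  proof (induction rule: rtrancl_induct)
    case (step z z')
    from step.hyps(2) obtain f where f: "f \<in> R" "z \<in> f" "z' \<in> f" by (auto simp: link_def)
    show ?case
    proof (cases "u \<in> f")
      case True
      then show ?thesis using f by blast
    next
      case False
      then have "(z, z') \<in> link ?R" "z \<noteq> u" using f by (auto simp: link_def)
      with step.IH show ?thesis by (meson rtrancl.rtrancl_into_rtrancl)
    qed
  qed simp
  with assms(2) obtain e w where e: "e \<in> R" "u \<in> e" "w \<in> e - {u}" "(w, v) \<in> (link ?R)\<^sup>*" by auto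
  moreover have "?R \<subseteq> R - {e}" using e by auto
  ultimately show ?thesis by (meson rtrancl_link_mono)
qed

lemma choose_le_power_div_fact: "real (n choose k) \<le> real n ^ k / fact k"
proof -
  have "real ((n choose k) * fact k) \<le> real (n ^ k)"
    using binomial_fact_pow of_nat_le_iff by blast
  then show ?thesis by (simp add: field_simps)
qed

lemma card_dsub_containing:
  assumes "finite V" "T \<subseteq> V" "card T \<le> d"
  shows "real (card {e \<in> dsub d V. T \<subseteq> e}) \<le> real (card V) ^ (d - card T) / fact (d - card T)"
proof -
  have T: "finite T" using assms finite_subset by auto
  have "inj_on (\<lambda>e. e - T) {e \<in> dsub d V. T \<subseteq> e}"
    by (auto simp: inj_on_def)
  moreover have "(\<lambda>e. e - T) ` {e \<in> dsub d V. T \<subseteq> e} \<subseteq> {e. e \<subseteq> V \<and> card e = d - card T}"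
    using T by (auto simp: dsub_def card_Diff_subset)
  ultimately have "card {e \<in> dsub d V. T \<subseteq> e} \<le> card {e. e \<subseteq> V \<and> card e = d - card T}"
    using assms(1) by (intro card_inj_on_le[where f = "\<lambda>e. e - T"]) auto
  also have "\<dots> = card V choose (d - card T)"
    using assms(1) by (rule n_subsets)
  finally show ?thesis
    using choose_le_power_div_fact[of "card V" "d - card T"] by linarith
qed

text \<open>The origin of \<open>fact (d - 2)\<close>: a vertex lies in at most
  \<open>card V ^ (d - 1) / fact (d - 1)\<close> edges, each with \<open>d - 1\<close> further
  vertices.\<close>

lemma sum_dsub_vertex_le:
  assumes "finite V" "u \<in> V" "\<Omega> \<subseteq> dsub d V" "d \<ge> 2" "0 \<le> b"
  shows "(\<Sum>e\<in>{e \<in> \<Omega>. u \<in> e}. \<Sum>w\<in>e - {u}. b) \<le> real (card V) ^ (d - 1) / fact (d - 2) * b"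
proof -
  have d: "fact (d - 1) = real (d - 1) * fact (d - 2)"
    using assms(4) fact_reduce[of "d - 1", where 'a = real] by (simp add: numeral_2_eq_2)
  have "(\<Sum>e\<in>{e \<in> \<Omega>. u \<in> e}. \<Sum>w\<in>e - {u}. b) = (\<Sum>e\<in>{e \<in> \<Omega>. u \<in> e}. real (d - 1) * b)"
    using assms by (intro sum.cong) (auto simp: dsub_def)
  also have "\<dots> = real (card {e \<in> \<Omega>. u \<in> e}) * (real (d - 1) * b)" by simp
  also have "\<dots> \<le> real (card {e \<in> dsub d V. {u} \<subseteq> e}) * (real (d - 1) * b)"
    using assms by (intro mult_right_mono of_nat_mono card_mono) auto
  also have "\<dots> \<le> real (card V) ^ (d - 1) / fact (d - 1) * (real (d - 1) * b)"
    using card_dsub_containing[of V "{u}" d] assms by (intro mult_right_mono) auto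
  also have "\<dots> = real (card V) ^ (d - 1) / fact (d - 2) * b"
    using assms(4) unfolding d by simp
  finally show ?thesis .
qed

text \<open>Independence of \<open>e\<close> from all other edges; this is why
  \<open>rtrancl_link_first_edge\<close> returns a continuation that avoids
  \<open>e\<close>.\<close>

lemma bexp_edge_and:
  assumes "finite \<Omega>" "e \<in> \<Omega>"
  shows "bexp \<Omega> p (\<lambda>R. of_bool (e \<in> R) * f (R - {e})) = p * bexp (\<Omega> - {e}) p f"
proof -
  have "bexp (\<Omega> - {e}) p (\<lambda>R. f (R \<union> {e} - {e})) = bexp (\<Omega> - {e}) p f"
    by (rule bexp_cong) (metis Diff_insert_absorb Un_insert_right insert_Diff_single subset_Diff_insert sup_bot.right_neutral)
  then show ?thesis
    using bexp_superset[of \<Omega> "{e}" p "\<lambda>R. f (R - {e})"] assms by simp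
qed

lemma bexp_edge_conn:
  assumes "finite \<Omega>" "e \<in> \<Omega>"
  shows "bexp \<Omega> p (\<lambda>R. of_bool (e \<in> R) * of_bool ((w, v) \<in> (link (R - {e}))\<^sup>*)) =
    p * bexp (\<Omega> - {e}) p (\<lambda>R. of_bool ((w, v) \<in> (link R)\<^sup>*))"
  using assms by (rule bexp_edge_and)

text \<open>Splitting off the first edge of a path from \<open>u\<close> bounds the expected size \<open>s\<close> of the component of
  \<open>u\<close> by \<open>1 + y * s\<close>, where \<open>s\<close> on the right refers to a smaller edge set; no paths are counted.\<close>
lemma sum_reach_prob_le:
  assumes "finite V" "d \<ge> 2" "0 \<le> p" "p \<le> 1"
    and y: "y = real (card V) ^ (d - 1) / fact (d - 2) * p" "y < 1"
    and "\<Omega> \<subseteq> dsub d V" "u \<in> V"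
  shows "(\<Sum>v\<in>V. bexp \<Omega> p (\<lambda>R. of_bool ((u, v) \<in> (link R)\<^sup>*))) \<le> 1 / (1 - y)"
proof -
  have "finite \<Omega>" using assms finite_subset finite_dsub by metis
  then show ?thesis using assms(7,8)
  proof (induction \<Omega> arbitrary: u rule: finite_psubset_induct)
    case (psubset \<Omega>)
    let ?conn = "\<lambda>u v R. of_bool ((u, v) \<in> (link R)\<^sup>*) :: real"
    let ?E = "{e \<in> \<Omega>. u \<in> e}"
    have fin: "finite e" if "e \<in> \<Omega>" for e
      using that psubset.prems assms(1) by (auto simp: dsub_def intro: finite_subset)
    have step: "bexp \<Omega> p (?conn u v) \<le>
        of_bool (u = v) + (\<Sum>e\<in>?E. \<Sum>w\<in>e - {u}. p * bexp (\<Omega> - {e}) p (?conn w v))" for v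
    proof -
      have "bexp \<Omega> p (?conn u v) \<le>
         bexp \<Omega> p (\<lambda>R. of_bool (u = v) + (\<Sum>e\<in>?E. \<Sum>w\<in>e - {u}. of_bool (e \<in> R) * ?conn w v (R - {e})))"
      proof (rule bexp_mono)
        fix R assume R: "R \<subseteq> \<Omega>"
        have nn: "0 \<le> (\<Sum>e\<in>?E. \<Sum>w\<in>e - {u}. of_bool (e \<in> R) * ?conn w v (R - {e}))"
          by (intro sum_nonneg) auto
        show "?conn u v R \<le> of_bool (u = v) + (\<Sum>e\<in>?E. \<Sum>w\<in>e - {u}. of_bool (e \<in> R) * ?conn w v (R - {e}))"
        proof (cases "u \<noteq> v \<and> (u, v) \<in> (link R)\<^sup>*")
          case True
          then obtain e w where e: "e \<in> R" "u \<in> e" "w \<in> e - {u}" "(w, v) \<in> (link (R - {e}))\<^sup>*"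
            using rtrancl_link_first_edge by meson
          then have eE: "e \<in> ?E" using R by auto
          have "1 = of_bool (e \<in> R) * ?conn w v (R - {e})" using e by simp
          also have "\<dots> \<le> (\<Sum>w\<in>e - {u}. of_bool (e \<in> R) * ?conn w v (R - {e}))"
            using e fin[of e] eE by (intro member_le_sum) auto
          also have "\<dots> \<le> (\<Sum>e\<in>?E. \<Sum>w\<in>e - {u}. of_bool (e \<in> R) * ?conn w v (R - {e}))"
            using eE psubset.hyps
            by (intro member_le_sum[of e ?E "\<lambda>e. \<Sum>w\<in>e - {u}. of_bool (e \<in> R) * ?conn w v (R - {e})"])
               (auto intro!: sum_nonneg)
          finally show ?thesis using True by auto
        next
          case False
          then show ?thesis using nn by auto
        qed
      qed (use assms in auto)
      also have "\<dots> = of_bool (u = v) + (\<Sum>e\<in>?E. \<Sum>w\<in>e - {u}. p * bexp (\<Omega> - {e}) p (?conn w v))"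
        using psubset.hyps by (simp add: bexp_add bexp_sum bexp_edge_conn)
      finally show ?thesis .
    qed
    have "(\<Sum>v\<in>V. bexp \<Omega> p (?conn u v)) \<le>
       (\<Sum>v\<in>V. of_bool (u = v) + (\<Sum>e\<in>?E. \<Sum>w\<in>e - {u}. p * bexp (\<Omega> - {e}) p (?conn w v)))"
      by (intro sum_mono step)
    also have "\<dots> = 1 + (\<Sum>e\<in>?E. \<Sum>w\<in>e - {u}. p * (\<Sum>v\<in>V. bexp (\<Omega> - {e}) p (?conn w v)))"
    proof -
      have "(\<Sum>v\<in>V. of_bool (u = v) :: real) = 1"
        using assms(1) psubset.prems by (simp add: of_bool_def sum.delta)
      moreover have "(\<Sum>v\<in>V. \<Sum>e\<in>?E. \<Sum>w\<in>e - {u}. p * bexp (\<Omega> - {e}) p (?conn w v))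
         = (\<Sum>e\<in>?E. \<Sum>w\<in>e - {u}. p * (\<Sum>v\<in>V. bexp (\<Omega> - {e}) p (?conn w v)))"
        unfolding sum_distrib_left by (subst sum.swap) (intro sum.cong refl sum.swap)
      ultimately show ?thesis by (simp add: sum.distrib)
    qed
    also have "\<dots> \<le> 1 + (\<Sum>e\<in>?E. \<Sum>w\<in>e - {u}. p * (1 / (1 - y)))"
    proof (intro add_left_mono sum_mono mult_left_mono psubset.IH)
      fix e w assume "e \<in> ?E" "w \<in> e - {u}"
      then show "\<Omega> - {e} \<subset> \<Omega>" "\<Omega> - {e} \<subseteq> dsub d V" "w \<in> V"
        using psubset.prems by (auto simp: dsub_def)
    qed (use assms in auto)
    also have "\<dots> \<le> 1 + real (card V) ^ (d - 1) / fact (d - 2) * (p * (1 / (1 - y)))"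
      using psubset.prems assms by (intro add_left_mono sum_dsub_vertex_le) auto
    also have "\<dots> = 1 / (1 - y)"
      using y(2) by (simp add: y(1) field_simps)
    finally show ?case .
  qed
qed

text \<open>The recursion of \<open>sum_reach_prob_le\<close> for a single target. Either the first
  edge contains \<open>v\<close> as well, which has probability at most \<open>t\<close>, or the
  path continues from some \<open>w \<noteq> v\<close>; the bound \<open>r\<close> thus solves
  \<open>r = t + y * r\<close>. As \<open>card V * t = y\<close>, it is of order
  \<open>1 / card V\<close>.\<close>

lemma pair_reach_prob_le:
  assumes "finite V" "d \<ge> 2" "0 \<le> p" "p \<le> 1"
    and y: "y = real (card V) ^ (d - 1) / fact (d - 2) * p" "y < 1"
    and t: "t = real (card V) ^ (d - 2) / fact (d - 2) * p"
    and "\<Omega> \<subseteq> dsub d V" "u \<in> V" "v \<in> V" "u \<noteq> v"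
  shows "bexp \<Omega> p (\<lambda>R. of_bool ((u, v) \<in> (link R)\<^sup>*)) \<le> t / (1 - y)"
proof -
  have "finite \<Omega>" using assms finite_subset finite_dsub by metis
  then show ?thesis using assms(8,9,11)
  proof (induction \<Omega> arbitrary: u rule: finite_psubset_induct)
    case (psubset \<Omega>)
    let ?conn = "\<lambda>u v R. of_bool ((u, v) \<in> (link R)\<^sup>*) :: real"
    let ?E = "{e \<in> \<Omega>. u \<in> e}"
    let ?E2 = "{e \<in> \<Omega>. {u, v} \<subseteq> e}"
    have fin: "finite e" if "e \<in> \<Omega>" for e
      using that psubset.prems assms(1) by (auto simp: dsub_def intro: finite_subset)
    have t0: "0 \<le> t" using assms(3) t by simp
    have "bexp \<Omega> p (?conn u v) \<le>
       bexp \<Omega> p (\<lambda>R. (\<Sum>e\<in>?E2. of_bool (e \<in> R) * 1) + (\<Sum>e\<in>?E. \<Sum>w\<in>e - {u, v}. of_bool (e \<in> R) * ?conn w v (R - {e})))"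
    proof (rule bexp_mono)
      fix R assume R: "R \<subseteq> \<Omega>"
      have nn: "0 \<le> (\<Sum>e\<in>?E. \<Sum>w\<in>e - {u, v}. of_bool (e \<in> R) * ?conn w v (R - {e}))"
        by (intro sum_nonneg) auto
      have nn2: "0 \<le> (\<Sum>e\<in>?E2. of_bool (e \<in> R) * 1 :: real)"
        by (intro sum_nonneg) auto
      show "?conn u v R \<le> (\<Sum>e\<in>?E2. of_bool (e \<in> R) * 1) + (\<Sum>e\<in>?E. \<Sum>w\<in>e - {u, v}. of_bool (e \<in> R) * ?conn w v (R - {e}))"
      proof (cases "(u, v) \<in> (link R)\<^sup>*")
        case True
        then obtain e w where e: "e \<in> R" "u \<in> e" "w \<in> e - {u}" "(w, v) \<in> (link (R - {e}))\<^sup>*"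
          using rtrancl_link_first_edge psubset.prems by meson
        then have eE: "e \<in> ?E" using R by auto
        show ?thesis
        proof (cases "w = v")
          case True
          then have "e \<in> ?E2" using e eE by auto
          then have "of_bool (e \<in> R) * 1 \<le> (\<Sum>e\<in>?E2. of_bool (e \<in> R) * 1 :: real)"
            using psubset.hyps by (intro member_le_sum) auto
          then show ?thesis using nn e(1) by auto
        next
          case False
          have "1 = of_bool (e \<in> R) * ?conn w v (R - {e})" using e by simp
          also have "\<dots> \<le> (\<Sum>w\<in>e - {u, v}. of_bool (e \<in> R) * ?conn w v (R - {e}))"
            using e fin[of e] eE False by (intro member_le_sum) auto
          also have "\<dots> \<le> (\<Sum>e\<in>?E. \<Sum>w\<in>e - {u, v}. of_bool (e \<in> R) * ?conn w v (R - {e}))"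
            using eE psubset.hyps
            by (intro member_le_sum[of e ?E "\<lambda>e. \<Sum>w\<in>e - {u, v}. of_bool (e \<in> R) * ?conn w v (R - {e})"])
               (auto intro!: sum_nonneg)
          finally show ?thesis using nn2 by auto
        qed
      next
        case False
        then show ?thesis using nn nn2 by auto
      qed
    qed (use assms in auto)
    also have "\<dots> = (\<Sum>e\<in>?E2. p) + (\<Sum>e\<in>?E. \<Sum>w\<in>e - {u, v}. p * bexp (\<Omega> - {e}) p (?conn w v))"
      unfolding bexp_add bexp_sum using psubset.hyps bexp_edge_and[of \<Omega> _ p "\<lambda>_. 1"]
      by (simp add: bexp_add bexp_sum bexp_edge_conn)
    also have "(\<Sum>e\<in>?E2. p) \<le> t"
    proof -
      have "real (card ?E2) \<le> real (card {e \<in> dsub d V. {u, v} \<subseteq> e})"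
        using psubset.prems assms(1) by (intro of_nat_mono card_mono) auto
      also have "\<dots> \<le> real (card V) ^ (d - 2) / fact (d - 2)"
        using card_dsub_containing[of V "{u, v}" d] psubset.prems assms by (simp add: numeral_2_eq_2)
      finally show ?thesis using mult_right_mono[OF _ assms(3)] by (fastforce simp: t)
    qed
    also have "(\<Sum>e\<in>?E. \<Sum>w\<in>e - {u, v}. p * bexp (\<Omega> - {e}) p (?conn w v)) \<le>
        (\<Sum>e\<in>?E. \<Sum>w\<in>e - {u, v}. p * (t / (1 - y)))"
    proof (intro sum_mono mult_left_mono psubset.IH)
      fix e w assume "e \<in> ?E" "w \<in> e - {u, v}"
      then show "\<Omega> - {e} \<subset> \<Omega>" "\<Omega> - {e} \<subseteq> dsub d V" "w \<in> V" "w \<noteq> v"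
        using psubset.prems by (auto simp: dsub_def)
    qed (use assms in auto)
    also have "\<dots> \<le> (\<Sum>e\<in>?E. \<Sum>w\<in>e - {u}. p * (t / (1 - y)))"
      using fin y(2) t0 assms(3) by (intro sum_mono sum_mono2) auto
    also have "\<dots> \<le> real (card V) ^ (d - 1) / fact (d - 2) * (p * (t / (1 - y)))"
      using psubset.prems assms t0 by (intro sum_dsub_vertex_le) auto
    also have "t + real (card V) ^ (d - 1) / fact (d - 2) * (p * (t / (1 - y))) = t + y * t / (1 - y)"
      by (simp add: y(1))
    also have "\<dots> = t / (1 - y)"
      using y(2) by (simp add: field_simps)
    finally show ?case by simp
  qed
qed

section \<open>Forests\<close>

text \<open>Unlike in \<open>excess\<close>, only covered vertices count, so that this depends on
  the edge set alone.\<close>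

definition set_excess :: "nat \<Rightarrow> 'a set set \<Rightarrow> int" where
  "set_excess d S = (int d - 1) * int (card S) - int (card (\<Union>S))"

text \<open>Connected edge sets have excess at least -1, so the connected pieces of a forest are
  hypertrees. In this form the property visibly passes to subsets, as Harris' inequality
  requires.\<close>

definition hforest :: "nat \<Rightarrow> 'a set set \<Rightarrow> bool" where
  "hforest d R \<longleftrightarrow> (\<forall>S\<subseteq>R. S \<noteq> {} \<longrightarrow> set_excess d S < 0)"

lemma hforest_antimono: "hforest d S \<Longrightarrow> R \<subseteq> S \<Longrightarrow> hforest d R"
  unfolding hforest_def by blast

text \<open>If the vertices of \<open>e\<close> were pairwise disconnected, \<open>e\<close> would join \<open>d\<close> vertex-disjoint pieces, each
  of negative excess or a single vertex.\<close>
lemma closing_edge_connected: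
  assumes "hforest d R" "finite R" "\<And>f. f \<in> R \<Longrightarrow> card f = d" "card e = d" "e \<notin> R" "d \<ge> 1"
    and "\<not> hforest d (insert e R)"
  shows "\<exists>u\<in>e. \<exists>v\<in>e. u \<noteq> v \<and> (u, v) \<in> (link R)\<^sup>*"
proof (rule ccontr)
  assume sep: "\<not> ?thesis"
  from assms(7) obtain S where S: "S \<subseteq> insert e R" "S \<noteq> {}" "set_excess d S \<ge> 0"
    unfolding hforest_def by (auto simp: not_less)
  have "e \<in> S"
    using S assms(1) unfolding hforest_def by (metis linorder_not_less subset_insert)
  define S' where "S' = S - {e}"
  have S': "S' \<subseteq> R" using S by (auto simp: S'_def)
  then have finS': "finite S'" using assms(2) finite_subset by blast
  have fine: "finite e" using assms(4,6) card.infinite by fastforce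
  have fing: "finite f" "f \<noteq> {}" if "f \<in> S'" for f
  proof -
    have "card f = d" using that S' assms(3) by auto
    then show "finite f" "f \<noteq> {}" using assms(6) card.infinite by fastforce+
  qed
  define reach where "reach u = {w. (u, w) \<in> (link R)\<^sup>*}" for u
  \<comment> \<open>\<open>P u\<close> consists of the edges of \<open>S'\<close> in the component
    of \<open>u\<close>, and \<open>S0\<close> of the edges that are in the component of no vertex
    of \<open>e\<close>.\<close>
  define P where "P u = {f \<in> S'. f \<inter> reach u \<noteq> {}}" for u
  define S0 where "S0 = S' - (\<Union>u\<in>e. P u)"
  have sub: "f \<subseteq> reach u" if "f \<in> P u" for f u
  proof
    fix x assume x: "x \<in> f"
    from that obtain z where z: "z \<in> f" "(u, z) \<in> (link R)\<^sup>*" "f \<in> R"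
      using S' by (auto simp: P_def reach_def)
    then have "(z, x) \<in> link R" using x by (auto simp: link_def)
    then show "x \<in> reach u" using z by (auto simp: reach_def)
  qed
  have disj: "reach u \<inter> reach v = {}" if "u \<in> e" "v \<in> e" "u \<noteq> v" for u v
  proof (rule ccontr)
    assume "reach u \<inter> reach v \<noteq> {}"
    then obtain z where "(u, z) \<in> (link R)\<^sup>*" "(v, z) \<in> (link R)\<^sup>*" by (auto simp: reach_def)
    then have "(u, v) \<in> (link R)\<^sup>*" using rtrancl_link_sym rtrancl_trans by metis
    then show False using sep that by blast
  qed
  \<comment> \<open>Including \<open>u\<close> covers the case \<open>P u = {}\<close>: every piece
    has at least one vertex more than \<open>d - 1\<close> per edge. These \<open>d\<close>
    additional vertices outweigh the \<open>d - 1\<close> that \<open>e\<close> contributes to the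
    excess.\<close>
  define W where "W u = insert u (\<Union>(P u))" for u
  have Wsub: "W u \<subseteq> reach u" for u
    using sub by (auto simp: W_def reach_def)
  have finW: "finite (W u)" for u
    using finS' fing by (auto simp: W_def P_def)
  have W: "int (card (W u)) \<ge> (int d - 1) * int (card (P u)) + 1" if "u \<in> e" for u
  proof (cases "P u = {}")
    case False
    have "P u \<subseteq> R" using S' by (auto simp: P_def)
    then have "set_excess d (P u) < 0" using False assms(1) by (auto simp: hforest_def)
    moreover have "card (\<Union>(P u)) \<le> card (W u)"
      using finW by (intro card_mono) (auto simp: W_def)
    ultimately show ?thesis by (simp add: set_excess_def)
  qed (simp add: W_def)
  have W0: "int (card (\<Union>S0)) \<ge> (int d - 1) * int (card S0)"
  proof (cases "S0 = {}")
    case False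
    have "S0 \<subseteq> R" using S' by (auto simp: S0_def)
    then have "set_excess d S0 < 0" using False assms(1) by (auto simp: hforest_def)
    then show ?thesis by (simp add: set_excess_def)
  qed simp
  have cardS': "card S' = (\<Sum>u\<in>e. card (P u)) + card S0"
  proof -
    have "card (\<Union>u\<in>e. P u) = (\<Sum>u\<in>e. card (P u))"
    proof (rule card_UN_disjoint)
      show "\<forall>u\<in>e. finite (P u)" using finS' by (auto simp: P_def)
      show "\<forall>u\<in>e. \<forall>v\<in>e. u \<noteq> v \<longrightarrow> P u \<inter> P v = {}"
      proof (intro ballI impI)
        fix u v assume uv: "u \<in> e" "v \<in> e" "u \<noteq> v"
        show "P u \<inter> P v = {}"
        proof (rule ccontr)
          assume "P u \<inter> P v \<noteq> {}"
          then obtain f where f: "f \<in> P u" "f \<in> P v" by auto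
          then have "f \<subseteq> {}" "f \<noteq> {}" using sub[of f u] sub[of f v] disj[OF uv] fing(2)[of f]
            by (auto simp: P_def)
          then show False by auto
        qed
      qed
    qed (use fine in auto)
    moreover have "S' = (\<Union>u\<in>e. P u) \<union> S0" "(\<Union>u\<in>e. P u) \<inter> S0 = {}"
      by (auto simp: S0_def P_def)
    ultimately show ?thesis using finS'
      by (metis (no_types, lifting) card_Un_disjoint finite_Un)
  qed
  have "card (\<Union>S) \<ge> card ((\<Union>u\<in>e. W u) \<union> \<Union>S0)"
  proof (rule card_mono)
    show "finite (\<Union>S)"
      using finS' fing fine \<open>e \<in> S\<close> S'_def by (metis Union_insert finite_UN finite_Un finite_Union insert_Diff)
    show "(\<Union>u\<in>e. W u) \<union> \<Union>S0 \<subseteq> \<Union>S"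
      using \<open>e \<in> S\<close> by (auto simp: W_def P_def S0_def S'_def)
  qed
  also have "card ((\<Union>u\<in>e. W u) \<union> \<Union>S0) = card (\<Union>u\<in>e. W u) + card (\<Union>S0)"
  proof (rule card_Un_disjoint)
    show "finite (\<Union>S0)" using finS' fing by (auto simp: S0_def)
    show "(\<Union>u\<in>e. W u) \<inter> \<Union>S0 = {}"
    proof (rule ccontr)
      assume "(\<Union>u\<in>e. W u) \<inter> \<Union>S0 \<noteq> {}"
      then obtain u x f where "u \<in> e" "x \<in> W u" "f \<in> S0" "x \<in> f" by auto
      then have "f \<in> P u" using Wsub by (auto simp: P_def S0_def)
      then show False using \<open>f \<in> S0\<close> \<open>u \<in> e\<close> by (auto simp: S0_def)
    qed
  qed (use fine finW in auto)
  also have "card (\<Union>u\<in>e. W u) = (\<Sum>u\<in>e. card (W u))"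
  proof (rule card_UN_disjoint)
    show "\<forall>u\<in>e. \<forall>v\<in>e. u \<noteq> v \<longrightarrow> W u \<inter> W v = {}"
      using disj Wsub by blast
  qed (use fine finW in auto)
  finally have "int (card (\<Union>S)) \<ge> (\<Sum>u\<in>e. int (card (W u))) + int (card (\<Union>S0))"
    by (simp flip: of_nat_sum of_nat_add)
  moreover have "(\<Sum>u\<in>e. int (card (W u))) \<ge> (\<Sum>u\<in>e. (int d - 1) * int (card (P u)) + 1)"
    by (intro sum_mono W)
  moreover have "(\<Sum>u\<in>e. (int d - 1) * int (card (P u)) + 1) = (int d - 1) * int (\<Sum>u\<in>e. card (P u)) + int d"
    using assms(4) by (simp add: sum.distrib sum_distrib_left)
  moreover have "int (card S) = 1 + int (\<Sum>u\<in>e. card (P u)) + int (card S0)"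
  proof -
    have "card S = Suc (card S')"
      using card_Suc_Diff1[of S e] \<open>e \<in> S\<close> finS' by (simp add: S'_def)
    then show ?thesis by (simp add: cardS')
  qed
  ultimately have "int (card (\<Union>S)) \<ge> (int d - 1) * int (card S) + 1"
  proof -
    define X Y where "X = (int d - 1) * int (\<Sum>u\<in>e. card (P u))" and "Y = (int d - 1) * int (card S0)"
    assume "(\<Sum>u\<in>e. int (card (W u))) + int (card (\<Union>S0)) \<le> int (card (\<Union>S))"
      and "(\<Sum>u\<in>e. (int d - 1) * int (card (P u)) + 1) \<le> (\<Sum>u\<in>e. int (card (W u)))"
      and "(\<Sum>u\<in>e. (int d - 1) * int (card (P u)) + 1) = (int d - 1) * int (\<Sum>u\<in>e. card (P u)) + int d"
      and cS: "int (card S) = 1 + int (\<Sum>u\<in>e. card (P u)) + int (card S0)"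
    then have "int (card (\<Union>S)) \<ge> X + int d + Y"
      using W0 unfolding X_def[symmetric] Y_def[symmetric] by linarith
    moreover have "(int d - 1) * int (card S) = int d - 1 + X + Y"
      unfolding cS X_def Y_def by (simp only: distrib_left mult_1_right)
    ultimately show ?thesis by linarith
  qed
  then show False using S(3) by (simp add: set_excess_def)
qed

text \<open>With \<open>F p\<close> the probability of a forest, Russo's formula, Harris' inequality and the bound on
  two-point connection give \<open>F' \<ge> - \<kappa> * (a / 2) * (a * p / (1 - a * p)) * F\<close>, which integrates to the
  claim.\<close>
lemma forest_prob_ge:
  fixes V :: "'a set"
  assumes V: "finite V" and d: "d \<ge> 2" and p0: "0 \<le> p0" "p0 < 1"
    and a: "a = real (card V) ^ (d - 1) / fact (d - 2)" and ap: "a * p0 < 1"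
  shows "bexp (dsub d V) p0 (\<lambda>R. of_bool (hforest d R)) \<ge>
     exp (- (1 / (1 - p0) * (1 / 2 * (- ln (1 - a * p0) - a * p0))))"
proof -
  let ?\<Omega> = "dsub d V"
  let ?n = "real (card V)"
  let ?h = "\<lambda>R. of_bool (hforest d R) :: real"
  define F where "F p = bexp ?\<Omega> p ?h" for p
  define DF where "DF p = (\<Sum>e\<in>?\<Omega>. bexp (?\<Omega> - {e}) p (\<lambda>R. ?h (insert e R) - ?h R))" for p
  \<comment> \<open>The price of passing from \<open>?\<Omega> - {e}\<close> to
    \<open>?\<Omega>\<close> is \<open>1 / (1 - p)\<close>, bounded here uniformly for
    \<open>p \<le> p0\<close> so that it is a constant in the differential inequality.\<close>
  define \<kappa> where "\<kappa> = 1 / (1 - p0)"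
  \<comment> \<open>The antiderivative of \<open>y / (2 * (1 - y))\<close> that vanishes at
    0.\<close>
  define g where "g y = 1 / 2 * (- ln (1 - y) - y)" for y :: real
  have a0: "a \<ge> 0" by (simp add: a)
  have fin\<Omega>: "finite ?\<Omega>" using V by simp
  have F_nonneg: "F p \<ge> 0" if "0 \<le> p" "p \<le> 1" for p
    unfolding F_def using that by (intro bexp_nonneg) auto
  have DF: "(F has_real_derivative DF p) (at p)" for p
    unfolding F_def DF_def using fin\<Omega> by (rule russo)
  have DF_ge: "DF p \<ge> - (\<kappa> * (a / 2 * (a * p / (1 - a * p)))) * F p" if p: "0 \<le> p" "p \<le> p0" for p
  proof -
    define y where "y = a * p"
    define t where "t = ?n ^ (d - 2) / fact (d - 2) * p"
    have y1: "y < 1" unfolding y_def using mult_left_mono[OF p(2) a0] ap by linarith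
    have t0: "t \<ge> 0" using p by (simp add: t_def)
    have p1: "p < 1" using p p0 by linarith
    have nt: "?n * t = y"
    proof -
      have "?n * ?n ^ (d - 2) = ?n ^ (d - 1)"
        using d power_Suc[of ?n "d - 2"] Suc_diff_le[of 2 d] by (simp add: numeral_2_eq_2)
      then show ?thesis by (simp add: t_def y_def a)
    qed
    have each: "bexp (?\<Omega> - {e}) p (\<lambda>R. ?h (insert e R) - ?h R) \<ge>
        - (real d * (real d - 1) / 2 * (t / (1 - y) * (\<kappa> * F p)))" if e: "e \<in> ?\<Omega>" for e
    proof -
      let ?c = "\<lambda>u v R. of_bool ((u, v) \<in> (link R)\<^sup>*) :: real"
      let ?B = "bexp (?\<Omega> - {e}) p"
      have cd: "card e = d" "finite e" "e \<subseteq> V"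
        using e V finite_subset by (auto simp: dsub_def)
      \<comment> \<open>A forest is destroyed only if \<open>e\<close> joins a connected pair. The
        double sum counts such a pair in both orders; the resulting factor \<open>1 / 2\<close> is
        the one in \<open>f_const\<close>.\<close>
      have "?B (\<lambda>R. ?h (insert e R) - ?h R) \<ge>
         ?B (\<lambda>R. - (1 / 2) * (\<Sum>u\<in>e. \<Sum>v\<in>e - {u}. ?h R * ?c u v R))"
      proof (rule bexp_mono)
        fix R assume R: "R \<subseteq> ?\<Omega> - {e}"
        let ?s = "\<lambda>u. \<Sum>v\<in>e - {u}. ?h R * ?c u v R"
        have snn: "?s u \<ge> 0" for u by (intro sum_nonneg) auto
        show "- (1 / 2) * (\<Sum>u\<in>e. ?s u) \<le> ?h (insert e R) - ?h R"
        proof (cases "hforest d R \<and> \<not> hforest d (insert e R)")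
          case True
          have "finite R" using R fin\<Omega> finite_subset by blast
          then have "\<exists>u\<in>e. \<exists>v\<in>e. u \<noteq> v \<and> (u, v) \<in> (link R)\<^sup>*"
            using True R cd d by (intro closing_edge_connected[of d R e]) (auto simp: dsub_def)
          then obtain u v where uv: "u \<in> e" "v \<in> e" "u \<noteq> v" "(u, v) \<in> (link R)\<^sup>*"
            by blast
          then have vu: "(v, u) \<in> (link R)\<^sup>*" by (simp add: rtrancl_link_sym)
          have "?h R * ?c u v R \<le> ?s u" using uv cd by (intro member_le_sum) auto
          then have "1 \<le> ?s u" using uv True by simp
          moreover have "?h R * ?c v u R \<le> ?s v" using uv cd by (intro member_le_sum) auto
          then have "1 \<le> ?s v" using vu True by simp
          moreover have "(\<Sum>w\<in>{u, v}. ?s w) \<le> (\<Sum>w\<in>e. ?s w)"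
            using uv cd snn by (intro sum_mono2) auto
          ultimately show ?thesis using True uv by simp
        next
          case False
          then have "?h (insert e R) - ?h R \<ge> 0"
            by (auto dest: hforest_antimono)
          moreover have "(\<Sum>u\<in>e. ?s u) \<ge> 0" by (intro sum_nonneg snn)
          ultimately show ?thesis by linarith
        qed
      qed (use p p1 in auto)
      also have "?B (\<lambda>R. - (1 / 2) * (\<Sum>u\<in>e. \<Sum>v\<in>e - {u}. ?h R * ?c u v R)) =
          - (1 / 2) * (\<Sum>u\<in>e. \<Sum>v\<in>e - {u}. ?B (\<lambda>R. ?h R * ?c u v R))"
        unfolding bexp_cmult bexp_sum by simp
      also have "\<dots> \<ge> - (1 / 2) * (\<Sum>u\<in>e. \<Sum>v\<in>e - {u}. \<kappa> * F p * (t / (1 - y)))"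
      proof -
        have "?B (\<lambda>R. ?h R * ?c u v R) \<le> \<kappa> * F p * (t / (1 - y))" if uv: "u \<in> e" "v \<in> e - {u}" for u v
        proof -
          have "?B (\<lambda>R. ?h R * ?c u v R) \<le> ?B ?h * ?B (?c u v)"
            using fin\<Omega> p p1 by (intro harris) (auto dest: hforest_antimono rtrancl_link_mono)
          also have "\<dots> \<le> \<kappa> * F p * (t / (1 - y))"
          proof (rule mult_mono)
            show "?B (?c u v) \<le> t / (1 - y)"
              using uv V d p p1 y1 cd
              by (intro pair_reach_prob_le[of V d]) (auto simp: y_def t_def a dsub_def)
            have "F p = p * ?B (\<lambda>R. ?h (insert e R)) + (1 - p) * ?B ?h"
              unfolding F_def using fin\<Omega> e by (rule bexp_remove)
            moreover have "?B (\<lambda>R. ?h (insert e R)) \<ge> 0"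
              using p p1 by (intro bexp_nonneg) auto
            ultimately have *: "(1 - p) * ?B ?h \<le> F p" using p by simp
            have B0: "?B ?h \<ge> 0"
              using p p1 by (intro bexp_nonneg) auto
            have "(1 - p0) * ?B ?h \<le> (1 - p) * ?B ?h"
              using p B0 by (intro mult_right_mono) auto
            then have "(1 - p0) * ?B ?h \<le> F p" using * by linarith
            then show "?B ?h \<le> \<kappa> * F p"
              using p0 by (simp add: \<kappa>_def field_simps)
            show "0 \<le> \<kappa> * F p" using F_nonneg[of p] p p1 p0 by (simp add: \<kappa>_def)
            show "0 \<le> ?B (?c u v)" using p p1 by (intro bexp_nonneg) auto
          qed
          finally show ?thesis .
        qed
        then have "(\<Sum>u\<in>e. \<Sum>v\<in>e - {u}. ?B (\<lambda>R. ?h R * ?c u v R)) \<le> (\<Sum>u\<in>e. \<Sum>v\<in>e - {u}. \<kappa> * F p * (t / (1 - y)))"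
          by (intro sum_mono) auto
        then show ?thesis by linarith
      qed
      also have "(\<Sum>u\<in>e. \<Sum>v\<in>e - {u}. \<kappa> * F p * (t / (1 - y))) = real d * (real d - 1) * (t / (1 - y) * (\<kappa> * F p))"
        using cd d by (simp add: of_nat_diff)
      finally show ?thesis by simp
    qed
    \<comment> \<open>Sum over all edges: there are at most \<open>?n ^ d / fact d\<close> of them
      with \<open>d * (d - 1) / 2\<close> pairs each, and the surplus power of \<open>?n\<close> is
      absorbed by \<open>?n * t = y\<close>.\<close>
    have "- (\<kappa> * (a / 2 * (y / (1 - y)))) * F p \<le>
       - (real (card ?\<Omega>) * (real d * (real d - 1) / 2 * (t / (1 - y) * (\<kappa> * F p))))"
    proof -
      have c: "card ?\<Omega> = card V choose d"
        using n_subsets[OF V, of d] by (simp add: dsub_def)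
      have fd: "fact d = real d * (real d - 1) * fact (d - 2)"
        using d fact_reduce[of d, where 'a = real] fact_reduce[of "d - 1", where 'a = real]
        by (simp add: of_nat_diff numeral_2_eq_2)
      have "real (card ?\<Omega>) * (real d * (real d - 1)) \<le> ?n ^ d / fact d * (real d * (real d - 1))"
        unfolding c using d by (intro mult_right_mono choose_le_power_div_fact) auto
      also have "\<dots> = ?n ^ d / fact (d - 2)"
        unfolding fd using d by simp
      also have "\<dots> = a * ?n"
        using d by (simp add: a power_eq_if[of _ d])
      finally have *: "real (card ?\<Omega>) * (real d * (real d - 1)) \<le> a * ?n" .
      have nn: "0 \<le> t / (1 - y) * (\<kappa> * F p) / 2"
        using F_nonneg[of p] p p1 p0 t0 y1 by (simp add: \<kappa>_def)
      have "real (card ?\<Omega>) * (real d * (real d - 1)) * (t / (1 - y) * (\<kappa> * F p) / 2)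
         \<le> a * ?n * (t / (1 - y) * (\<kappa> * F p) / 2)"
        using mult_right_mono[OF * nn] .
      also have "\<dots> = a * (?n * t) / (1 - y) * (\<kappa> * F p) / 2" by simp
      finally show ?thesis unfolding nt by (simp add: mult_ac)
    qed
    also have "\<dots> = (\<Sum>e\<in>?\<Omega>. - (real d * (real d - 1) / 2 * (t / (1 - y) * (\<kappa> * F p))))"
      by simp
    also have "\<dots> \<le> DF p"
      unfolding DF_def by (intro sum_mono each)
    finally show ?thesis by (simp add: y_def)
  qed
  \<comment> \<open>The integrating factor: by the differential inequality this function is
    nondecreasing, and it starts at 1.\<close>
  let ?H = "\<lambda>p. F p * exp (\<kappa> * g (a * p))"
  have "?H 0 \<le> ?H p0"
  proof (rule DERIV_nonneg_imp_nondecreasing[OF p0(1)])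
    fix p assume p: "0 \<le> p" "p \<le> p0"
    have lt: "a * p < 1" using mult_left_mono[OF p(2) a0] ap by linarith
    have "((\<lambda>p. exp (\<kappa> * g (a * p))) has_real_derivative
        exp (\<kappa> * g (a * p)) * (\<kappa> * (a / 2 * (a * p / (1 - a * p))))) (at p)"
      unfolding g_def using lt
      by (auto intro!: derivative_eq_intros simp: field_simps)
    then have "(?H has_real_derivative DF p * exp (\<kappa> * g (a * p)) +
        exp (\<kappa> * g (a * p)) * (\<kappa> * (a / 2 * (a * p / (1 - a * p)))) * F p) (at p)"
      using DERIV_mult[OF DF] by blast
    moreover have "DF p * exp (\<kappa> * g (a * p)) +
        exp (\<kappa> * g (a * p)) * (\<kappa> * (a / 2 * (a * p / (1 - a * p)))) * F p \<ge> 0"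
    proof -
      have "0 \<le> exp (\<kappa> * g (a * p)) * (DF p - - (\<kappa> * (a / 2 * (a * p / (1 - a * p)))) * F p)"
        using DF_ge[OF p] by simp
      then show ?thesis by (simp add: algebra_simps)
    qed
    ultimately show "\<exists>y. (?H has_real_derivative y) (at p) \<and> 0 \<le> y" by blast
  qed
  moreover have "?H 0 = 1"
    using fin\<Omega> by (simp add: F_def bexp_zero_prob hforest_def g_def)
  ultimately have "1 \<le> F p0 * exp (\<kappa> * g (a * p0))" by simp
  then have "exp (- (\<kappa> * g (a * p0))) \<le> F p0"
    by (simp add: exp_minus field_simps)
  then show ?thesis by (simp add: F_def \<kappa>_def g_def)
qed

section \<open>Janson's inequality and circuits\<close>

text \<open>The conditioning in the usual proof is avoided: the only correlation inequality needed is between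
  a decreasing event and the presence of a fixed set.\<close>
lemma janson:
  assumes "finite \<Omega>" "0 \<le> p" "p \<le> 1" "finite F" "\<And>C. C \<in> F \<Longrightarrow> C \<subseteq> \<Omega>"
  shows "bexp \<Omega> p (\<lambda>R. of_bool (\<forall>C\<in>F. \<not> C \<subseteq> R)) \<le>
    exp (- (\<Sum>C\<in>F. p ^ card C) + (\<Sum>C\<in>F. \<Sum>D\<in>{D \<in> F. D \<noteq> C \<and> D \<inter> C \<noteq> {}}. p ^ card (C \<union> D)))"
  using assms(4,5)
proof (induction F rule: finite_induct)
  case empty
  then show ?case using assms(1) by simp
next
  case (insert C F)
  let ?N = "\<lambda>F R. of_bool (\<forall>C\<in>F. \<not> C \<subseteq> R) :: real"
  let ?dl = "\<lambda>F C. \<Sum>D\<in>{D \<in> F. D \<noteq> C \<and> D \<inter> C \<noteq> {}}. p ^ card (C \<union> D)"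
  \<comment> \<open>The members disjoint from \<open>C\<close> are independent of its presence.
    Those meeting \<open>C\<close> are treated by a union bound, in which
    \<open>bexp_subset_le\<close> separates the presence of \<open>C \<union> D\<close> from the
    absence of \<open>E\<close>.\<close>
  define E where "E = {D \<in> F. D \<inter> C = {}}"
  define q s where "q = p ^ card C" and "s = ?dl F C"
  have C: "C \<subseteq> \<Omega>" using insert.prems by auto
  have anti: "?N G S \<le> ?N G R" if "R \<subseteq> S" for R S G
    using that by auto
  have B0: "0 \<le> bexp \<Omega> p (?N G)" for G
    using assms by (intro bexp_nonneg) auto
  have E_irr: "?N E ((R - C) \<union> C) = ?N E R" "?N E (R - C) = ?N E R" for R
  proof -
    have "D \<subseteq> (R - C) \<union> C \<longleftrightarrow> D \<subseteq> R" "D \<subseteq> R - C \<longleftrightarrow> D \<subseteq> R" if "D \<in> E" for D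
      using that by (auto simp: E_def)
    then show "?N E ((R - C) \<union> C) = ?N E R" "?N E (R - C) = ?N E R" by auto
  qed
  have EC: "bexp \<Omega> p (\<lambda>R. of_bool (C \<subseteq> R) * ?N E R) = q * bexp \<Omega> p (?N E)"
  proof -
    have "bexp (\<Omega> - C) p (\<lambda>R. ?N E (R \<union> C)) = bexp (\<Omega> - C) p (?N E)"
    proof (rule bexp_cong)
      fix R assume "R \<subseteq> \<Omega> - C"
      then have "R - C = R" by auto
      then show "?N E (R \<union> C) = ?N E R" using E_irr[of R] by simp
    qed
    also have "\<dots> = bexp \<Omega> p (?N E)"
      using assms(1) C E_irr by (intro bexp_remove_irrelevant[symmetric]) auto
    finally show ?thesis using assms(1) C by (simp add: bexp_superset q_def)
  qed
  have "bexp \<Omega> p (\<lambda>R. of_bool (C \<subseteq> R) * ?N F R) \<ge>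
      bexp \<Omega> p (\<lambda>R. of_bool (C \<subseteq> R) * ?N E R -
        (\<Sum>D\<in>{D \<in> F. D \<noteq> C \<and> D \<inter> C \<noteq> {}}. of_bool (C \<union> D \<subseteq> R) * ?N E R))"
  proof (rule bexp_mono)
    fix R assume "R \<subseteq> \<Omega>"
    let ?S = "\<Sum>D\<in>{D \<in> F. D \<noteq> C \<and> D \<inter> C \<noteq> {}}. of_bool (C \<union> D \<subseteq> R) * ?N E R"
    have S0: "?S \<ge> 0" by (intro sum_nonneg) auto
    show "of_bool (C \<subseteq> R) * ?N E R - ?S \<le> of_bool (C \<subseteq> R) * ?N F R"
    proof (cases "C \<subseteq> R \<and> (\<forall>C\<in>E. \<not> C \<subseteq> R) \<and> \<not> (\<forall>C\<in>F. \<not> C \<subseteq> R)")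
      case True
      then obtain D where D: "D \<in> F" "D \<subseteq> R" by auto
      then have "D \<in> {D \<in> F. D \<noteq> C \<and> D \<inter> C \<noteq> {}}"
        using True insert.hyps by (auto simp: E_def)
      then have "of_bool (C \<union> D \<subseteq> R) * ?N E R \<le> ?S"
        using insert.hyps by (intro member_le_sum) auto
      then show ?thesis using True D by auto
    next
      case False
      have "of_bool (C \<subseteq> R) * ?N E R \<le> of_bool (C \<subseteq> R) * ?N F R" using False by auto
      then show ?thesis using S0 by linarith
    qed
  qed (use assms in auto)
  also have "bexp \<Omega> p (\<lambda>R. of_bool (C \<subseteq> R) * ?N E R -
        (\<Sum>D\<in>{D \<in> F. D \<noteq> C \<and> D \<inter> C \<noteq> {}}. of_bool (C \<union> D \<subseteq> R) * ?N E R)) =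
      q * bexp \<Omega> p (?N E) - (\<Sum>D\<in>{D \<in> F. D \<noteq> C \<and> D \<inter> C \<noteq> {}}. bexp \<Omega> p (\<lambda>R. of_bool (C \<union> D \<subseteq> R) * ?N E R))"
    by (simp only: bexp_diff bexp_sum EC)
  also have "\<dots> \<ge> q * bexp \<Omega> p (?N E) - (\<Sum>D\<in>{D \<in> F. D \<noteq> C \<and> D \<inter> C \<noteq> {}}. p ^ card (C \<union> D) * bexp \<Omega> p (?N E))"
    using assms C insert.prems by (intro diff_left_mono sum_mono bexp_subset_le anti) auto
  also have "q * bexp \<Omega> p (?N E) - (\<Sum>D\<in>{D \<in> F. D \<noteq> C \<and> D \<inter> C \<noteq> {}}. p ^ card (C \<union> D) * bexp \<Omega> p (?N E))
      = (q - s) * bexp \<Omega> p (?N E)"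
    by (simp add: s_def left_diff_distrib sum_distrib_right)
  finally have main: "(q - s) * bexp \<Omega> p (?N E) \<le> bexp \<Omega> p (\<lambda>R. of_bool (C \<subseteq> R) * ?N F R)" .
  \<comment> \<open>For \<open>q < s\<close> the comparison of \<open>?N E\<close> with
    \<open>?N F\<close> would go the wrong way, but then the left side is at most 0.\<close>
  have "(q - s) * bexp \<Omega> p (?N F) \<le> bexp \<Omega> p (\<lambda>R. of_bool (C \<subseteq> R) * ?N F R)"
  proof (cases "q - s \<ge> 0")
    case True
    have "bexp \<Omega> p (?N F) \<le> bexp \<Omega> p (?N E)"
      using assms by (intro bexp_mono) (auto simp: E_def)
    then have "(q - s) * bexp \<Omega> p (?N F) \<le> (q - s) * bexp \<Omega> p (?N E)"
      using True by (rule mult_left_mono)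
    then show ?thesis using main by linarith
  next
    case False
    have "0 \<le> bexp \<Omega> p (\<lambda>R. of_bool (C \<subseteq> R) * ?N F R)"
      using assms by (intro bexp_nonneg) auto
    moreover have "(q - s) * bexp \<Omega> p (?N F) \<le> 0"
      using False B0[of F] by (intro mult_nonpos_nonneg) auto
    ultimately show ?thesis by linarith
  qed
  moreover have "bexp \<Omega> p (?N (insert C F)) = bexp \<Omega> p (?N F) - bexp \<Omega> p (\<lambda>R. of_bool (C \<subseteq> R) * ?N F R)"
    unfolding bexp_diff[symmetric] by (rule bexp_cong) auto
  ultimately have "bexp \<Omega> p (?N (insert C F)) \<le> bexp \<Omega> p (?N F) * (1 + (s - q))"
    by (simp add: algebra_simps)
  also have "\<dots> \<le> bexp \<Omega> p (?N F) * exp (s - q)"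
    using B0 by (intro mult_left_mono exp_ge_add_one_self)
  also have "\<dots> \<le> exp (- (\<Sum>C\<in>F. p ^ card C) + (\<Sum>C\<in>F. ?dl F C)) * exp (s - q)"
    using insert.IH insert.prems by (intro mult_right_mono) auto
  also have "\<dots> = exp (- (\<Sum>C\<in>insert C F. p ^ card C) + (s + (\<Sum>C\<in>F. ?dl F C)))"
    using insert.hyps by (simp add: q_def flip: exp_add)
  \<comment> \<open>The recursion produces each new pair in one order only; allowing both orders in
    the exponent weakens the bound and keeps the sum symmetric.\<close>
  also have "\<dots> \<le> exp (- (\<Sum>C\<in>insert C F. p ^ card C) + (\<Sum>A\<in>insert C F. ?dl (insert C F) A))"
  proof -
    have "s \<le> ?dl (insert C F) C" unfolding s_def
      using insert.hyps assms by (intro sum_mono2) auto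
    moreover have "(\<Sum>A\<in>F. ?dl F A) \<le> (\<Sum>A\<in>F. ?dl (insert C F) A)"
      using insert.hyps assms by (intro sum_mono sum_mono2) auto
    ultimately show ?thesis using insert.hyps by simp
  qed
  finally show ?case .
qed

text \<open>Having no circuit is weaker than \<open>hforest\<close>: for \<open>d \<ge> 4\<close>,
  two edges with exactly three common vertices have excess 1 and contain no circuit. Such sets are
  rare for another reason, their positive excess.\<close>

definition circuit :: "nat \<Rightarrow> 'a set set \<Rightarrow> bool" where
  "circuit d C \<longleftrightarrow> C \<noteq> {} \<and> set_excess d C = 0 \<and> (\<forall>S\<subset>C. S \<noteq> {} \<longrightarrow> set_excess d S < 0)"

text \<open>The number of edges is modular. Vertices covered by \<open>S \<inter> T\<close> are
  covered by both \<open>S\<close> and \<open>T\<close>, and this inclusion may be strict.\<close>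

lemma set_excess_supermodular:
  assumes "finite S" "finite T" "finite (\<Union>S)" "finite (\<Union>T)"
  shows "set_excess d S + set_excess d T \<le> set_excess d (S \<union> T) + set_excess d (S \<inter> T)"
proof -
  have "card (\<Union>S) + card (\<Union>T) = card (\<Union>S \<union> \<Union>T) + card (\<Union>S \<inter> \<Union>T)"
    using assms by (intro card_Un_Int)
  moreover have "card (\<Union>(S \<inter> T)) \<le> card (\<Union>S \<inter> \<Union>T)"
    using assms by (intro card_mono) auto
  moreover have "card (\<Union>S \<union> \<Union>T) = card (\<Union>(S \<union> T))" by (simp add: Union_Un_distrib)
  ultimately have 1: "int (card (\<Union>S)) + int (card (\<Union>T)) \<ge> int (card (\<Union>(S \<union> T))) + int (card (\<Union>(S \<inter> T)))"
    by linarith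
  have "int (card S) + int (card T) = int (card (S \<union> T)) + int (card (S \<inter> T))"
    using card_Un_Int[OF assms(1,2)] by simp
  then have "(int d - 1) * (int (card S) + int (card T)) = (int d - 1) * (int (card (S \<union> T)) + int (card (S \<inter> T)))"
    by simp
  then show ?thesis using 1 unfolding set_excess_def by (simp only: distrib_left)
qed

text \<open>The intersection is a nonempty proper subset of one of the circuits and so has negative
  excess; supermodularity passes the deficit on to the union.\<close>

lemma circuits_union_set_excess:
  assumes "circuit d C" "circuit d D" "C \<noteq> D" "C \<inter> D \<noteq> {}"
    and "finite C" "finite D" "finite (\<Union>C)" "finite (\<Union>D)"
  shows "set_excess d (C \<union> D) \<ge> 1"
proof -
  have "C \<inter> D \<subset> C \<or> C \<inter> D \<subset> D" using assms(3) by auto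
  then have "set_excess d (C \<inter> D) < 0" using assms(1,2,4) unfolding circuit_def by blast
  then show ?thesis
    using set_excess_supermodular[of C D d] assms unfolding circuit_def by linarith
qed

text \<open>Enlarge the covered vertices to an \<open>s\<close>-set \<open>W\<close>; the family is
  then one of the \<open>2 ^ (2 ^ s)\<close> subsets of \<open>Pow W\<close>. The crude constant is
  harmless, since \<open>s\<close> stays bounded while \<open>card V\<close> grows.\<close>

lemma card_small_span_le:
  assumes "finite V" "s \<le> card V"
  shows "card {U. U \<subseteq> dsub d V \<and> card (\<Union>U) \<le> s} \<le> card V ^ s * 2 ^ (2 ^ s)"
proof -
  let ?W = "{W. W \<subseteq> V \<and> card W = s}"
  have finW: "finite ?W" using assms(1) by simp
  have "{U. U \<subseteq> dsub d V \<and> card (\<Union>U) \<le> s} \<subseteq> (\<Union>W\<in>?W. Pow (Pow W))"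
  proof
    fix U assume "U \<in> {U. U \<subseteq> dsub d V \<and> card (\<Union>U) \<le> s}"
    then have U: "\<Union>U \<subseteq> V" "card (\<Union>U) \<le> s" by (auto simp: dsub_def)
    then obtain W where "\<Union>U \<subseteq> W" "W \<subseteq> V" "card W = s"
      using exists_subset_between[of "\<Union>U" s V] assms by auto
    then show "U \<in> (\<Union>W\<in>?W. Pow (Pow W))" by blast
  qed
  then have "card {U. U \<subseteq> dsub d V \<and> card (\<Union>U) \<le> s} \<le> card (\<Union>W\<in>?W. Pow (Pow W))"
    using assms(1) finW by (intro card_mono finite_UN_I) (auto intro: finite_subset)
  also have "\<dots> \<le> (\<Sum>W\<in>?W. card (Pow (Pow W)))"
    using finW by (rule card_UN_le)
  also have "\<dots> = (\<Sum>W\<in>?W. 2 ^ (2 ^ s))"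
    using assms(1) by (intro sum.cong refl) (auto simp: card_Pow finite_subset)
  also have "\<dots> = (card V choose s) * 2 ^ (2 ^ s)"
    using n_subsets[OF assms(1), of s] by simp
  also have "\<dots> \<le> card V ^ s * 2 ^ (2 ^ s)"
    using binomial_le_pow[OF assms(2)] by simp
  finally show ?thesis .
qed

section \<open>First moments of dense edge sets\<close>

definition dense_sets :: "nat \<Rightarrow> 'a set \<Rightarrow> nat \<Rightarrow> nat \<Rightarrow> 'a set set set" where
  "dense_sets d V L j = {U. U \<subseteq> dsub d V \<and> 1 \<le> card U \<and> card U \<le> L \<and> int j \<le> set_excess d U}"

lemma finite_dense_sets: "finite V \<Longrightarrow> finite (dense_sets d V L j)"
  by (rule finite_subset[of _ "Pow (dsub d V)"]) (auto simp: dense_sets_def)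

definition dense_bound :: "nat \<Rightarrow> real \<Rightarrow> nat \<Rightarrow> real" where
  "dense_bound d B L = (\<Sum>m=1..L. B ^ m * 2 ^ (2 ^ ((d - 1) * m)))"

text \<open>Sets of \<open>m\<close> edges with excess at least \<open>j\<close> cover at most
  \<open>(d - 1) * m - j\<close> vertices, so each unit of excess gains a factor
  \<open>1 / card V\<close>. The case \<open>j = 0\<close> bounds the expected number of circuits,
  and \<open>j = 1\<close> shows that positive excess is rare.\<close>

lemma sum_dense_sets_le:
  assumes "finite V" "d \<ge> 2" "0 \<le> p" "j \<le> 1" "(d - 1) * L \<le> card V" "1 \<le> card V"
    and B: "real (card V) ^ (d - 1) * p \<le> B"
  shows "(\<Sum>U\<in>dense_sets d V L j. p ^ card U) \<le> dense_bound d B L / real (card V) ^ j"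
proof -
  let ?n = "real (card V)"
  let ?D = "\<lambda>m. {U \<in> dense_sets d V L j. card U = m}"
  have each: "(\<Sum>U\<in>?D m. p ^ card U) \<le> B ^ m * 2 ^ (2 ^ ((d - 1) * m)) / ?n ^ j" if m: "m \<in> {1..L}" for m
  proof -
    \<comment> \<open>Since \<open>j \<le> 1\<close> and \<open>m \<ge> 1\<close>, the subtraction
      is not truncated.\<close>
    let ?s = "(d - 1) * m - j"
    have dm: "1 \<le> (d - 1) * m" using m assms(2) by (simp add: Suc_leI)
    have s: "?s \<le> card V"
    proof -
      have "(d - 1) * m \<le> (d - 1) * L" using m by (intro mult_le_mono2) auto
      then show ?thesis using assms(5) by linarith
    qed
    have "?D m \<subseteq> {U. U \<subseteq> dsub d V \<and> card (\<Union>U) \<le> ?s}"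
    proof
      fix U assume U: "U \<in> ?D m"
      then have "int j \<le> (int d - 1) * int m - int (card (\<Union>U))"
        by (auto simp: dense_sets_def set_excess_def)
      also have "(int d - 1) * int m = int ((d - 1) * m)" using assms(2) by (simp add: of_nat_diff)
      finally have "card (\<Union>U) \<le> ?s" by linarith
      then show "U \<in> {U. U \<subseteq> dsub d V \<and> card (\<Union>U) \<le> ?s}"
        using U by (auto simp: dense_sets_def)
    qed
    then have "card (?D m) \<le> card {U. U \<subseteq> dsub d V \<and> card (\<Union>U) \<le> ?s}"
      using assms(1) by (intro card_mono) (auto intro: finite_subset[of _ "Pow (dsub d V)"])
    also have "\<dots> \<le> card V ^ ?s * 2 ^ (2 ^ ?s)"
      by (rule card_small_span_le[OF assms(1) s])
    also have "\<dots> \<le> card V ^ ?s * 2 ^ (2 ^ ((d - 1) * m))"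
      by (intro mult_left_mono power_increasing) auto
    finally have "real (card (?D m)) \<le> ?n ^ ?s * 2 ^ (2 ^ ((d - 1) * m))"
      using of_nat_mono[where 'a = real] by fastforce
    moreover have "?n ^ ?s = ?n ^ ((d - 1) * m) / ?n ^ j"
      using assms(6) order_trans[OF assms(4) dm] by (intro power_diff) auto
    ultimately have card: "real (card (?D m)) \<le> (?n ^ (d - 1)) ^ m / ?n ^ j * 2 ^ (2 ^ ((d - 1) * m))"
      by (simp add: power_mult)
    have "(\<Sum>U\<in>?D m. p ^ card U) = real (card (?D m)) * p ^ m" by simp
    also have "\<dots> \<le> (?n ^ (d - 1)) ^ m / ?n ^ j * 2 ^ (2 ^ ((d - 1) * m)) * p ^ m"
      using assms(3) by (intro mult_right_mono card) auto
    also have "\<dots> = (?n ^ (d - 1) * p) ^ m * 2 ^ (2 ^ ((d - 1) * m)) / ?n ^ j"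
      by (simp add: power_mult_distrib)
    also have "\<dots> \<le> B ^ m * 2 ^ (2 ^ ((d - 1) * m)) / ?n ^ j"
      using assms(3) B by (intro divide_right_mono mult_right_mono power_mono) auto
    finally show ?thesis .
  qed
  have "(\<Sum>U\<in>dense_sets d V L j. p ^ card U) = (\<Sum>m\<in>{1..L}. \<Sum>U\<in>?D m. p ^ card U)"
    using assms(1) by (intro sum.group[symmetric] finite_dense_sets) (auto simp: dense_sets_def)
  also have "\<dots> \<le> (\<Sum>m\<in>{1..L}. B ^ m * 2 ^ (2 ^ ((d - 1) * m)) / ?n ^ j)"
    by (intro sum_mono each)
  finally show ?thesis by (simp add: dense_bound_def sum_divide_distrib)
qed

definition circuits_upto :: "nat \<Rightarrow> 'a set \<Rightarrow> nat \<Rightarrow> 'a set set set" where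
  "circuits_upto d V K = {C. C \<subseteq> dsub d V \<and> card C \<le> K \<and> circuit d C}"

lemma dsub_finite_facts:
  assumes "finite V" "U \<subseteq> dsub d V"
  shows "finite U" "finite (\<Union>U)" "\<Union>U \<subseteq> V"
proof -
  show "\<Union>U \<subseteq> V" using assms by (auto simp: dsub_def)
  then show "finite (\<Union>U)" using assms(1) by (rule finite_subset)
  show "finite U" using assms finite_subset finite_dsub by blast
qed

lemma circuits_upto_dense: "finite V \<Longrightarrow> circuits_upto d V K \<subseteq> dense_sets d V K 0"
  using dsub_finite_facts[of V]
  by (auto simp: circuits_upto_def dense_sets_def circuit_def Suc_le_eq card_gt_0_iff)

text \<open>Group the pairs by their union \<open>U\<close>, which has positive excess and at most
  \<open>2 * K\<close> edges. A set \<open>U\<close> arises from at most \<open>4 ^ card U\<close>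
  pairs of its subsets.\<close>

lemma overlapping_circuits_sum_le:
  fixes p :: real
  assumes "finite V" "0 \<le> p"
  shows "(\<Sum>C\<in>circuits_upto d V K. \<Sum>D\<in>{D \<in> circuits_upto d V K. D \<noteq> C \<and> D \<inter> C \<noteq> {}}. p ^ card (C \<union> D))
      \<le> 4 ^ (2 * K) * (\<Sum>U\<in>dense_sets d V (2 * K) 1. p ^ card U)"
proof -
  let ?F = "circuits_upto d V K"
  let ?A = "Sigma ?F (\<lambda>C. {D \<in> ?F. D \<noteq> C \<and> D \<inter> C \<noteq> {}})"
  let ?U = "dense_sets d V (2 * K) 1"
  let ?B = "Sigma ?U (\<lambda>U. Pow U \<times> Pow U)"
  have finF: "finite ?F"
    using finite_subset[OF circuits_upto_dense finite_dense_sets] assms(1) by blast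
  have finU: "finite ?U" using assms(1) by (rule finite_dense_sets)
  have finU': "finite U" if "U \<in> ?U" for U
    using that assms(1) dsub_finite_facts by (auto simp: dense_sets_def)
  have "(\<Sum>C\<in>?F. \<Sum>D\<in>{D \<in> ?F. D \<noteq> C \<and> D \<inter> C \<noteq> {}}. p ^ card (C \<union> D)) = (\<Sum>(C, D)\<in>?A. p ^ card (C \<union> D))"
    using finF by (simp add: sum.Sigma)
  also have "\<dots> = (\<Sum>(U, C, D)\<in>(\<lambda>(C, D). (C \<union> D, C, D)) ` ?A. p ^ card U)"
    by (subst sum.reindex) (auto simp: inj_on_def case_prod_unfold)
  also have "\<dots> \<le> (\<Sum>(U, C, D)\<in>?B. p ^ card U)"
  proof (rule sum_mono2)
    show "finite ?B" using finU finU' by auto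
    show "(\<lambda>(C, D). (C \<union> D, C, D)) ` ?A \<subseteq> ?B"
    proof
      fix x assume "x \<in> (\<lambda>(C, D). (C \<union> D, C, D)) ` ?A"
      then obtain C D where x: "x = (C \<union> D, C, D)"
        and CD: "C \<in> ?F" "D \<in> ?F" "D \<noteq> C" "D \<inter> C \<noteq> {}" by auto
      then have *: "C \<subseteq> dsub d V" "D \<subseteq> dsub d V" "circuit d C" "circuit d D" "card C \<le> K" "card D \<le> K"
        by (auto simp: circuits_upto_def)
      note fin = dsub_finite_facts[OF assms(1) *(1)] dsub_finite_facts[OF assms(1) *(2)]
      have "set_excess d (C \<union> D) \<ge> 1"
        using * CD fin by (intro circuits_union_set_excess) auto
      moreover have "card (C \<union> D) \<le> 2 * K"
        using card_Un_le[of C D] * by linarith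
      moreover have "1 \<le> card (C \<union> D)"
        using fin CD by (auto simp: Suc_le_eq card_gt_0_iff)
      ultimately have "C \<union> D \<in> ?U" using * by (auto simp: dense_sets_def)
      then show "x \<in> ?B" by (auto simp: x)
    qed
  qed (use assms in auto)
  also have "\<dots> = (\<Sum>U\<in>?U. \<Sum>(C, D)\<in>Pow U \<times> Pow U. p ^ card U)"
    using finU finU' by (subst sum.Sigma) auto
  also have "\<dots> = (\<Sum>U\<in>?U. 4 ^ card U * p ^ card U)"
  proof (intro sum.cong refl)
    fix U assume "U \<in> ?U"
    then show "(\<Sum>(C, D)\<in>Pow U \<times> Pow U. p ^ card U) = 4 ^ card U * p ^ card U"
      using finU'[of U] power_mult_distrib[of "2 :: real" 2 "card U"]
      by (simp add: case_prod_unfold card_cartesian_product card_Pow)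
  qed
  also have "\<dots> \<le> (\<Sum>U\<in>?U. 4 ^ (2 * K) * p ^ card U)"
    using assms by (intro sum_mono mult_right_mono power_increasing) (auto simp: dense_sets_def)
  finally show ?thesis by (simp add: sum_distrib_left)
qed

section \<open>Circuits and unicyclic components\<close>

definition unicycle_free :: "nat \<Rightarrow> 'a set \<Rightarrow> 'a set set \<Rightarrow> bool" where
  "unicycle_free d V R \<longleftrightarrow> (\<forall>C\<in>components (Hypergraph V R). \<not> unicycle d C)"

text \<open>If not, the edges in the component of \<open>u\<close> and the remaining ones form two
  nonempty parts without common vertices. The excess is additive over them and negative on both,
  whereas that of \<open>C\<close> is 0.\<close>

lemma circuit_connected:
  assumes "circuit d C" "finite C" "finite (\<Union>C)" "\<And>e. e \<in> C \<Longrightarrow> e \<noteq> {}" "u \<in> \<Union>C" "v \<in> \<Union>C"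
  shows "(u, v) \<in> (link C)\<^sup>*"
proof (rule ccontr)
  assume nc: "\<not> ?thesis"
  define W where "W = {w. (u, w) \<in> (link C)\<^sup>*}"
  define S where "S = {e \<in> C. e \<inter> W \<noteq> {}}"
  have sub: "e \<subseteq> W" if "e \<in> S" for e
  proof
    fix x assume x: "x \<in> e"
    obtain z where "z \<in> e" "(u, z) \<in> (link C)\<^sup>*" "e \<in> C" using \<open>e \<in> S\<close> by (auto simp: S_def W_def)
    moreover then have "(z, x) \<in> link C" using x by (auto simp: link_def)
    ultimately show "x \<in> W" by (auto simp: W_def)
  qed
  have "u \<in> W" "v \<notin> W" using nc by (auto simp: W_def)
  then have "S \<noteq> {}" "S \<noteq> C" using sub assms(5,6) by (auto simp: S_def)
  then have "S \<subset> C" "S \<noteq> {}" "C - S \<subset> C" "C - S \<noteq> {}" by (auto simp: S_def)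
  then have neg: "set_excess d S < 0" "set_excess d (C - S) < 0" using assms(1) unfolding circuit_def by blast+
  have SC: "S \<subseteq> C" by (auto simp: S_def)
  have "\<Union>C = \<Union>S \<union> \<Union>(C - S)" using SC by auto
  moreover have "\<Union>S \<inter> \<Union>(C - S) = {}" using sub by (auto simp: S_def)
  ultimately have "card (\<Union>C) = card (\<Union>S) + card (\<Union>(C - S))"
    using assms(3) by (simp add: card_Un_disjoint)
  moreover have "card C = card S + card (C - S)"
    using assms(2) SC by (metis card_Diff_subset card_mono finite_subset le_add_diff_inverse)
  ultimately have "set_excess d C = set_excess d S + set_excess d (C - S)"
    by (simp add: set_excess_def algebra_simps)
  then show False using neg assms(1) by (simp add: circuit_def)
qed

text \<open>A connected edge set that contains all edges meeting it is the edge set of a component.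
  Read contrapositively, a connected set of excess 0 can be enlarged as long as there is no
  unicyclic component.\<close>

lemma closed_zero_excess_unicycle:
  assumes "finite V" "R \<subseteq> dsub d V" "d \<ge> 1" "S \<subseteq> R" "S \<noteq> {}" "set_excess d S = 0"
    and "u \<in> \<Union>S" "\<And>v. v \<in> \<Union>S \<Longrightarrow> (u, v) \<in> (link R)\<^sup>*"
    and "\<And>e. e \<in> R \<Longrightarrow> e \<inter> \<Union>S \<noteq> {} \<Longrightarrow> e \<in> S"
  shows "\<not> unicycle_free d V R"
proof -
  let ?H = "Hypergraph V R"
  have ne: "e \<noteq> {}" if "e \<in> R" for e using that assms(2,3) by (auto simp: dsub_def)
  have SV: "\<Union>S \<subseteq> V" using assms(2,4) by (auto simp: dsub_def)
  have closed: "w \<in> \<Union>S \<and> (z, w) \<in> (link S)\<^sup>*" if "(z, w) \<in> (link R)\<^sup>*" "z \<in> \<Union>S" for z w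
    using that(1)
  proof (induction rule: rtrancl_induct)
    case base
    then show ?case using that by auto
  next
    case (step y w)
    then obtain e where e: "e \<in> R" "y \<in> e" "w \<in> e" by (auto simp: link_def)
    then have "e \<in> S" using step assms(9) by blast
    then have "(y, w) \<in> link S" "w \<in> \<Union>S" using e by (auto simp: link_def)
    then show ?case using step by (auto intro: rtrancl_into_rtrancl)
  qed
  have C: "{w \<in> V. (u, w) \<in> (link R)\<^sup>*} = \<Union>S"
    using closed assms(7,8) SV by blast
  have E: "{e \<in> R. e \<subseteq> \<Union>S} = S"
  proof
    show "{e \<in> R. e \<subseteq> \<Union>S} \<subseteq> S"
    proof
      fix e assume "e \<in> {e \<in> R. e \<subseteq> \<Union>S}"
      then have "e \<in> R" "e \<inter> \<Union>S = e" by auto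
      then show "e \<in> S" using assms(9)[of e] ne[of e] by simp
    qed
  qed (use assms(4) in auto)
  have comp: "component_of ?H u = Hypergraph (\<Union>S) S"
    by (simp add: component_of_def adj_link C E)
  have "uniform d (Hypergraph (\<Union>S) S)"
    using assms(1,2,4) SV finite_subset by (auto simp: uniform_def dsub_def)
  moreover have "connected_hg (Hypergraph (\<Union>S) S)"
    unfolding connected_hg_def adj_link
  proof (intro conjI ballI)
    fix v w assume "v \<in> verts (Hypergraph (\<Union>S) S)" "w \<in> verts (Hypergraph (\<Union>S) S)"
    then have "v \<in> \<Union>S" "w \<in> \<Union>S" by simp_all
    then have "(u, v) \<in> (link S)\<^sup>*" "(u, w) \<in> (link S)\<^sup>*" using closed assms(7,8) by blast+
    then show "(v, w) \<in> (link (edges (Hypergraph (\<Union>S) S)))\<^sup>*"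
      by (simp add: rtrancl_link_sym) (meson rtrancl_link_sym rtrancl_trans)
  qed (use assms(7) in auto)
  moreover have "excess d (Hypergraph (\<Union>S) S) = 0"
    using assms(6) by (simp add: excess_def set_excess_def)
  ultimately have "unicycle d (component_of ?H u)" by (simp add: unicycle_def comp)
  moreover have "component_of ?H u \<in> components ?H"
    using assms(7) SV by (auto simp: components_def)
  ultimately show ?thesis by (auto simp: unicycle_free_def)
qed

text \<open>A component without edges has negative excess, so a unicycle has an edge. Its edges
  cover at most its vertices, hence their \<open>set_excess\<close> is nonnegative.\<close>

lemma hforest_unicycle_free:
  assumes "finite V" "R \<subseteq> dsub d V" "hforest d R"
  shows "unicycle_free d V R"
  unfolding unicycle_free_def
proof (intro ballI notI)
  fix C assume C: "C \<in> components (Hypergraph V R)" "unicycle d C"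
  have sub: "edges C \<subseteq> R" "\<Union>(edges C) \<subseteq> verts C" "verts C \<subseteq> V"
    using C(1) by (auto simp: components_def component_of_def Let_def)
  have fin: "finite (verts C)" "verts C \<noteq> {}" "excess d C = 0"
    using C(2) by (auto simp: unicycle_def uniform_def connected_hg_def)
  have "edges C \<noteq> {}" using fin by (auto simp: excess_def)
  then have "set_excess d (edges C) < 0" using assms(3) sub by (auto simp: hforest_def)
  moreover have "card (\<Union>(edges C)) \<le> card (verts C)" using sub fin by (intro card_mono)
  ultimately show False using fin(3) by (simp add: set_excess_def excess_def)
qed

text \<open>Enlarge \<open>C\<close> edge by edge inside its component. The excess never decreases; as long as it stays
  \<open>0\<close> the edge set is not closed, since otherwise it would be a unicyclic component.\<close>
lemma unicycle_free_grows:
  assumes "finite V" "R \<subseteq> dsub d V" "d \<ge> 2" "circuit d C" "C \<subseteq> R" "card C \<le> L"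
    and free: "unicycle_free d V R"
    and small: "\<And>U. U \<subseteq> R \<Longrightarrow> U \<notin> dense_sets d V L 1"
  shows "L \<le> card {v \<in> V. \<exists>u\<in>\<Union>C. (u, v) \<in> (link R)\<^sup>*}"
proof -
  have ne: "e \<noteq> {}" if "e \<in> R" for e using that assms(2,3) by (auto simp: dsub_def)
  have CV: "C \<subseteq> dsub d V" using assms by auto
  note finC = dsub_finite_facts[OF assms(1) CV]
  have "C \<noteq> {}" using assms(4) by (simp add: circuit_def)
  then obtain e where "e \<in> C" by auto
  moreover then have "e \<noteq> {}" using assms(5) ne by auto
  ultimately obtain u where u: "u \<in> \<Union>C" by auto
  define W where "W = {w. (u, w) \<in> (link R)\<^sup>*}"
  define A where "A = {S. C \<subseteq> S \<and> S \<subseteq> R \<and> card S \<le> L \<and> set_excess d S \<ge> 0 \<and> \<Union>S \<subseteq> W}"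
  have finR: "finite R" using dsub_finite_facts[OF assms(1,2)] by simp
  have "\<Union>C \<subseteq> W"
  proof
    fix v assume "v \<in> \<Union>C"
    then have "(u, v) \<in> (link C)\<^sup>*"
      using assms(4) finC u ne assms(5) by (intro circuit_connected[of d C]) blast+
    then show "v \<in> W" using rtrancl_link_mono[OF _ assms(5)] by (auto simp: W_def)
  qed
  then have "C \<in> A" using assms by (auto simp: A_def circuit_def)
  moreover have "finite A"
    by (rule finite_subset[of _ "Pow R"]) (use finR in \<open>auto simp: A_def\<close>)
  moreover from calculation have "Max (card ` A) \<in> card ` A" by (intro Max_in) auto
  ultimately obtain S where S: "S \<in> A" "\<And>T. T \<in> A \<Longrightarrow> card T \<le> card S"
    by (metis (no_types, lifting) Max_ge finite_imageI imageE imageI)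
  then have S': "C \<subseteq> S" "S \<subseteq> R" "card S \<le> L" "set_excess d S \<ge> 0" "\<Union>S \<subseteq> W" by (auto simp: A_def)
  have SV: "S \<subseteq> dsub d V" using S' assms by auto
  note finS = dsub_finite_facts[OF assms(1) SV]
  have "S \<noteq> {}" using \<open>C \<noteq> {}\<close> S' by auto
  then have c1: "1 \<le> card S" using finS by (simp add: Suc_le_eq card_gt_0_iff)
  have zero: "set_excess d S = 0"
    using small[OF S'(2)] S' SV c1 by (auto simp: dense_sets_def)
  have "card S = L"
  proof (rule ccontr)
    assume "card S \<noteq> L"
    then have lt: "card S < L" using S' by simp
    have "e \<in> S" if e: "e \<in> R" "e \<inter> \<Union>S \<noteq> {}" for e
    proof (rule ccontr)
      assume "e \<notin> S"
      have "e \<subseteq> V" and ce: "card e = d" using e assms(2) by (auto simp: dsub_def)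
      then have "finite e" using assms(1) finite_subset by blast
      note ce = ce this
      \<comment> \<open>As \<open>e\<close> shares a vertex with \<open>S\<close>, it adds at most
        \<open>d - 1\<close> vertices, which its own contribution \<open>d - 1\<close> to the excess
        compensates.\<close>
      have "card (\<Union>(insert e S)) + card (e \<inter> \<Union>S) = card e + card (\<Union>S)"
        using card_Un_Int[of e "\<Union>S"] ce finS by simp
      moreover have "1 \<le> card (e \<inter> \<Union>S)" using e ce by (simp add: Suc_le_eq card_gt_0_iff)
      ultimately have le: "int (card (\<Union>(insert e S))) \<le> int d - 1 + int (card (\<Union>S))" using ce by linarith
      have "int (card (insert e S)) = 1 + int (card S)" using \<open>e \<notin> S\<close> finS by simp
      then have "(int d - 1) * int (card (insert e S)) = (int d - 1) + (int d - 1) * int (card S)"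
        by (simp only: distrib_left mult_1_right)
      then have "set_excess d (insert e S) \<ge> 0" using le zero by (simp only: set_excess_def)
      moreover have "e \<subseteq> W"
      proof
        fix x assume "x \<in> e"
        obtain z where "z \<in> e" "z \<in> W" using e S' by blast
        then show "x \<in> W" using \<open>x \<in> e\<close> e(1) unfolding W_def
          by (auto simp: link_def intro: rtrancl_into_rtrancl)
      qed
      ultimately have "insert e S \<in> A" using S' e lt finS \<open>e \<notin> S\<close> by (auto simp: A_def)
      then have "card (insert e S) \<le> card S" by (rule S(2))
      then show False using \<open>e \<notin> S\<close> finS by simp
    qed
    then have "\<not> unicycle_free d V R"
      using assms(1,2,3) S' \<open>S \<noteq> {}\<close> zero u
      by (intro closed_zero_excess_unicycle[of V R d S u]) (auto simp: W_def)
    then show False using free by simp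
  qed
  \<comment> \<open>Excess 0 converts the \<open>L\<close> edges into \<open>(d - 1) * L\<close>
    vertices.\<close>
  have "int L \<le> (int d - 1) * int (card S)" using assms(3) \<open>card S = L\<close> by (simp add: mult_le_cancel_right1)
  then have "L \<le> card (\<Union>S)" using zero by (simp add: set_excess_def)
  also have "\<dots> \<le> card {v \<in> V. \<exists>u\<in>\<Union>C. (u, v) \<in> (link R)\<^sup>*}"
  proof (intro card_mono subsetI)
    fix v assume "v \<in> \<Union>S"
    then have "v \<in> V" "(u, v) \<in> (link R)\<^sup>*" using finS S'(5) by (auto simp: W_def)
    then show "v \<in> {v \<in> V. \<exists>u\<in>\<Union>C. (u, v) \<in> (link R)\<^sup>*}" using u by blast
  qed (use assms(1) in simp)
  finally show ?thesis .
qed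

text \<open>Cut the path after its last edge that is in \<open>C\<close>.\<close>

lemma reach_from_added_edges:
  assumes "(u, v) \<in> (link (R \<union> C))\<^sup>*" "u \<in> \<Union>C"
  shows "\<exists>w\<in>\<Union>C. (w, v) \<in> (link R)\<^sup>*"
  using assms(1)
proof (induction rule: rtrancl_induct)
  case base
  then show ?case using assms(2) by blast
next
  case (step y z)
  from step.hyps(2) obtain e where e: "e \<in> R \<union> C" "y \<in> e" "z \<in> e" by (auto simp: link_def)
  show ?case
  proof (cases "e \<in> C")
    case True
    then show ?thesis using e by blast
  next
    case False
    then have "(y, z) \<in> link R" using e by (auto simp: link_def)
    then show ?thesis using step.IH by (meson rtrancl_into_rtrancl)
  qed
qed

text \<open>Once \<open>C\<close> is required to be present, the other edges are still independent,
  and by \<open>reach_from_added_edges\<close> the component of \<open>C\<close> is covered by the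
  components of its vertices in those edges.\<close>

lemma circuit_reach_expectation_le:
  assumes "finite V" "d \<ge> 2" "0 \<le> p" "p \<le> 1"
    and y: "y = real (card V) ^ (d - 1) / fact (d - 2) * p" "y < 1"
    and C: "C \<subseteq> dsub d V"
  shows "bexp (dsub d V) p (\<lambda>R. of_bool (C \<subseteq> R) * real (card {v \<in> V. \<exists>u\<in>\<Union>C. (u, v) \<in> (link R)\<^sup>*}))
     \<le> p ^ card C * (real (card (\<Union>C)) / (1 - y))"
proof -
  let ?\<Omega> = "dsub d V"
  note finC = dsub_finite_facts[OF assms(1) C]
  have "bexp ?\<Omega> p (\<lambda>R. of_bool (C \<subseteq> R) * real (card {v \<in> V. \<exists>u\<in>\<Union>C. (u, v) \<in> (link R)\<^sup>*}))
     = p ^ card C * bexp (?\<Omega> - C) p (\<lambda>R. real (card {v \<in> V. \<exists>u\<in>\<Union>C. (u, v) \<in> (link (R \<union> C))\<^sup>*}))"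
    using assms(1) C by (intro bexp_superset) auto
  also have "\<dots> \<le> p ^ card C * bexp (?\<Omega> - C) p (\<lambda>R. \<Sum>w\<in>\<Union>C. \<Sum>v\<in>V. of_bool ((w, v) \<in> (link R)\<^sup>*))"
  proof (intro mult_left_mono bexp_mono)
    fix R assume "R \<subseteq> ?\<Omega> - C"
    have "real (card {v \<in> V. \<exists>u\<in>\<Union>C. (u, v) \<in> (link (R \<union> C))\<^sup>*}) =
        (\<Sum>v\<in>V. of_bool (\<exists>u\<in>\<Union>C. (u, v) \<in> (link (R \<union> C))\<^sup>*))"
      using assms(1) by (simp add: Int_def)
    also have "\<dots> \<le> (\<Sum>v\<in>V. \<Sum>w\<in>\<Union>C. of_bool ((w, v) \<in> (link R)\<^sup>*))"
    proof (intro sum_mono)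
      fix v
      show "of_bool (\<exists>u\<in>\<Union>C. (u, v) \<in> (link (R \<union> C))\<^sup>*) \<le> (\<Sum>w\<in>\<Union>C. of_bool ((w, v) \<in> (link R)\<^sup>*) :: real)"
      proof (cases "\<exists>u\<in>\<Union>C. (u, v) \<in> (link (R \<union> C))\<^sup>*")
        case True
        then obtain u where "u \<in> \<Union>C" "(u, v) \<in> (link (R \<union> C))\<^sup>*" by (elim bexE)
        from reach_from_added_edges[OF this(2,1)]
        obtain w where w: "w \<in> \<Union>C" "(w, v) \<in> (link R)\<^sup>*" by (elim bexE)
        have "of_bool ((w, v) \<in> (link R)\<^sup>*) \<le> (\<Sum>w\<in>\<Union>C. of_bool ((w, v) \<in> (link R)\<^sup>*) :: real)"
          using w finC by (intro member_le_sum) auto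
        then show ?thesis using w by (simp del: sum_of_bool_eq)
      next
        case False
        then show ?thesis by (simp only: of_bool_eq) (intro sum_nonneg, auto)
      qed
    qed
    also have "\<dots> = (\<Sum>w\<in>\<Union>C. \<Sum>v\<in>V. of_bool ((w, v) \<in> (link R)\<^sup>*))" by (rule sum.swap)
    finally show "real (card {v \<in> V. \<exists>u\<in>\<Union>C. (u, v) \<in> (link (R \<union> C))\<^sup>*}) \<le> \<dots>" .
  qed (use assms in auto)
  also have "\<dots> = p ^ card C * (\<Sum>w\<in>\<Union>C. \<Sum>v\<in>V. bexp (?\<Omega> - C) p (\<lambda>R. of_bool ((w, v) \<in> (link R)\<^sup>*)))"
    by (simp only: bexp_sum)
  also have "\<dots> \<le> p ^ card C * (\<Sum>w\<in>\<Union>C. 1 / (1 - y))"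
    using assms finC by (intro mult_left_mono sum_mono sum_reach_prob_le[of V d]) auto
  finally show ?thesis by simp
qed

text \<open>If no short circuit is present, Janson's inequality applies, with overlapping pairs as
  its error term. Otherwise \<open>unicycle_free_grows\<close> leaves two cases: a set of positive
  excess, rare by its first moment, or a short circuit whose component has at least \<open>L\<close>
  vertices, unlikely by Markov's inequality. The room for \<open>2 * L\<close> edges in
  \<open>V\<close> also accommodates unions of two circuits.\<close>

lemma unicycle_free_prob_le:
  assumes "finite V" "d \<ge> 2" "0 \<le> p" "p \<le> 1" "1 \<le> K" "K \<le> L" "(d - 1) * (2 * L) \<le> card V"
    and y: "y = real (card V) ^ (d - 1) / fact (d - 2) * p" "y < 1"
    and B: "real (card V) ^ (d - 1) * p \<le> B"
  shows "bexp (dsub d V) p (\<lambda>R. of_bool (unicycle_free d V R)) \<le>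
     exp (- (\<Sum>C\<in>circuits_upto d V K. p ^ card C) + 4 ^ (2 * K) * (dense_bound d B (2 * K) / real (card V)))
     + dense_bound d B L / real (card V)
     + dense_bound d B K * (real (d * K) / (1 - y)) / real L"
proof -
  let ?\<Omega> = "dsub d V"
  let ?n = "real (card V)"
  let ?F = "circuits_upto d V K"
  let ?r = "\<lambda>C R. real (card {v \<in> V. \<exists>u\<in>\<Union>C. (u, v) \<in> (link R)\<^sup>*})"
  have fin\<Omega>: "finite ?\<Omega>" using assms(1) by simp
  have finF: "finite ?F"
    using finite_subset[OF circuits_upto_dense finite_dense_sets] assms(1) by blast
  have L: "1 \<le> L" using assms by linarith
  have "2 * L \<le> (d - 1) * (2 * L)" using assms(2) by (cases "d - 1") auto
  then have n1: "1 \<le> card V" using assms(7) L by linarith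
  have dK: "(d - 1) * (2 * K) \<le> card V" "(d - 1) * K \<le> card V" "(d - 1) * L \<le> card V"
  proof -
    have "(d - 1) * (2 * K) \<le> (d - 1) * (2 * L)" "(d - 1) * K \<le> (d - 1) * (2 * L)"
      "(d - 1) * L \<le> (d - 1) * (2 * L)"
      using assms(6) by (intro mult_le_mono2; simp)+
    then show "(d - 1) * (2 * K) \<le> card V" "(d - 1) * K \<le> card V" "(d - 1) * L \<le> card V"
      using assms(7) by linarith+
  qed
  have "bexp ?\<Omega> p (\<lambda>R. of_bool (unicycle_free d V R)) \<le>
     bexp ?\<Omega> p (\<lambda>R. of_bool (\<forall>C\<in>?F. \<not> C \<subseteq> R) + (\<Sum>U\<in>dense_sets d V L 1. of_bool (U \<subseteq> R))
       + (\<Sum>C\<in>?F. 1 / real L * (of_bool (C \<subseteq> R) * ?r C R)))"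
  proof (rule bexp_mono)
    fix R assume R: "R \<subseteq> ?\<Omega>"
    let ?D = "\<Sum>U\<in>dense_sets d V L 1. of_bool (U \<subseteq> R) :: real"
    let ?M = "\<Sum>C\<in>?F. 1 / real L * (of_bool (C \<subseteq> R) * ?r C R)"
    have D0: "?D \<ge> 0" and M0: "?M \<ge> 0" by (intro sum_nonneg; simp)+
    show "of_bool (unicycle_free d V R) \<le> of_bool (\<forall>C\<in>?F. \<not> C \<subseteq> R) + ?D + ?M"
    proof (cases "unicycle_free d V R \<and> (\<exists>C\<in>?F. C \<subseteq> R)")
      case True
      then obtain C where C: "C \<in> ?F" "C \<subseteq> R" by auto
      show ?thesis
      proof (cases "\<exists>U\<in>dense_sets d V L 1. U \<subseteq> R")
        case True
        then obtain U where U: "U \<in> dense_sets d V L 1" "U \<subseteq> R" by auto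
        have "of_bool (U \<subseteq> R) \<le> ?D"
          using U assms(1) by (intro member_le_sum) (auto intro: finite_dense_sets)
        then have "1 \<le> ?D" using U by simp
        then show ?thesis using M0 by (simp add: of_bool_def)
      next
        case False
        have "L \<le> card {v \<in> V. \<exists>u\<in>\<Union>C. (u, v) \<in> (link R)\<^sup>*}"
          using assms(1,2,6) R C True False
          by (intro unicycle_free_grows[of V R d C L]) (auto simp: circuits_upto_def)
        then have "1 \<le> 1 / real L * (of_bool (C \<subseteq> R) * ?r C R)" using C L by (simp add: field_simps)
        also have "\<dots> \<le> ?M" using C finF by (intro member_le_sum) auto
        finally show ?thesis using D0 by (simp add: of_bool_def)
      qed
    next
      case False
      then have "of_bool (unicycle_free d V R) \<le> (of_bool (\<forall>C\<in>?F. \<not> C \<subseteq> R) :: real)" by auto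
      then show ?thesis using D0 M0 by linarith
    qed
  qed (use assms in auto)
  also have "\<dots> = bexp ?\<Omega> p (\<lambda>R. of_bool (\<forall>C\<in>?F. \<not> C \<subseteq> R)) + (\<Sum>U\<in>dense_sets d V L 1. bexp ?\<Omega> p (\<lambda>R. of_bool (U \<subseteq> R)))
       + (\<Sum>C\<in>?F. 1 / real L * bexp ?\<Omega> p (\<lambda>R. of_bool (C \<subseteq> R) * ?r C R))"
    by (simp only: bexp_add bexp_sum bexp_cmult)
  also have "bexp ?\<Omega> p (\<lambda>R. of_bool (\<forall>C\<in>?F. \<not> C \<subseteq> R)) \<le>
      exp (- (\<Sum>C\<in>?F. p ^ card C) + 4 ^ (2 * K) * (dense_bound d B (2 * K) / ?n))"
  proof -
    have "(\<Sum>C\<in>?F. \<Sum>D\<in>{D \<in> ?F. D \<noteq> C \<and> D \<inter> C \<noteq> {}}. p ^ card (C \<union> D))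
       \<le> 4 ^ (2 * K) * (\<Sum>U\<in>dense_sets d V (2 * K) 1. p ^ card U)"
      using assms by (intro overlapping_circuits_sum_le)
    also have "\<dots> \<le> 4 ^ (2 * K) * (dense_bound d B (2 * K) / ?n)"
      using sum_dense_sets_le[of V d p 1 "2 * K" B] assms dK n1 by (intro mult_left_mono) auto
    finally have "exp (- (\<Sum>C\<in>?F. p ^ card C) + (\<Sum>C\<in>?F. \<Sum>D\<in>{D \<in> ?F. D \<noteq> C \<and> D \<inter> C \<noteq> {}}. p ^ card (C \<union> D)))
       \<le> exp (- (\<Sum>C\<in>?F. p ^ card C) + 4 ^ (2 * K) * (dense_bound d B (2 * K) / ?n))"
      by simp
    then show ?thesis
      using janson[OF fin\<Omega> assms(3,4) finF] by (fastforce simp: circuits_upto_def intro: order_trans)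
  qed
  also have "(\<Sum>U\<in>dense_sets d V L 1. bexp ?\<Omega> p (\<lambda>R. of_bool (U \<subseteq> R))) = (\<Sum>U\<in>dense_sets d V L 1. p ^ card U)"
    using fin\<Omega> by (intro sum.cong refl bexp_superset_indicator) (auto simp: dense_sets_def)
  also have "\<dots> \<le> dense_bound d B L / ?n"
    using sum_dense_sets_le[of V d p 1 L B] assms dK n1 by auto
  also have "(\<Sum>C\<in>?F. 1 / real L * bexp ?\<Omega> p (\<lambda>R. of_bool (C \<subseteq> R) * ?r C R)) \<le>
      (\<Sum>C\<in>?F. 1 / real L * (p ^ card C * (real (d * K) / (1 - y))))"
  proof (intro sum_mono mult_left_mono)
    fix C assume C: "C \<in> ?F"
    then have "C \<subseteq> ?\<Omega>" by (auto simp: circuits_upto_def)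
    then have "bexp ?\<Omega> p (\<lambda>R. of_bool (C \<subseteq> R) * ?r C R) \<le> p ^ card C * (real (card (\<Union>C)) / (1 - y))"
      using assms by (intro circuit_reach_expectation_le) auto
    also have "\<dots> \<le> p ^ card C * (real (d * K) / (1 - y))"
    proof (intro mult_left_mono divide_right_mono of_nat_mono)
      have "int (card (\<Union>C)) = (int d - 1) * int (card C)"
        using C by (simp add: circuits_upto_def circuit_def set_excess_def)
      also have "\<dots> \<le> int d * int K"
        using C assms(2) by (intro mult_mono) (auto simp: circuits_upto_def)
      finally show "card (\<Union>C) \<le> d * K" by (simp flip: of_nat_mult)
    qed (use assms in auto)
    finally show "bexp ?\<Omega> p (\<lambda>R. of_bool (C \<subseteq> R) * ?r C R) \<le> p ^ card C * (real (d * K) / (1 - y))" .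
  qed simp
  also have "\<dots> = (\<Sum>C\<in>?F. p ^ card C) * (real (d * K) / (1 - y)) / real L"
    unfolding sum_distrib_right sum_divide_distrib by (intro sum.cong refl) simp
  also have "\<dots> \<le> dense_bound d B K * (real (d * K) / (1 - y)) / real L"
  proof (intro divide_right_mono mult_right_mono)
    have "(\<Sum>C\<in>?F. p ^ card C) \<le> (\<Sum>U\<in>dense_sets d V K 0. p ^ card U)"
      using assms(1,3) circuits_upto_dense[of V d K] by (intro sum_mono2) (auto intro: finite_dense_sets)
    also have "\<dots> \<le> dense_bound d B K"
      using sum_dense_sets_le[of V d p 0 K B] assms dK n1 by auto
    finally show "(\<Sum>C\<in>?F. p ^ card C) \<le> dense_bound d B K" .
  qed (use y in auto)
  finally show ?thesis by simp
qed

section \<open>Labeled copies\<close>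

definition relabel :: "('a \<Rightarrow> 'b) \<Rightarrow> 'a hypergraph \<Rightarrow> 'b hypergraph" where
  "relabel f H = Hypergraph (f ` verts H) ((`) f ` edges H)"

lemma verts_relabel [simp]: "verts (relabel f H) = f ` verts H"
  and edges_relabel [simp]: "edges (relabel f H) = (`) f ` edges H"
  by (simp_all add: relabel_def)

lemma relabel_cong:
  assumes "\<And>x. x \<in> verts H \<Longrightarrow> f x = g x" "\<And>e. e \<in> edges H \<Longrightarrow> e \<subseteq> verts H"
  shows "relabel f H = relabel g H"
proof -
  have "f ` e = g ` e" if "e \<in> edges H" for e
    using assms(1) assms(2)[OF that] by (intro image_cong) auto
  then have "(`) f ` edges H = (`) g ` edges H" by (rule image_cong[OF refl])
  then show ?thesis using assms(1) by (simp add: relabel_def)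
qed

lemma relabel_comp: "relabel f (relabel g H) = relabel (f \<circ> g) H"
  by (simp add: relabel_def image_comp comp_def)

text \<open>The injections are extensional, so that they are finite in number and each copy arises
  from exactly \<open>aut H\<close> of them.\<close>

definition copies :: "'a hypergraph \<Rightarrow> 'b set \<Rightarrow> 'b hypergraph set" where
  "copies H V = (\<lambda>f. relabel f H) ` {f \<in> verts H \<rightarrow>\<^sub>E V. inj_on f (verts H)}"

text \<open>For \<open>k > n\<close> the factor with \<open>i = n\<close> makes the product 0, in
  agreement with \<open>card_injections\<close>.\<close>

definition falling :: "nat \<Rightarrow> nat \<Rightarrow> real" where
  "falling n k = (\<Prod>i<k. real (n - i))"

lemma card_injections:
  assumes "finite A" "finite V"
  shows "real (card {f \<in> A \<rightarrow>\<^sub>E V. inj_on f A}) = falling (card V) (card A)"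
  using card_inj_on_subset_funcset[OF assms, of A] by (simp add: falling_def lessThan_atLeast0)

text \<open>Orbits and stabilizers: the injections that induce the same copy as \<open>g\<close> are
  the maps \<open>g \<circ> \<pi>\<close> with \<open>\<pi>\<close> an automorphism.\<close>

lemma card_copies_mult_aut:
  fixes H :: "'a hypergraph" and V :: "'b set"
  assumes "finite (verts H)" "\<And>e. e \<in> edges H \<Longrightarrow> e \<subseteq> verts H" "finite V"
  shows "real (card (copies H V)) * real (aut H) = falling (card V) (card (verts H))"
proof -
  let ?X = "verts H"
  let ?I = "{f \<in> ?X \<rightarrow>\<^sub>E V. inj_on f ?X}"
  let ?A = "{\<pi>. \<pi> permutes ?X \<and> (\<lambda>e. \<pi> ` e) ` edges H = edges H}"
  have finI: "finite ?I" using assms by (auto intro!: finite_PiE)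
  have autrel: "\<pi> \<in> ?A \<longleftrightarrow> \<pi> permutes ?X \<and> relabel \<pi> H = H" for \<pi>
    by (cases H) (simp add: relabel_def permutes_image cong: conj_cong)
  have fibre: "card {f \<in> ?I. relabel f H = G} = aut H" if G: "G \<in> copies H V" for G
  proof -
    from G obtain g where g: "g \<in> ?I" "relabel g H = G" by (auto simp: copies_def)
    have ginj: "inj_on g ?X" using g by auto
    have "bij_betw (\<lambda>\<pi>. restrict (g \<circ> \<pi>) ?X) ?A {f \<in> ?I. relabel f H = G}"
    proof (rule bij_betw_imageI)
      show "inj_on (\<lambda>\<pi>. restrict (g \<circ> \<pi>) ?X) ?A"
      proof (rule inj_onI, rule ext)
        fix \<pi> \<rho> x assume pr: "\<pi> \<in> ?A" "\<rho> \<in> ?A" and eq: "restrict (g \<circ> \<pi>) ?X = restrict (g \<circ> \<rho>) ?X"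
        show "\<pi> x = \<rho> x"
        proof (cases "x \<in> ?X")
          case True
          then have "g (\<pi> x) = g (\<rho> x)" using fun_cong[OF eq, of x] by simp
          moreover have "\<pi> x \<in> ?X" "\<rho> x \<in> ?X" using pr True by (auto simp: permutes_in_image)
          ultimately show ?thesis using ginj by (auto dest: inj_onD)
        next
          case False
          then show ?thesis using pr by (auto simp: permutes_not_in)
        qed
      qed
      show "(\<lambda>\<pi>. restrict (g \<circ> \<pi>) ?X) ` ?A = {f \<in> ?I. relabel f H = G}"
      proof (intro equalityI subsetI)
        fix f assume "f \<in> (\<lambda>\<pi>. restrict (g \<circ> \<pi>) ?X) ` ?A"
        then obtain \<pi> where pi: "\<pi> \<in> ?A" and f: "f = restrict (g \<circ> \<pi>) ?X" by auto
        have perm: "\<pi> permutes ?X" using pi by auto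
        have "relabel f H = relabel (g \<circ> \<pi>) H"
          using assms(2) by (intro relabel_cong) (auto simp: f)
        also have "\<dots> = G" using pi g(2) by (simp only: relabel_comp[symmetric] autrel)
        finally have "relabel f H = G" .
        moreover have "f \<in> ?X \<rightarrow>\<^sub>E V" using g(1) perm by (auto simp: f permutes_in_image)
        moreover have "inj_on f ?X"
          unfolding f inj_on_restrict_eq using perm ginj
          by (intro comp_inj_on) (auto simp: permutes_inj_on permutes_image)
        ultimately show "f \<in> {f \<in> ?I. relabel f H = G}" by simp
      next
        fix f assume f: "f \<in> {f \<in> ?I. relabel f H = G}"
        \<comment> \<open>The only candidate on \<open>verts H\<close>, extended by the identity
          because \<open>permutes\<close> demands it.\<close>
        define \<pi> where "\<pi> = (\<lambda>x. if x \<in> ?X then inv_into ?X g (f x) else x)"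
        have im: "f ` ?X = g ` ?X"
        proof -
          have "verts (relabel f H) = verts (relabel g H)" using f g by simp
          then show ?thesis by simp
        qed
        have gpi: "g (\<pi> x) = f x" if "x \<in> ?X" for x
        proof -
          have "f x \<in> g ` ?X" using that im by blast
          then show ?thesis using that by (simp add: \<pi>_def f_inv_into_f)
        qed
        have "bij_betw (inv_into ?X g \<circ> f) ?X ?X"
        proof (rule bij_betw_trans)
          show "bij_betw f ?X (g ` ?X)" using f im by (auto simp: bij_betw_def)
          show "bij_betw (inv_into ?X g) (g ` ?X) ?X"
            using ginj by (intro bij_betw_inv_into) (auto simp: bij_betw_def)
        qed
        then have "bij_betw \<pi> ?X ?X"
          by (rule bij_betw_cong[THEN iffD1, rotated]) (auto simp: \<pi>_def)
        then have perm: "\<pi> permutes ?X"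
          by (rule bij_imp_permutes) (auto simp: \<pi>_def)
        have "relabel g (relabel \<pi> H) = relabel f H"
          unfolding relabel_comp using assms(2) gpi by (intro relabel_cong) auto
        also have "\<dots> = relabel g H" using f g by simp
        finally have eqE: "(`) g ` ((`) \<pi> ` edges H) = (`) g ` edges H"
          by (metis edges_relabel)
        have "(`) \<pi> ` edges H = edges H"
        proof (rule inj_on_image_eq_iff[THEN iffD1, OF _ _ _ eqE])
          show "inj_on ((`) g) (Pow ?X)" using ginj by (rule inj_on_image_Pow)
          show "(`) \<pi> ` edges H \<subseteq> Pow ?X"
            using assms(2) permutes_image[OF perm] by blast
        qed (use assms(2) in auto)
        then have "\<pi> \<in> ?A" using perm by simp
        moreover have "f = restrict (g \<circ> \<pi>) ?X"
        proof
          fix x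
          have "f \<in> ?X \<rightarrow>\<^sub>E V" using f by simp
          then show "f x = restrict (g \<circ> \<pi>) ?X x"
            using gpi[of x] PiE_arb[of f ?X "\<lambda>_. V" x] by (cases "x \<in> ?X") simp_all
        qed
        ultimately show "f \<in> (\<lambda>\<pi>. restrict (g \<circ> \<pi>) ?X) ` ?A" by auto
      qed
    qed
    then show ?thesis by (simp add: aut_def bij_betw_same_card[symmetric])
  qed
  have fin: "finite (copies H V)" using finI by (simp add: copies_def)
  have "card ?I = (\<Sum>G\<in>copies H V. card {f \<in> ?I. relabel f H = G})"
    using sum.group[OF finI fin, of "\<lambda>f. relabel f H" "\<lambda>_. 1 :: nat"] by (auto simp: copies_def)
  also have "\<dots> = (\<Sum>G\<in>copies H V. aut H)" by (intro sum.cong refl fibre)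
  also have "\<dots> = card (copies H V) * aut H" by simp
  finally show ?thesis using card_injections[OF assms(1,3)] by (metis of_nat_mult)
qed

lemma set_excess_image:
  assumes "inj_on f (\<Union>S)"
  shows "set_excess d ((`) f ` S) = set_excess d S"
proof -
  have "inj_on ((`) f) S" using inj_on_image[OF assms] .
  then have "card ((`) f ` S) = card S" by (rule card_image)
  moreover have "\<Union>((`) f ` S) = f ` \<Union>S" by auto
  then have "card (\<Union>((`) f ` S)) = card (\<Union>S)" using assms by (simp add: card_image)
  ultimately show ?thesis by (simp add: set_excess_def)
qed

lemma circuit_image:
  assumes "circuit d C" "inj_on f (\<Union>C)"
  shows "circuit d ((`) f ` C)"
  unfolding circuit_def
proof (intro conjI allI impI)
  show "(`) f ` C \<noteq> {}" "set_excess d ((`) f ` C) = 0"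
    using assms by (auto simp: circuit_def set_excess_image)
  fix S assume S: "S \<subset> (`) f ` C" "S \<noteq> {}"
  then obtain T where T: "T \<subseteq> C" "S = (`) f ` T" by (meson psubset_imp_subset subset_image_iff)
  then have "T \<subset> C" "T \<noteq> {}" using S by auto
  moreover have "set_excess d S = set_excess d T"
    using T assms(2) by (simp add: set_excess_image inj_on_subset[OF _ Union_mono])
  ultimately show "set_excess d S < 0" using assms(1) by (auto simp: circuit_def)
qed

section \<open>Loose cycles\<close>

text \<open>The loose cycle with \<open>k\<close> edges: the joint vertices are \<open>(i, 0)\<close>, and edge \<open>i\<close> consists of row \<open>i\<close>
  together with the joint of the next row.\<close>
definition cyc_edge :: "nat \<Rightarrow> nat \<Rightarrow> nat \<Rightarrow> (nat \<times> nat) set" where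
  "cyc_edge d k i = insert (Suc i mod k, 0) ({i} \<times> {..<d - 1})"

definition cyc :: "nat \<Rightarrow> nat \<Rightarrow> (nat \<times> nat) hypergraph" where
  "cyc d k = Hypergraph ({..<k} \<times> {..<d - 1}) (cyc_edge d k ` {..<k})"

lemma mem_cyc_edge:
  "(a, b) \<in> cyc_edge d k i \<longleftrightarrow> (a = i \<and> b < d - 1) \<or> (a = Suc i mod k \<and> b = 0)"
  by (auto simp: cyc_edge_def)

lemma Suc_mod_inj: "i < k \<Longrightarrow> j < k \<Longrightarrow> Suc i mod k = Suc j mod k \<Longrightarrow> i = j"
  by (auto simp: mod_Suc split: if_splits)

lemma Suc_mod_neq: "2 \<le> k \<Longrightarrow> i < k \<Longrightarrow> Suc i mod k \<noteq> i"
  by (auto simp: mod_Suc split: if_splits)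

context
  fixes d k :: nat
  assumes d: "d \<ge> 3" and k: "k \<ge> 2"
begin

lemma cyc_edge_subset: "i < k \<Longrightarrow> cyc_edge d k i \<subseteq> verts (cyc d k)"
  using d k by (auto simp: cyc_def cyc_edge_def)

lemma card_cyc_edge: "i < k \<Longrightarrow> card (cyc_edge d k i) = d"
  using d k Suc_mod_neq[of k i] by (auto simp: cyc_edge_def)

text \<open>For \<open>d \<ge> 3\<close> row \<open>i\<close> has the vertex \<open>(i, 1)\<close>,
  which lies in edge \<open>i\<close> alone.\<close>

lemma cyc_edge_inj: "cyc_edge d k i = cyc_edge d k j \<Longrightarrow> i = j"
proof -
  assume "cyc_edge d k i = cyc_edge d k j"
  moreover have "(i, 1) \<in> cyc_edge d k i" using d by (simp add: mem_cyc_edge)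
  ultimately have "(i, 1) \<in> cyc_edge d k j" by simp
  then show "i = j" by (simp add: mem_cyc_edge)
qed

lemma cyc_union: "\<Union>(edges (cyc d k)) = verts (cyc d k)"
  using cyc_edge_subset by (auto simp: cyc_def mem_cyc_edge)

text \<open>The edges with indices in \<open>I\<close> cover their rows. If \<open>I\<close> is
  nonempty and proper, it is not closed under the cyclic successor, so they also cover the joint of
  a row outside \<open>I\<close>; this vertex makes the excess negative.\<close>

lemma cyc_circuit: "circuit d (edges (cyc d k))"
proof -
  let ?e = "cyc_edge d k"
  have ce: "card (?e ` I) = card I" for I
    by (intro card_image inj_onI cyc_edge_inj)
  have d1: "int d - 1 = int (d - 1)" using d by simp
  have "set_excess d (edges (cyc d k)) = 0"
    unfolding set_excess_def cyc_union d1 by (simp add: cyc_def ce card_cartesian_product mult.commute)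
  moreover have "set_excess d S < 0" if S: "S \<subset> edges (cyc d k)" "S \<noteq> {}" for S
  proof -
    from S obtain I where I: "I \<subseteq> {..<k}" "S = ?e ` I"
    proof -
      have "S \<subseteq> ?e ` {..<k}" using S by (auto simp: cyc_def)
      then show ?thesis using that unfolding subset_image_iff by blast
    qed
    have Ik: "I \<noteq> {..<k}" "I \<noteq> {}" using S I by (auto simp: cyc_def)
    have "\<exists>i\<in>I. Suc i mod k \<notin> I"
    proof (rule ccontr)
      assume "\<not> ?thesis"
      then have cl: "\<And>i. i \<in> I \<Longrightarrow> Suc i mod k \<in> I" by auto
      obtain i0 where i0: "i0 \<in> I" using Ik by auto
      have "(i0 + j) mod k \<in> I" for j
      proof (induction j)
        case 0
        then show ?case using i0 I by auto
      next
        case (Suc j)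
        then show ?case using cl[OF Suc] by (simp add: mod_Suc_eq)
      qed
      note all = this
      have "x \<in> I" if "x < k" for x
        using all[of "k - i0 + x"] i0 I that by (auto simp: subset_iff)
      then show False using I Ik by auto
    qed
    then obtain i where i: "i \<in> I" "Suc i mod k \<notin> I" by auto
    have finI: "finite I" using I finite_subset by blast
    have "insert (Suc i mod k, 0) (I \<times> {..<d - 1}) \<subseteq> \<Union>S"
      using i I by (auto simp: mem_cyc_edge)
    moreover have "finite (\<Union>S)" using I finI by (auto simp: cyc_edge_def)
    ultimately have "card (insert (Suc i mod k, 0) (I \<times> {..<d - 1})) \<le> card (\<Union>S)"
      by (intro card_mono)
    moreover have "card (insert (Suc i mod k, 0) (I \<times> {..<d - 1})) = Suc (card I * (d - 1))"
      using i finI by (simp add: card_cartesian_product)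
    ultimately have "int (card I * (d - 1)) < int (card (\<Union>S))" by linarith
    then show ?thesis using I by (simp add: set_excess_def ce d1 mult.commute)
  qed
  moreover have "edges (cyc d k) \<noteq> {}" using k by (auto simp: cyc_def lessThan_empty_iff)
  ultimately show ?thesis by (auto simp: circuit_def)
qed

section \<open>Automorphisms of the loose cycle\<close>

abbreviation cyc_auts :: "(nat \<times> nat \<Rightarrow> nat \<times> nat) set" where
  "cyc_auts \<equiv> {\<pi>. \<pi> permutes verts (cyc d k) \<and> (\<lambda>e. \<pi> ` e) ` edges (cyc d k) = edges (cyc d k)}"

lemma cyc_aut_edge:
  assumes "\<pi> \<in> cyc_auts" "i < k"
  obtains j where "j < k" "\<pi> ` cyc_edge d k i = cyc_edge d k j"
proof -
  have "\<pi> ` cyc_edge d k i \<in> (\<lambda>e. \<pi> ` e) ` edges (cyc d k)"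
    using assms(2) by (auto simp: cyc_def)
  then have "\<pi> ` cyc_edge d k i \<in> edges (cyc d k)"
    using assms(1) by simp
  then show ?thesis using that by (auto simp: cyc_def)
qed

lemma cyc_aut_edge_neq:
  assumes "\<pi> \<in> cyc_auts" "i \<noteq> j"
  shows "\<pi> ` cyc_edge d k i \<noteq> \<pi> ` cyc_edge d k j"
proof -
  have "inj \<pi>" using assms by (auto simp: permutes_inj)
  then show ?thesis using cyc_edge_inj assms(2) by (auto simp: inj_image_eq_iff)
qed

text \<open>Joints are the vertices that lie in two different edges, and automorphisms preserve
  this.\<close>

lemma cyc_aut_joint:
  assumes "\<pi> \<in> cyc_auts" "i < k"
  shows "snd (\<pi> (i, 0)) = 0"
proof -
  obtain i' where i': "i' < k" "Suc i' mod k = i" "i' \<noteq> i"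
  proof (cases i)
    case 0
    then show ?thesis using k that[of "k - 1"] by auto
  next
    case (Suc m)
    then show ?thesis using that[of m] assms(2) by auto
  qed
  obtain j where j: "j < k" "\<pi> ` cyc_edge d k i = cyc_edge d k j"
    using cyc_aut_edge[OF assms] .
  obtain j' where j': "j' < k" "\<pi> ` cyc_edge d k i' = cyc_edge d k j'"
    using cyc_aut_edge[OF assms(1) i'(1)] .
  have "j \<noteq> j'" using cyc_aut_edge_neq[OF assms(1) i'(3)] j j' by auto
  have "(i, 0) \<in> cyc_edge d k i" "(i, 0) \<in> cyc_edge d k i'"
    using d i' by (auto simp: mem_cyc_edge)
  then have "\<pi> (i, 0) \<in> cyc_edge d k j" "\<pi> (i, 0) \<in> cyc_edge d k j'" using j j' by blast+
  then show ?thesis using \<open>j \<noteq> j'\<close> by (cases "\<pi> (i, 0)") (auto simp: mem_cyc_edge)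
qed

text \<open>Walk around the cycle. The image of edge \<open>i\<close> has two joints; one is the
  image of joint \<open>i\<close>, so the other is that of joint \<open>Suc i\<close>. A joint lies
  in two edges; one is the image of edge \<open>i\<close>, so the other is that of edge
  \<open>Suc i\<close>.\<close>

lemma cyc_aut_determined:
  assumes pi: "\<pi> \<in> cyc_auts" and rho: "\<rho> \<in> cyc_auts"
    and e0: "\<pi> ` cyc_edge d k 0 = \<rho> ` cyc_edge d k 0" and v0: "\<pi> (0, 0) = \<rho> (0, 0)"
    and "i < k"
  shows "\<pi> ` cyc_edge d k i = \<rho> ` cyc_edge d k i \<and> \<pi> (i, 0) = \<rho> (i, 0)"
  using assms(5)
proof (induction i)
  case 0
  then show ?case using e0 v0 by simp
next
  case (Suc i)
  then have ik: "i < k" "Suc i < k" and IH: "\<pi> ` cyc_edge d k i = \<rho> ` cyc_edge d k i" "\<pi> (i, 0) = \<rho> (i, 0)" by auto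
  obtain j where j: "j < k" "\<pi> ` cyc_edge d k i = cyc_edge d k j" using cyc_aut_edge[OF pi ik(1)] .
  have mem: "(i, 0) \<in> cyc_edge d k i" "(Suc i, 0) \<in> cyc_edge d k i" "(Suc i, 0) \<in> cyc_edge d k (Suc i)"
    using d ik by (auto simp: mem_cyc_edge)
  have on: "\<sigma> (Suc i, 0) \<in> {(j, 0), (Suc j mod k, 0)} \<and> \<sigma> (i, 0) \<in> {(j, 0), (Suc j mod k, 0)} \<and> \<sigma> (Suc i, 0) \<noteq> \<sigma> (i, 0)"
    if s: "\<sigma> \<in> cyc_auts" "\<sigma> ` cyc_edge d k i = cyc_edge d k j" for \<sigma>
  proof -
    have "\<sigma> (i, 0) \<in> cyc_edge d k j" "\<sigma> (Suc i, 0) \<in> cyc_edge d k j" using s mem by blast+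
    moreover have "snd (\<sigma> (i, 0)) = 0" "snd (\<sigma> (Suc i, 0)) = 0" using cyc_aut_joint s(1) ik by auto
    moreover have "\<sigma> (Suc i, 0) \<noteq> \<sigma> (i, 0)"
    proof
      assume "\<sigma> (Suc i, 0) = \<sigma> (i, 0)"
      moreover have "inj \<sigma>" using s by (auto simp: permutes_inj)
      ultimately have "(Suc i, 0 :: nat) = (i, 0)" by (metis injD)
      then show False by simp
    qed
    ultimately show ?thesis
      by (cases "\<sigma> (i, 0)"; cases "\<sigma> (Suc i, 0)") (auto simp: mem_cyc_edge)
  qed
  have v: "\<pi> (Suc i, 0) = \<rho> (Suc i, 0)"
    using on[OF pi j(2)] on[OF rho, folded IH(1), OF j(2)] IH(2) by auto
  obtain a where a: "\<pi> (Suc i, 0) = (a, 0)" using on[OF pi j(2)] by auto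
  obtain j1 where j1: "j1 < k" "\<pi> ` cyc_edge d k (Suc i) = cyc_edge d k j1" using cyc_aut_edge[OF pi ik(2)] .
  obtain j2 where j2: "j2 < k" "\<rho> ` cyc_edge d k (Suc i) = cyc_edge d k j2" using cyc_aut_edge[OF rho ik(2)] .
  have "j1 \<noteq> j" using cyc_aut_edge_neq[OF pi, of "Suc i" i] j j1 by auto
  have "j2 \<noteq> j" using cyc_aut_edge_neq[OF rho, of "Suc i" i] j j2 IH by auto
  have "(a, 0) \<in> cyc_edge d k j" "(a, 0) \<in> cyc_edge d k j1" using j j1 mem a by (metis imageI)+
  moreover have "(a, 0) \<in> cyc_edge d k j2" using j2 mem a v by (metis imageI)
  ultimately have "j1 = j2"
    using \<open>j1 \<noteq> j\<close> \<open>j2 \<noteq> j\<close> Suc_mod_inj j(1) j1(1) j2(1) by (auto simp: mem_cyc_edge)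
  then show ?case using j1 j2 v by simp
qed

text \<open>An automorphism is determined on the joints by the images of edge \<open>0\<close> and joint \<open>0\<close> (\<open>2 * k\<close>
  possibilities), and then permutes the \<open>d - 2\<close> other vertices of each edge.\<close>
lemma aut_cyc_le: "aut (cyc d k) \<le> 2 * k * fact (d - 2) ^ k"
proof -
  let ?e = "cyc_edge d k"
  let ?s = "\<lambda>i. {i} \<times> {1..<d - 1}"
  define \<Phi> where "\<Phi> \<pi> = (\<pi> ` ?e 0, \<pi> (0, 0))" for \<pi> :: "nat \<times> nat \<Rightarrow> nat \<times> nat"
  have fin: "finite cyc_auts"
    by (rule finite_subset[OF _ finite_permutations[of "verts (cyc d k)"]]) (auto simp: cyc_def)
  \<comment> \<open>All pairs of an edge and one of its two joints, hence at most
    \<open>2 * k\<close> of them.\<close>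
  define T :: "((nat \<times> nat) set \<times> nat \<times> nat) set" where "T = (\<lambda>j. (?e j, (j, 0))) ` {..<k} \<union> (\<lambda>j. (?e j, (Suc j mod k, 0))) ` {..<k}"
  have cardT: "card T \<le> 2 * k"
    unfolding T_def using card_Un_le card_image_le[of "{..<k}"] by (smt (verit) add_mono card_lessThan finite_lessThan le_trans mult_2)
  have finT: "finite T" by (auto simp: T_def)
  have \<Phi>T: "\<Phi> \<pi> \<in> T" if pi: "\<pi> \<in> cyc_auts" for \<pi>
  proof -
    have k0: "0 < k" using k by simp
    obtain j where j: "j < k" "\<pi> ` ?e 0 = ?e j" using cyc_aut_edge[OF pi k0] .
    have "(0, 0) \<in> ?e 0" using d by (simp add: mem_cyc_edge)
    then have "\<pi> (0, 0) \<in> ?e j" using j by blast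
    then show ?thesis using cyc_aut_joint[OF pi k0] j
      by (cases "\<pi> (0, 0)") (auto simp: \<Phi>_def T_def mem_cyc_edge)
  qed
  have fibre: "card {\<pi> \<in> cyc_auts. \<Phi> \<pi> = t} \<le> fact (d - 2) ^ k" for t
  proof (cases "{\<pi> \<in> cyc_auts. \<Phi> \<pi> = t} = {}")
    case False
    then obtain \<rho> where rho: "\<rho> \<in> cyc_auts" "\<Phi> \<rho> = t" by auto
    have same: "\<pi> ` ?e i = \<rho> ` ?e i \<and> \<pi> (i, 0) = \<rho> (i, 0)"
      if "\<pi> \<in> cyc_auts" "\<Phi> \<pi> = t" "i < k" for \<pi> i
      using that rho by (intro cyc_aut_determined) (auto simp: \<Phi>_def)
    have inj: "inj \<pi>" if "\<pi> \<in> cyc_auts" for \<pi> using that by (auto simp: permutes_inj)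
    have s_eq: "?s i = ?e i - {(i, 0), (Suc i mod k, 0)}" for i
      by (auto simp: mem_cyc_edge)
    have same_s: "\<pi> ` ?s i = \<rho> ` ?s i"
      if "\<pi> \<in> cyc_auts" "\<Phi> \<pi> = t" "i < k" for \<pi> i
    proof -
      have "Suc i mod k < k" using k by simp
      then show ?thesis
        unfolding s_eq image_set_diff[OF inj[OF that(1)]] image_set_diff[OF inj[OF rho(1)]]
        using same[OF that] same[OF that(1,2), of "Suc i mod k"] by simp
    qed
    \<comment> \<open>The joints being settled, an automorphism in the fibre is given by its
      restrictions to the \<open>d - 2\<close> private vertices of each edge, whose image set is the
      same as under \<open>\<rho>\<close>.\<close>
    let ?P = "PiE {..<k} (\<lambda>i. {g \<in> ?s i \<rightarrow>\<^sub>E \<rho> ` ?s i. inj_on g (?s i)})"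
    define \<Psi> where "\<Psi> \<pi> = (\<lambda>i\<in>{..<k}. restrict \<pi> (?s i))" for \<pi> :: "nat \<times> nat \<Rightarrow> nat \<times> nat"
    have "card {\<pi> \<in> cyc_auts. \<Phi> \<pi> = t} \<le> card ?P"
    proof (rule card_inj_on_le)
      show "inj_on \<Psi> {\<pi> \<in> cyc_auts. \<Phi> \<pi> = t}"
      proof (rule inj_onI, rule ext)
        fix \<pi> \<sigma> and x :: "nat \<times> nat" assume p: "\<pi> \<in> {\<pi> \<in> cyc_auts. \<Phi> \<pi> = t}" and s: "\<sigma> \<in> {\<pi> \<in> cyc_auts. \<Phi> \<pi> = t}"
          and eq: "\<Psi> \<pi> = \<Psi> \<sigma>"
        obtain i b where x: "x = (i, b)" by (cases x)
        show "\<pi> x = \<sigma> x"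
        proof (cases "x \<in> verts (cyc d k)")
          case True
          then have ib: "i < k" "b < d - 1" by (auto simp: x cyc_def)
          show ?thesis
          proof (cases "b = 0")
            case True
            then show ?thesis using same[of \<pi> i] same[of \<sigma> i] p s ib by (simp add: x)
          next
            case False
            have "restrict \<pi> (?s i) x = restrict \<sigma> (?s i) x"
              using fun_cong[OF eq, of i] ib by (simp add: \<Psi>_def)
            then show ?thesis using False ib by (simp add: x)
          qed
        next
          case False
          then show ?thesis using p s by (auto simp: permutes_not_in)
        qed
      qed
      show "\<Psi> ` {\<pi> \<in> cyc_auts. \<Phi> \<pi> = t} \<subseteq> ?P"
      proof
        fix g assume "g \<in> \<Psi> ` {\<pi> \<in> cyc_auts. \<Phi> \<pi> = t}"
        then obtain \<pi> where pi: "\<pi> \<in> cyc_auts" "\<Phi> \<pi> = t" "g = \<Psi> \<pi>" by auto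
        have "restrict \<pi> (?s i) \<in> {g \<in> ?s i \<rightarrow>\<^sub>E \<rho> ` ?s i. inj_on g (?s i)}" if "i < k" for i
        proof -
          have "restrict \<pi> (?s i) \<in> ?s i \<rightarrow>\<^sub>E \<rho> ` ?s i"
            unfolding restrict_PiE_iff same_s[OF pi(1,2) that, symmetric] by (intro ballI imageI)
          moreover have "inj_on \<pi> (?s i)" using inj[OF pi(1)] inj_on_subset by blast
          ultimately show ?thesis by simp
        qed
        then show "g \<in> ?P" unfolding pi(3) \<Psi>_def by (intro PiE_I) auto
      qed
      have "finite (?s i \<rightarrow>\<^sub>E \<rho> ` ?s i)" for i by (intro finite_PiE) auto
      then show "finite ?P" by (intro finite_PiE finite_Collect_conjI) auto
    qed
    also have "card ?P = (\<Prod>i<k. fact (d - 2))"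
    proof -
      have "card {g \<in> ?s i \<rightarrow>\<^sub>E \<rho> ` ?s i. inj_on g (?s i)} = fact (d - 2)" for i
      proof -
        have c: "card (?s i) = d - 2" by simp
        moreover have "card (\<rho> ` ?s i) = d - 2"
          using inj[OF rho(1)] c by (metis card_image inj_on_subset subset_UNIV)
        ultimately show ?thesis
          using card_inj_on_subset_funcset[of "?s i" "\<rho> ` ?s i" "?s i"]
          by (simp add: fact_prod_rev)
      qed
      then show ?thesis by (simp add: card_PiE)
    qed
    finally show ?thesis by simp
  next
    case True
    show ?thesis unfolding True by simp
  qed
  have "aut (cyc d k) = card cyc_auts" by (simp add: aut_def)
  also have "\<dots> = (\<Sum>t\<in>T. card {\<pi> \<in> cyc_auts. \<Phi> \<pi> = t})"
  proof -
    have "\<Phi> ` cyc_auts \<subseteq> T" using \<Phi>T by (rule image_subsetI)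
    then show ?thesis
      using sum.group[OF fin finT, of \<Phi> "\<lambda>_. 1 :: nat"] by (simp del: mem_Collect_eq)
  qed
  also have "\<dots> \<le> (\<Sum>t\<in>T. fact (d - 2) ^ k)" by (intro sum_mono fibre)
  also have "\<dots> = card T * fact (d - 2) ^ k" by simp
  also have "\<dots> \<le> 2 * k * fact (d - 2) ^ k" using cardT by (intro mult_right_mono) auto
  finally show ?thesis .
qed

end

section \<open>The probability of having no unicyclic component\<close>

lemma tendsto_falling: "(\<lambda>n. falling (n - j) m / real n ^ m) \<longlonglongrightarrow> 1"
proof -
  have *: "(\<lambda>n. real (n - i) / real n) \<longlonglongrightarrow> 1" for i
  proof -
    have "(\<lambda>n. 1 - real i / real n) \<longlonglongrightarrow> 1 - 0"
      by (intro tendsto_diff tendsto_const lim_const_over_n)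
    moreover have "eventually (\<lambda>n. 1 - real i / real n = real (n - i) / real n) sequentially"
      using eventually_gt_at_top[of i] by eventually_elim (simp add: of_nat_diff field_simps)
    ultimately show ?thesis
      using Lim_transform_eventually by fastforce
  qed
  have "(\<lambda>n. \<Prod>i<m. real (n - (j + i)) / real n) \<longlonglongrightarrow> (\<Prod>i<m. 1)"
    by (intro tendsto_prod *)
  then show ?thesis by (simp add: falling_def prod_dividef)
qed

lemma tendsto_falling_times_power:
  assumes "(\<lambda>n. real n ^ (d - 1) * p n) \<longlonglongrightarrow> c"
  shows "(\<lambda>n. falling n ((d - 1) * k) * p n ^ k) \<longlonglongrightarrow> c ^ k"
proof -
  have "(\<lambda>n. falling n ((d - 1) * k) / real n ^ ((d - 1) * k) * (real n ^ (d - 1) * p n) ^ k) \<longlonglongrightarrow> 1 * c ^ k"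
    using tendsto_falling[of 0] by (intro tendsto_mult tendsto_power assms) simp
  moreover have "eventually (\<lambda>n. falling n ((d - 1) * k) / real n ^ ((d - 1) * k) * (real n ^ (d - 1) * p n) ^ k
      = falling n ((d - 1) * k) * p n ^ k) sequentially"
    using eventually_gt_at_top[of 0]
    by eventually_elim (simp add: power_mult_distrib power_mult)
  ultimately show ?thesis by (simp add: Lim_transform_eventually)
qed

text \<open>Loose cycles are circuits, and a copy is determined by its edges because they cover its
  vertices. An upper bound on the automorphisms bounds the number of copies from below.\<close>

lemma sum_circuits_ge:
  assumes "finite V" "d \<ge> 3" "0 \<le> p"
  shows "(\<Sum>k=2..K. falling (card V) ((d - 1) * k) * p ^ k / (2 * real k * fact (d - 2) ^ k))
     \<le> (\<Sum>C\<in>circuits_upto d V K. p ^ card C)"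
proof -
  let ?F = "circuits_upto d V K"
  have finF: "finite ?F"
    using finite_subset[OF circuits_upto_dense finite_dense_sets] assms(1) by blast
  have each: "falling (card V) ((d - 1) * k) * p ^ k / (2 * real k * fact (d - 2) ^ k)
       \<le> (\<Sum>C\<in>{C \<in> ?F. card C = k}. p ^ card C)" if k: "k \<in> {2..K}" for k
  proof -
    let ?H = "cyc d k"
    have k2: "2 \<le> k" using k by simp
    have sub: "e \<subseteq> verts ?H" if "e \<in> edges ?H" for e
      using that cyc_edge_subset[OF assms(2) k2] by (auto simp: cyc_def)
    have finH: "finite (verts ?H)" by (simp add: cyc_def)
    have cardH: "card (verts ?H) = (d - 1) * k" by (simp add: cyc_def card_cartesian_product)
    have cop: "real (card (copies ?H V)) * real (aut ?H) = falling (card V) ((d - 1) * k)"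
      using card_copies_mult_aut[OF finH sub assms(1)] cardH by simp
    have "inj_on edges (copies ?H V)"
    proof (rule inj_onI)
      fix G1 G2 assume G: "G1 \<in> copies ?H V" "G2 \<in> copies ?H V" "edges G1 = edges G2"
      have "verts G = \<Union>(edges G)" if GV: "G \<in> copies ?H V" for G
      proof -
        obtain f where "G = relabel f ?H" using GV by (auto simp: copies_def)
        then have "verts G = f ` \<Union>(edges ?H)" using cyc_union[OF assms(2) k2] by simp
        then show ?thesis using \<open>G = relabel f ?H\<close> by auto
      qed
      then have "verts G1 = verts G2" using G by simp
      then show "G1 = G2" using G(3) by (rule hypergraph.expand[OF conjI])
    qed
    moreover have "edges ` copies ?H V \<subseteq> {C \<in> ?F. card C = k}"
    proof
      fix C assume "C \<in> edges ` copies ?H V"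
      then obtain f where f: "f \<in> verts ?H \<rightarrow>\<^sub>E V" "inj_on f (verts ?H)" "C = (`) f ` edges ?H"
        by (auto simp: copies_def)
      have inj: "inj_on f (\<Union>(edges ?H))" using f cyc_union[OF assms(2) k2] by simp
      have "circuit d C"
        unfolding f(3) using cyc_circuit[OF assms(2) k2] inj by (rule circuit_image)
      moreover have "card C = k"
      proof -
        have "card C = card (edges ?H)" unfolding f(3) using inj by (intro card_image inj_on_image)
        also have "\<dots> = k" unfolding cyc_def using cyc_edge_inj[OF assms(2) k2]
          by (simp add: card_image inj_on_def)
        finally show ?thesis .
      qed
      moreover have "C \<subseteq> dsub d V"
      proof
        fix e assume "e \<in> C"
        then obtain i where i: "i < k" "e = f ` cyc_edge d k i" by (auto simp: f(3) cyc_def)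
        have s: "cyc_edge d k i \<subseteq> verts ?H" using cyc_edge_subset[OF assms(2) k2 i(1)] .
        have "card e = d"
          unfolding i(2) using card_cyc_edge[OF assms(2) k2 i(1)] inj_on_subset[OF f(2) s] by (simp add: card_image)
        moreover have "e \<subseteq> V" using s f(1) i(2) by auto
        ultimately show "e \<in> dsub d V" by (simp add: dsub_def)
      qed
      ultimately show "C \<in> {C \<in> ?F. card C = k}" using k by (simp add: circuits_upto_def)
    qed
    ultimately have le: "card (copies ?H V) \<le> card {C \<in> ?F. card C = k}"
      using finF by (intro card_inj_on_le[of edges]) auto
    have "falling (card V) ((d - 1) * k) \<le> real (card (copies ?H V)) * (2 * real k * fact (d - 2) ^ k)"
      unfolding cop[symmetric]
    proof (intro mult_left_mono)
      have "real (aut ?H) \<le> real (2 * k * fact (d - 2) ^ k)"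
        using aut_cyc_le[OF assms(2) k2] of_nat_le_iff by blast
      then show "real (aut ?H) \<le> 2 * real k * fact (d - 2) ^ k" by simp
    qed simp
    then have "falling (card V) ((d - 1) * k) / (2 * real k * fact (d - 2) ^ k) \<le> real (card (copies ?H V))"
      using k2 by (simp add: divide_le_eq)
    also have "\<dots> \<le> real (card {C \<in> ?F. card C = k})" using le by simp
    finally have "falling (card V) ((d - 1) * k) / (2 * real k * fact (d - 2) ^ k) * p ^ k
       \<le> real (card {C \<in> ?F. card C = k}) * p ^ k"
      using assms(3) by (intro mult_right_mono) auto
    then show ?thesis by simp
  qed
  have "(\<Sum>k=2..K. falling (card V) ((d - 1) * k) * p ^ k / (2 * real k * fact (d - 2) ^ k))
     \<le> (\<Sum>k=2..K. \<Sum>C\<in>{C \<in> ?F. card C = k}. p ^ card C)"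
    by (intro sum_mono each)
  also have "\<dots> = (\<Sum>C\<in>(\<Union>k\<in>{2..K}. {C \<in> ?F. card C = k}). p ^ card C)"
    using finF by (intro sum.UNION_disjoint[symmetric]) auto
  also have "\<dots> \<le> (\<Sum>C\<in>?F. p ^ card C)"
    using finF assms(3) by (intro sum_mono2) auto
  finally show ?thesis .
qed

lemma tendsto_cycle_series:
  fixes x :: real
  assumes "0 \<le> x" "x < 1"
  shows "(\<lambda>K. \<Sum>k=2..K. x ^ k / (2 * real k)) \<longlonglongrightarrow> 1 / 2 * (- ln (1 - x) - x)"
proof -
  have "(\<lambda>n. - ((- (- x)) ^ n) / real n) sums ln (1 + - x)"
    using assms by (intro ln_series') auto
  then have "(\<lambda>n. - (x ^ n / real n)) sums ln (1 - x)" by simp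
  then have "(\<lambda>n. x ^ n / real n) sums (- ln (1 - x))"
    using sums_minus by fastforce
  then have "(\<lambda>K. \<Sum>n<Suc K. x ^ n / real n) \<longlonglongrightarrow> - ln (1 - x)"
    unfolding sums_def by (rule LIMSEQ_Suc)
  then have lim: "(\<lambda>K. 1 / 2 * ((\<Sum>n<Suc K. x ^ n / real n) - x)) \<longlonglongrightarrow> 1 / 2 * (- ln (1 - x) - x)"
    by (intro tendsto_intros)
  have "eventually (\<lambda>K. 1 / 2 * ((\<Sum>n<Suc K. x ^ n / real n) - x) = (\<Sum>k=2..K. x ^ k / (2 * real k))) sequentially"
    using eventually_ge_at_top[of 1]
  proof eventually_elim
    case (elim K)
    \<comment> \<open>The summand for 0 vanishes because it is \<open>1 / 0\<close>; the one for 1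
      is the \<open>x\<close> that is subtracted.\<close>
    have "{..<Suc K} = insert 0 (insert 1 {2..K})" using elim by auto
    then have "(\<Sum>n<Suc K. x ^ n / real n) = x + (\<Sum>n=2..K. x ^ n / real n)" by simp
    then show ?case by (simp add: sum_divide_distrib mult.commute)
  qed
  then show ?thesis using lim by (simp add: Lim_transform_eventually)
qed

lemma unicycle_free_limit:
  fixes c :: real
  assumes d: "d \<ge> 3" and p: "\<And>n. 0 \<le> p n \<and> p n \<le> 1"
    and lim: "(\<lambda>n. real n ^ (d - 1) * p n) \<longlonglongrightarrow> c" and c: "0 < c" "c < fact (d - 2)"
    and V: "\<And>n. finite (V n)" "\<And>n. card (V n) = n"
  shows "(\<lambda>n. bexp (dsub d (V n)) (p n) (\<lambda>R. of_bool (unicycle_free d (V n) R))) \<longlonglongrightarrow> exp (- f_const d c)"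
proof -
  define x where "x = c / fact (d - 2)"
  define y where "y n = real n ^ (d - 1) / fact (d - 2) * p n" for n
  define Q where "Q n = bexp (dsub d (V n)) (p n) (\<lambda>R. of_bool (unicycle_free d (V n) R))" for n
  have x: "0 < x" "x < 1" using c by (auto simp: x_def)
  have f: "f_const d c = 1 / 2 * (- ln (1 - x) - x)"
    using x by (simp add: f_const_def x_def[symmetric] ln_div right_diff_distrib)
  have limy: "y \<longlonglongrightarrow> x"
  proof -
    have "(\<lambda>n. real n ^ (d - 1) * p n / fact (d - 2)) \<longlonglongrightarrow> c / fact (d - 2)"
      by (intro tendsto_divide lim tendsto_const) auto
    then show ?thesis by (simp add: y_def[abs_def] x_def)
  qed
  have limp: "p \<longlonglongrightarrow> 0"
  proof -
    have "(\<lambda>n. real n ^ (d - 1) * p n * inverse (real n ^ (d - 1))) \<longlonglongrightarrow> c * 0"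
    proof (intro tendsto_mult lim)
      have "(\<lambda>n. inverse (real n) ^ (d - 1)) \<longlonglongrightarrow> 0 ^ (d - 1)"
        by (intro tendsto_power lim_inverse_n)
      then show "(\<lambda>n. inverse (real n ^ (d - 1))) \<longlonglongrightarrow> 0"
        using d by (simp add: power_inverse power_0_left)
    qed
    moreover have "eventually (\<lambda>n. real n ^ (d - 1) * p n * inverse (real n ^ (d - 1)) = p n) sequentially"
      using eventually_gt_at_top[of 0] by eventually_elim simp
    ultimately show ?thesis by (simp add: Lim_transform_eventually)
  qed
  have evy: "eventually (\<lambda>n. y n < 1) sequentially"
    using order_tendstoD(2)[OF limy x(2)] .
  have evp: "eventually (\<lambda>n. p n < 1) sequentially"
    using order_tendstoD(2)[OF limp] by auto
  define lo where "lo n = exp (- (1 / (1 - p n) * (1 / 2 * (- ln (1 - y n) - y n))))" for n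
  have limlo: "lo \<longlonglongrightarrow> exp (- f_const d c)"
  proof -
    have "lo \<longlonglongrightarrow> exp (- (1 / (1 - 0) * (1 / 2 * (- ln (1 - x) - x))))"
      unfolding lo_def[abs_def] using x
      by (intro tendsto_exp tendsto_minus tendsto_mult tendsto_divide tendsto_const tendsto_diff tendsto_ln limy limp) auto
    then show ?thesis by (simp add: f)
  qed
  have evlo: "eventually (\<lambda>n. lo n \<le> Q n) sequentially"
    using evy evp
  proof eventually_elim
    case (elim n)
    have "lo n \<le> bexp (dsub d (V n)) (p n) (\<lambda>R. of_bool (hforest d R))"
      using forest_prob_ge[of "V n" d "p n" "real n ^ (d - 1) / fact (d - 2)"] V d p[of n] elim
      by (simp add: lo_def y_def)
    also have "\<dots> \<le> Q n"
      unfolding Q_def using p[of n] V(1)[of n] hforest_unicycle_free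
      by (intro bexp_mono) (auto simp: of_bool_def)
    finally show ?case .
  qed
  \<comment> \<open>The order of choices: \<open>K\<close> brings the partial sum close to
    \<open>f_const d c\<close>, then \<open>L\<close>, depending on \<open>K\<close>, makes the
    Markov term small, and only then does \<open>n\<close> grow and remove the remaining
    errors.\<close>
  have up: "eventually (\<lambda>n. Q n < exp (- f_const d c) + \<epsilon>) sequentially" if eps: "\<epsilon> > 0" for \<epsilon>
  proof -
    define g where "g K = (\<Sum>k=2..K. x ^ k / (2 * real k))" for K
    have "(\<lambda>K. exp (- g K)) \<longlonglongrightarrow> exp (- f_const d c)"
      unfolding f g_def using x by (intro tendsto_exp tendsto_minus tendsto_cycle_series) auto
    then have "eventually (\<lambda>K. exp (- g K) < exp (- f_const d c) + \<epsilon> / 2) sequentially"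
      using eps by (intro order_tendstoD(2)) auto
    then have "eventually (\<lambda>K. exp (- g K) < exp (- f_const d c) + \<epsilon> / 2 \<and> 1 \<le> K) sequentially"
      using eventually_ge_at_top[of 1] by (rule eventually_conj)
    then obtain K where K: "exp (- g K) < exp (- f_const d c) + \<epsilon> / 2" "1 \<le> K"
      by (auto simp: eventually_sequentially)
    define B where "B = c + 1"
    define M where "M = dense_bound d B K * (real (d * K) / (1 - x))"
    have "(\<lambda>L. M / real L) \<longlonglongrightarrow> 0" by (rule lim_const_over_n)
    then have "eventually (\<lambda>L. M / real L < \<epsilon> / 2 \<and> K \<le> L) sequentially"
      using eps eventually_ge_at_top[of K] by (intro eventually_conj order_tendstoD(2)) auto
    then obtain L where L: "M / real L < \<epsilon> / 2" "K \<le> L"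
      by (auto simp: eventually_sequentially)
    define s where "s n = (\<Sum>k=2..K. falling n ((d - 1) * k) * p n ^ k / (2 * real k * fact (d - 2) ^ k))" for n
    define U where "U n = exp (- s n + 4 ^ (2 * K) * (dense_bound d B (2 * K) / real n))
       + dense_bound d B L / real n + dense_bound d B K * (real (d * K) / (1 - y n)) / real L" for n
    have lims: "s \<longlonglongrightarrow> g K"
    proof -
      have "s \<longlonglongrightarrow> (\<Sum>k=2..K. c ^ k / (2 * real k * fact (d - 2) ^ k))"
        unfolding s_def[abs_def]
        by (intro tendsto_sum tendsto_divide tendsto_falling_times_power lim tendsto_const) auto
      also have "(\<Sum>k=2..K. c ^ k / (2 * real k * fact (d - 2) ^ k)) = g K"
        unfolding g_def x_def by (intro sum.cong refl) (simp add: power_divide)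
      finally show ?thesis .
    qed
    have "U \<longlonglongrightarrow> exp (- g K + 4 ^ (2 * K) * 0) + 0 + M / real L"
      unfolding U_def[abs_def] M_def using x L K
      by (intro tendsto_intros lims limy lim_const_over_n) auto
    moreover have "exp (- g K + 4 ^ (2 * K) * 0) + 0 + M / real L < exp (- f_const d c) + \<epsilon>"
      using add_strict_mono[OF K(1) L(1)] by simp
    ultimately have "eventually (\<lambda>n. U n < exp (- f_const d c) + \<epsilon>) sequentially"
      by (rule order_tendstoD(2))
    moreover have "eventually (\<lambda>n. real n ^ (d - 1) * p n < B) sequentially"
      using order_tendstoD(2)[OF lim, of B] by (simp add: B_def)
    moreover have "eventually (\<lambda>n. (d - 1) * (2 * L) \<le> n) sequentially"
      by (rule eventually_ge_at_top)
    ultimately show ?thesis using evy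
    proof eventually_elim
      case (elim n)
      have "Q n \<le> exp (- (\<Sum>C\<in>circuits_upto d (V n) K. p n ^ card C) + 4 ^ (2 * K) * (dense_bound d B (2 * K) / real (card (V n))))
        + dense_bound d B L / real (card (V n)) + dense_bound d B K * (real (d * K) / (1 - y n)) / real L"
        unfolding Q_def using V d p[of n] K L elim
        by (intro unicycle_free_prob_le) (auto simp: y_def)
      also have "\<dots> \<le> U n"
        using sum_circuits_ge[OF V(1) d, of "p n" n K] p[of n] by (simp add: U_def V s_def)
      finally show ?case using elim by linarith
    qed
  qed
  have "Q \<longlonglongrightarrow> exp (- f_const d c)"
  proof (rule order_tendstoI)
    fix a assume "a < exp (- f_const d c)"
    from order_tendstoD(1)[OF limlo this] evlo
    show "eventually (\<lambda>n. a < Q n) sequentially" by eventually_elim linarith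
  next
    fix a assume "exp (- f_const d c) < a"
    then show "eventually (\<lambda>n. Q n < a) sequentially"
      using up[of "a - exp (- f_const d c)"] by simp
  qed
  then show ?thesis by (simp add: Q_def[abs_def])
qed

section \<open>The probability of a given fragment\<close>

lemma link_image: "(u, v) \<in> link S \<Longrightarrow> (f u, f v) \<in> link ((`) f ` S)"
  by (auto simp: link_def)

lemma rtrancl_link_image: "(u, v) \<in> (link S)\<^sup>* \<Longrightarrow> (f u, f v) \<in> (link ((`) f ` S))\<^sup>*"
  by (induction rule: rtrancl_induct) (auto intro: rtrancl_into_rtrancl link_image)

lemma image_inv_into_image:
  assumes "inj_on f V" "S \<subseteq> Pow V"
  shows "(`) (inv_into V f) ` (`) f ` S = S"
proof -
  have "inv_into V f ` f ` e = e" if "e \<in> S" for e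
    using that assms by (intro inv_into_image_cancel) auto
  then show ?thesis by (simp add: image_image)
qed

lemma rtrancl_link_image_iff:
  assumes "inj_on f V" "S \<subseteq> Pow V" "u \<in> V" "v \<in> V"
  shows "(f u, f v) \<in> (link ((`) f ` S))\<^sup>* \<longleftrightarrow> (u, v) \<in> (link S)\<^sup>*"
  using rtrancl_link_image[of "f u" "f v" "(`) f ` S" "inv_into V f"] rtrancl_link_image[of u v S f]
    image_inv_into_image[OF assms(1,2)] assms by auto

lemma component_of_simps:
  "verts (component_of H v) = {w \<in> verts H. (v, w) \<in> (link (edges H))\<^sup>*}"
  "edges (component_of H v) = {e \<in> edges H. e \<subseteq> verts (component_of H v)}"
  by (simp_all add: component_of_def Let_def adj_link)

lemma component_of_relabel:
  assumes "inj_on f (verts H)" "edges H \<subseteq> Pow (verts H)" "v \<in> verts H"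
  shows "component_of (relabel f H) (f v) = relabel f (component_of H v)"
proof (rule hypergraph.expand, intro conjI)
  show v: "verts (component_of (relabel f H) (f v)) = verts (relabel f (component_of H v))"
    using rtrancl_link_image_iff[OF assms(1,2,3)] by (auto simp: component_of_simps)
  have sub: "verts (component_of H v) \<subseteq> verts H" by (auto simp: component_of_simps)
  have "f ` e \<subseteq> f ` verts (component_of H v) \<longleftrightarrow> e \<subseteq> verts (component_of H v)" if "e \<in> edges H" for e
    using that assms(2) sub by (intro inj_on_image_subset_iff[OF assms(1)]) auto
  then show "edges (component_of (relabel f H) (f v)) = edges (relabel f (component_of H v))"
    unfolding component_of_simps(2)[of "relabel f H"] v
    unfolding edges_relabel component_of_simps(2)[of H] by auto
qed

lemma components_relabel:
  assumes "inj_on f (verts H)" "edges H \<subseteq> Pow (verts H)"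
  shows "components (relabel f H) = relabel f ` components H"
  using component_of_relabel[OF assms] by (force simp: components_def)

lemma component_props:
  assumes "C \<in> components H"
  shows "verts C \<subseteq> verts H" "edges C \<subseteq> edges H" "edges C \<subseteq> Pow (verts C)"
  using assms by (auto simp: components_def component_of_simps)

lemma unicycle_edges: "unicycle d C \<Longrightarrow> edges C \<subseteq> Pow (verts C)"
  by (auto simp: unicycle_def uniform_def)

lemma unicycle_relabel:
  assumes "inj_on f (verts C)" "unicycle d C"
  shows "unicycle d (relabel f C)"
proof -
  have sub: "edges C \<subseteq> Pow (verts C)" by (rule unicycle_edges[OF assms(2)])
  have u: "uniform d C" "connected_hg C" "excess d C = 0" using assms(2) by (auto simp: unicycle_def)
  have "card (f ` e) = card e" if "e \<in> edges C" for e
    using that sub by (intro card_image inj_on_subset[OF assms(1)]) auto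
  then have "uniform d (relabel f C)" using u(1) by (auto simp: uniform_def)
  moreover have "connected_hg (relabel f C)"
    using u(2) rtrancl_link_image by (fastforce simp: connected_hg_def adj_link)
  moreover have "card ((`) f ` edges C) = card (edges C)"
    using sub by (intro card_image inj_on_subset[OF inj_on_image_Pow[OF assms(1)]])
  then have "excess d (relabel f C) = 0"
    using u(3) assms(1) by (simp add: excess_def card_image)
  ultimately show ?thesis by (simp add: unicycle_def)
qed

lemma relabel_inv_into:
  assumes "inj_on f (verts C)" "edges C \<subseteq> Pow (verts C)"
  shows "relabel (inv_into (verts C) f) (relabel f C) = C"
  using image_inv_into_image[OF assms] assms(1)
  by (intro hypergraph.expand conjI) (simp_all add: inv_into_image_cancel)

lemma unicycle_relabel_iff:
  assumes "inj_on f (verts C)" "edges C \<subseteq> Pow (verts C)"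
  shows "unicycle d (relabel f C) \<longleftrightarrow> unicycle d C"
proof
  assume "unicycle d (relabel f C)"
  then have "unicycle d (relabel (inv_into (verts C) f) (relabel f C))"
    by (rule unicycle_relabel[rotated]) (auto intro: inj_on_inv_into)
  then show "unicycle d C" by (simp only: relabel_inv_into[OF assms])
qed (use unicycle_relabel assms in auto)

lemma unicycle_free_image:
  assumes "inj_on f V" "R \<subseteq> Pow V"
  shows "unicycle_free d (f ` V) ((`) f ` R) \<longleftrightarrow> unicycle_free d V R"
proof -
  let ?H = "Hypergraph V R"
  have H: "Hypergraph (f ` V) ((`) f ` R) = relabel f ?H" by (simp add: relabel_def)
  have "unicycle d (relabel f C) \<longleftrightarrow> unicycle d C" if "C \<in> components ?H" for C
    using component_props[OF that] by (intro unicycle_relabel_iff inj_on_subset[OF assms(1)]) auto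
  then show ?thesis
    unfolding unicycle_free_def H using components_relabel[of f ?H] assms by simp
qed

lemma unicyclic_family_relabel:
  assumes "H \<in> unicyclic_family d" "inj_on f (verts H)"
  shows "relabel f H \<in> unicyclic_family d"
proof -
  have u: "uniform d H" using assms(1) by (simp add: unicyclic_family_def)
  then have sub: "edges H \<subseteq> Pow (verts H)" by (auto simp: uniform_def)
  have "card (f ` e) = card e" if "e \<in> edges H" for e
    using that sub by (intro card_image inj_on_subset[OF assms(2)]) auto
  then have "uniform d (relabel f H)" using u by (auto simp: uniform_def)
  moreover have "unicycle d (relabel f C)" if "C \<in> components H" for C
    using that component_props[OF that] assms
    by (intro unicycle_relabel inj_on_subset[OF assms(2)]) (auto simp: unicyclic_family_def)
  ultimately show ?thesis
    using components_relabel[OF assms(2) sub] by (auto simp: unicyclic_family_def)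
qed

text \<open>The empty edge is excluded from \<open>R2\<close> because it is a subset of every vertex
  set, so \<open>component_of\<close> would put it into components on \<open>V1\<close>.\<close>

lemma component_of_disjoint_union:
  assumes "V1 \<inter> V2 = {}" "R1 \<subseteq> Pow V1" "R2 \<subseteq> Pow V2 - {{}}" "v \<in> V1"
  shows "component_of (Hypergraph (V1 \<union> V2) (R1 \<union> R2)) v = component_of (Hypergraph V1 R1) v"
proof -
  have reach: "w \<in> V1 \<and> (v, w) \<in> (link R1)\<^sup>*" if "(v, w) \<in> (link (R1 \<union> R2))\<^sup>*" for w
    using that
  proof (induction rule: rtrancl_induct)
    case base
    then show ?case using assms(4) by simp
  next
    case (step y z)
    then obtain e where e: "e \<in> R1 \<union> R2" "y \<in> e" "z \<in> e" by (auto simp: link_def)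
    then have "e \<in> R1" using step.IH assms by blast
    then have "(y, z) \<in> link R1" "z \<in> V1" using e assms(2) by (auto simp: link_def)
    then show ?case using step.IH by (auto intro: rtrancl_into_rtrancl)
  qed
  have v: "verts (component_of (Hypergraph (V1 \<union> V2) (R1 \<union> R2)) v) = verts (component_of (Hypergraph V1 R1) v)"
    using reach rtrancl_link_mono[of v _ R1 "R1 \<union> R2"] by (auto simp: component_of_simps)
  moreover have "edges (component_of (Hypergraph (V1 \<union> V2) (R1 \<union> R2)) v) = edges (component_of (Hypergraph V1 R1) v)"
  proof -
    have "e \<notin> R2" if "e \<subseteq> verts (component_of (Hypergraph V1 R1) v)" for e
    proof
      assume "e \<in> R2"
      moreover have "e \<subseteq> V1" using that by (auto simp: component_of_simps(1))
      ultimately have "e \<subseteq> V1 \<inter> V2" "e \<noteq> {}" using assms(3) by blast+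
      then show False using assms(1) by simp
    qed
    then show ?thesis unfolding component_of_simps(2) v by auto
  qed
  ultimately show ?thesis by (intro hypergraph.expand conjI)
qed

lemma components_disjoint_union:
  assumes "V1 \<inter> V2 = {}" "R1 \<subseteq> Pow V1 - {{}}" "R2 \<subseteq> Pow V2 - {{}}"
  shows "components (Hypergraph (V1 \<union> V2) (R1 \<union> R2)) = components (Hypergraph V1 R1) \<union> components (Hypergraph V2 R2)"
proof -
  have "component_of (Hypergraph (V1 \<union> V2) (R1 \<union> R2)) v = component_of (Hypergraph V1 R1) v" if "v \<in> V1" for v
    using assms that by (intro component_of_disjoint_union) auto
  moreover have "component_of (Hypergraph (V1 \<union> V2) (R1 \<union> R2)) v = component_of (Hypergraph V2 R2) v" if "v \<in> V2" for v
    using component_of_disjoint_union[of V2 V1 R2 R1 v] assms that by (auto simp: Un_commute)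
  ultimately show ?thesis by (simp add: components_def image_Un)
qed

section \<open>Components as a partition\<close>

lemma Union_components:
  assumes "edges H \<subseteq> Pow (verts H) - {{}}"
  shows "(\<Union>C\<in>components H. verts C) = verts H" "(\<Union>C\<in>components H. edges C) = edges H"
proof -
  show "(\<Union>C\<in>components H. verts C) = verts H"
    by (auto simp: components_def component_of_simps)
  show "(\<Union>C\<in>components H. edges C) = edges H"
  proof
    show "edges H \<subseteq> (\<Union>C\<in>components H. edges C)"
    proof
      fix e assume e: "e \<in> edges H"
      then obtain v where v: "v \<in> e" "v \<in> verts H" using assms by auto
      have "e \<subseteq> verts (component_of H v)"
        using e v assms by (auto simp: component_of_simps link_def)
      then have "e \<in> edges (component_of H v)" using e by (simp add: component_of_simps(2))
      then show "e \<in> (\<Union>C\<in>components H. edges C)" using v by (auto simp: components_def)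
    qed
  qed (auto simp: components_def component_of_simps)
qed

lemma component_edge_closed:
  assumes "C \<in> components H" "e \<in> edges H" "e \<inter> verts C \<noteq> {}" "e \<subseteq> verts H"
  shows "e \<in> edges C"
proof -
  from assms(1) obtain v where C: "C = component_of H v" by (auto simp: components_def)
  obtain z where z: "z \<in> e" "(v, z) \<in> (link (edges H))\<^sup>*" using assms(3) by (auto simp: C component_of_simps)
  have "e \<subseteq> verts C"
  proof
    fix x assume "x \<in> e"
    then have "(z, x) \<in> link (edges H)" using z assms(2) by (auto simp: link_def)
    then show "x \<in> verts C" using z \<open>x \<in> e\<close> assms(4) by (auto simp: C component_of_simps)
  qed
  then show ?thesis using assms(2) by (simp add: C component_of_simps(2))
qed

lemma components_meet_eq:
  assumes "C \<in> components H" "D \<in> components H" "verts C \<inter> verts D \<noteq> {}"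
  shows "C = D"
proof -
  from assms obtain u v where C: "C = component_of H u" and D: "D = component_of H v"
    by (auto simp: components_def)
  obtain z where z: "(u, z) \<in> (link (edges H))\<^sup>*" "(v, z) \<in> (link (edges H))\<^sup>*"
    using assms(3) by (auto simp: C D component_of_simps)
  then have uv: "(u, v) \<in> (link (edges H))\<^sup>*" "(v, u) \<in> (link (edges H))\<^sup>*"
    by (meson rtrancl_link_sym rtrancl_trans)+
  have "verts C = verts D"
    using uv by (auto simp: C D component_of_simps intro: rtrancl_trans)
  moreover from this have "edges C = edges D"
    unfolding C D component_of_simps(2) by simp
  ultimately show ?thesis by (intro hypergraph.expand conjI)
qed

lemma unicyclic_family_edges:
  assumes "H \<in> unicyclic_family d" "d \<ge> 1"
  shows "edges H \<subseteq> Pow (verts H) - {{}}" "finite (verts H)" "edges H \<subseteq> dsub d (verts H)"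
  using assms by (auto simp: unicyclic_family_def uniform_def dsub_def)

text \<open>Sum the excess over the components, which have disjoint vertex and edge sets. This is
  the relation that cancels the powers of \<open>n\<close> in the limit.\<close>

lemma unicyclic_family_card:
  assumes "H \<in> unicyclic_family d" "d \<ge> 1"
  shows "card (verts H) = (d - 1) * card (edges H)"
proof -
  note E = unicyclic_family_edges[OF assms]
  have finC: "finite (components H)" using E(2) by (simp add: components_def)
  have finE: "finite (edges H)" using E(1,2) by (auto intro: finite_subset[of _ "Pow (verts H)"])
  have "card (verts C) = (d - 1) * card (edges C)" if "C \<in> components H" for C
  proof -
    have "excess d C = 0" using that assms(1) by (auto simp: unicyclic_family_def unicycle_def)
    then have "int (card (verts C)) = (int d - 1) * int (card (edges C))" by (simp add: excess_def)
    also have "\<dots> = int ((d - 1) * card (edges C))" using assms(2) by (simp add: of_nat_diff)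
    finally show ?thesis by (simp only: of_nat_eq_iff)
  qed
  then have "(\<Sum>C\<in>components H. card (verts C)) = (d - 1) * (\<Sum>C\<in>components H. card (edges C))"
    by (simp add: sum_distrib_left)
  moreover have "card (\<Union>C\<in>components H. verts C) = (\<Sum>C\<in>components H. card (verts C))"
  proof (intro card_UN_disjoint ballI impI finC)
    fix C assume C: "C \<in> components H"
    then show "finite (verts C)" using component_props(1) E(2) finite_subset by metis
    fix D assume "D \<in> components H" "C \<noteq> D"
    then show "verts C \<inter> verts D = {}" using components_meet_eq[OF C] by metis
  qed
  moreover have "card (\<Union>C\<in>components H. edges C) = (\<Sum>C\<in>components H. card (edges C))"
  proof (intro card_UN_disjoint ballI impI finC)
    fix C assume "C \<in> components H"
    then show "finite (edges C)" using component_props(2) finE finite_subset by metis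
    fix D assume CD: "D \<in> components H" "C \<noteq> D"
    show "edges C \<inter> edges D = {}"
    proof (rule ccontr)
      assume "edges C \<inter> edges D \<noteq> {}"
      then obtain e where e: "e \<in> edges C" "e \<in> edges D" by auto
      then have "e \<noteq> {}" "e \<subseteq> verts C \<inter> verts D"
        using E(1) component_props[OF \<open>C \<in> components H\<close>] component_props[OF CD(1)] by auto
      then show False using components_meet_eq[OF \<open>C \<in> components H\<close> CD(1)] CD(2) by auto
    qed
  qed
  ultimately show ?thesis using Union_components[OF E(1)] by simp
qed

text \<open>The three conditions concern disjoint sets of potential edges: those of
  \<open>H\<close>, the others that meet \<open>verts H\<close>, and those inside
  \<open>V - verts H\<close>. Hence their probabilities multiply.\<close>

lemma fragment_eq_iff:
  assumes "finite V" "R \<subseteq> dsub d V" "d \<ge> 1" "H \<in> unicyclic_family d" "verts H \<subseteq> V"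
  shows "fragment d (Hypergraph V R) = H \<longleftrightarrow>
    edges H \<subseteq> R \<and> R - edges H \<subseteq> dsub d (V - verts H) \<and> unicycle_free d (V - verts H) (R - edges H)"
proof -
  let ?G = "Hypergraph V R"
  let ?W = "V - verts H"
  let ?S = "R - edges H"
  note E = unicyclic_family_edges[OF assms(4,3)]
  have H: "Hypergraph (verts H) (edges H) = H" by (cases H) simp
  have dsub_ne: "dsub d X \<subseteq> Pow X - {{}}" for X :: "'a set" using assms(3) by (auto simp: dsub_def)
  have comps: "components ?G = components H \<union> components (Hypergraph ?W ?S)"
    if "edges H \<subseteq> R" "?S \<subseteq> dsub d ?W"
  proof -
    have "components (Hypergraph (verts H \<union> ?W) (edges H \<union> ?S)) =
        components (Hypergraph (verts H) (edges H)) \<union> components (Hypergraph ?W ?S)"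
      using E(1) that(2) dsub_ne by (intro components_disjoint_union) blast+
    moreover have "verts H \<union> ?W = V" "edges H \<union> ?S = R" using that(1) assms(5) by auto
    ultimately show ?thesis by (simp only: H)
  qed
  show ?thesis
  proof
    assume R: "edges H \<subseteq> R \<and> ?S \<subseteq> dsub d ?W \<and> unicycle_free d ?W ?S"
    then have "{C \<in> components ?G. unicycle d C} = components H"
      using comps assms(4) by (auto simp: unicycle_free_def unicyclic_family_def)
    then show "fragment d ?G = H"
      unfolding fragment_def by (simp add: Union_components[OF E(1)] H)
  next
    assume F: "fragment d ?G = H"
    have vH: "verts H = (\<Union>C\<in>{C \<in> components ?G. unicycle d C}. verts C)"
      and eH: "edges H = (\<Union>C\<in>{C \<in> components ?G. unicycle d C}. edges C)"
      using arg_cong[OF F, of verts] arg_cong[OF F, of edges] by (simp_all add: fragment_def)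
    have 1: "edges H \<subseteq> R" unfolding eH using component_props(2)[of _ ?G] by fastforce
    have 2: "?S \<subseteq> dsub d ?W"
    proof
      fix e assume e: "e \<in> ?S"
      have "e \<inter> verts H = {}"
      proof (rule ccontr)
        assume "e \<inter> verts H \<noteq> {}"
        then obtain C where C: "C \<in> components ?G" "unicycle d C" "e \<inter> verts C \<noteq> {}" unfolding vH by auto
        then have "e \<in> edges C" using e assms(2) by (intro component_edge_closed[of C ?G e]) (auto simp: dsub_def)
        then show False using C e unfolding eH by auto
      qed
      then show "e \<in> dsub d ?W" using e assms(2) by (auto simp: dsub_def)
    qed
    have 3: "unicycle_free d ?W ?S"
      unfolding unicycle_free_def
    proof (intro ballI notI)
      fix C assume C: "C \<in> components (Hypergraph ?W ?S)" "unicycle d C"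
      then have "C \<in> components ?G" using comps[OF 1 2] by auto
      then have "verts C \<subseteq> verts H" unfolding vH using C by blast
      moreover have "verts C \<subseteq> ?W" using component_props(1)[OF C(1)] by simp
      moreover have "verts C \<noteq> {}" using C(2) by (auto simp: unicycle_def connected_hg_def)
      ultimately show False by auto
    qed
    show "edges H \<subseteq> R \<and> ?S \<subseteq> dsub d ?W \<and> unicycle_free d ?W ?S" using 1 2 3 by simp
  qed
qed

text \<open>The leftover vertex set varies with the copy of \<open>H\<close>; by this lemma every
  copy contributes the same probability.\<close>

lemma unicycle_free_prob_card:
  assumes "finite V" "finite W" "card V = card W"
  shows "bexp (dsub d V) p (\<lambda>R. of_bool (unicycle_free d V R)) = bexp (dsub d W) p (\<lambda>R. of_bool (unicycle_free d W R))"
proof -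
  obtain h where h: "bij_betw h V W" using assms finite_same_card_bij by blast
  then have inj: "inj_on h V" and im: "h ` V = W" by (auto simp: bij_betw_def)
  have injP: "inj_on ((`) h) (dsub d V)"
    by (rule inj_on_subset[OF inj_on_image_Pow[OF inj]]) (auto simp: dsub_def)
  have "(`) h ` dsub d V = dsub d W"
  proof
    show "(`) h ` dsub d V \<subseteq> dsub d W"
      using im inj by (auto simp: dsub_def card_image inj_on_subset)
    show "dsub d W \<subseteq> (`) h ` dsub d V"
    proof
      fix e assume e: "e \<in> dsub d W"
      then obtain a where a: "a \<subseteq> V" "e = h ` a" using im by (auto simp: dsub_def subset_image_iff)
      then have "card a = d" using e inj by (auto simp: dsub_def card_image inj_on_subset)
      then show "e \<in> (`) h ` dsub d V" using a by (auto simp: dsub_def)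
    qed
  qed
  then have "bexp (dsub d W) p (\<lambda>R. of_bool (unicycle_free d W R)) =
      bexp (dsub d V) p (\<lambda>R. of_bool (unicycle_free d (h ` V) ((`) h ` R)))"
    using bexp_image[of "dsub d V" "(`) h" p] assms(1) injP by (simp add: im)
  also have "\<dots> = bexp (dsub d V) p (\<lambda>R. of_bool (unicycle_free d V R))"
  proof (rule bexp_cong)
    fix R assume "R \<subseteq> dsub d V"
    then have "R \<subseteq> Pow V" by (auto simp: dsub_def)
    then show "of_bool (unicycle_free d (h ` V) ((`) h ` R)) = (of_bool (unicycle_free d V R) :: real)"
      using unicycle_free_image[OF inj] by simp
  qed
  finally show ?thesis by simp
qed

lemma fragment_eq_prob:
  assumes "finite V" "d \<ge> 1" "H \<in> unicyclic_family d" "verts H \<subseteq> V"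
  shows "bexp (dsub d V) p (\<lambda>R. of_bool (fragment d (Hypergraph V R) = H)) =
    p ^ card (edges H) * ((1 - p) ^ ((card V choose d) - (card V - card (verts H) choose d) - card (edges H))
      * bexp (dsub d (V - verts H)) p (\<lambda>R. of_bool (unicycle_free d (V - verts H) R)))"
proof -
  let ?W = "V - verts H"
  let ?E = "edges H"
  \<comment> \<open>The potential edges that meet \<open>verts H\<close> without belonging to
    \<open>H\<close>.\<close>
  define D where "D = dsub d V - dsub d ?W - ?E"
  note E = unicyclic_family_edges[OF assms(3,2)]
  have EV: "?E \<subseteq> dsub d V" using E(3) assms(4) unfolding dsub_def by blast
  have EW: "?E \<inter> dsub d ?W = {}" using E(1) by (auto simp: dsub_def)
  have WV: "dsub d ?W \<subseteq> dsub d V" by (auto simp: dsub_def)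
  have "bexp (dsub d V) p (\<lambda>R. of_bool (fragment d (Hypergraph V R) = H)) =
    bexp (dsub d V) p (\<lambda>R. of_bool (?E \<subseteq> R) * (of_bool ((R - ?E) \<inter> D = {}) * of_bool (unicycle_free d ?W (R - ?E))))"
  proof (rule bexp_cong)
    fix R assume R: "R \<subseteq> dsub d V"
    have "R - ?E \<subseteq> dsub d ?W \<longleftrightarrow> (R - ?E) \<inter> D = {}" using R by (auto simp: D_def)
    then show "of_bool (fragment d (Hypergraph V R) = H) =
        (of_bool (?E \<subseteq> R) * (of_bool ((R - ?E) \<inter> D = {}) * of_bool (unicycle_free d ?W (R - ?E))) :: real)"
      unfolding fragment_eq_iff[OF assms(1) R assms(2-4)] by simp
  qed
  also have "\<dots> = p ^ card ?E * bexp (dsub d V - ?E) p (\<lambda>R. of_bool (((R \<union> ?E) - ?E) \<inter> D = {}) * of_bool (unicycle_free d ?W ((R \<union> ?E) - ?E)))"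
    using assms(1) EV by (intro bexp_superset) auto
  also have "bexp (dsub d V - ?E) p (\<lambda>R. of_bool (((R \<union> ?E) - ?E) \<inter> D = {}) * of_bool (unicycle_free d ?W ((R \<union> ?E) - ?E)))
     = bexp (dsub d V - ?E) p (\<lambda>R. of_bool (R \<inter> D = {}) * of_bool (unicycle_free d ?W R))"
  proof (rule bexp_cong)
    fix R assume "R \<subseteq> dsub d V - ?E"
    then have "(R \<union> ?E) - ?E = R" by auto
    then show "of_bool (((R \<union> ?E) - ?E) \<inter> D = {}) * of_bool (unicycle_free d ?W ((R \<union> ?E) - ?E)) =
      (of_bool (R \<inter> D = {}) * of_bool (unicycle_free d ?W R) :: real)" by simp
  qed
  also have "\<dots> = (1 - p) ^ card D * bexp (dsub d V - ?E - D) p (\<lambda>R. of_bool (unicycle_free d ?W R))"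
    using assms(1) by (intro bexp_avoid) (auto simp: D_def)
  also have "dsub d V - ?E - D = dsub d ?W" using EW WV by (auto simp: D_def)
  also have "card D = (card V choose d) - (card V - card (verts H) choose d) - card ?E"
  proof -
    have "card D = card (dsub d V) - card (dsub d ?W) - card ?E"
      unfolding D_def using assms(1) EV EW WV
      by (subst card_Diff_subset) (auto simp: card_Diff_subset intro: finite_subset)
    moreover have "card (dsub d V) = card V choose d" "card (dsub d ?W) = card ?W choose d"
      using n_subsets[of V d] n_subsets[of ?W d] assms(1) by (simp_all add: dsub_def)
    moreover have "card ?W = card V - card (verts H)" using assms(4) E(2) by (simp add: card_Diff_subset)
    ultimately show ?thesis by simp
  qed
  finally show ?thesis .
qed

text \<open>Replaces isomorphism by membership in a finite set, so that the event splits into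
  disjoint events, one for each labeled copy.\<close>

lemma iso_iff_copies:
  assumes "edges G \<subseteq> Pow (verts G)" "edges H \<subseteq> Pow (verts H)" "verts G \<subseteq> V"
  shows "G \<simeq> H \<longleftrightarrow> G \<in> copies H V"
proof
  assume "G \<simeq> H"
  then obtain f where f: "bij_betw f (verts G) (verts H)" "(\<lambda>e. f ` e) ` edges G = edges H"
    by (auto simp: iso_def)
  then have inj: "inj_on f (verts G)" and im: "f ` verts G = verts H" by (auto simp: bij_betw_def)
  have H: "H = relabel f G" using f im by (intro hypergraph.expand conjI) simp_all
  define g where "g = restrict (inv_into (verts G) f) (verts H)"
  have "relabel g H = relabel (inv_into (verts G) f) H"
    using assms(2) by (intro relabel_cong) (auto simp: g_def)
  also have "\<dots> = G" unfolding H by (rule relabel_inv_into[OF inj assms(1)])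
  finally have "G = relabel g H" by simp
  moreover have "g \<in> verts H \<rightarrow>\<^sub>E V"
    using im assms(3) inv_into_into[of _ f "verts G"] by (auto simp: g_def)
  moreover have "inj_on g (verts H)"
    unfolding g_def inj_on_restrict_eq using im by (intro inj_on_inv_into) auto
  ultimately show "G \<in> copies H V" by (auto simp: copies_def)
next
  assume "G \<in> copies H V"
  then obtain f where f: "inj_on f (verts H)" "G = relabel f H" by (auto simp: copies_def)
  have "relabel (inv_into (verts H) f) G = H" unfolding f(2) by (rule relabel_inv_into[OF f(1) assms(2)])
  then have "edges (relabel (inv_into (verts H) f) G) = edges H" by simp
  then have "(\<lambda>e. inv_into (verts H) f ` e) ` edges G = edges H" by simp
  moreover have "bij_betw (inv_into (verts H) f) (verts G) (verts H)"
    using f by (intro bij_betw_inv_into) (simp add: bij_betw_def)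
  ultimately show "G \<simeq> H" by (auto simp: iso_def)
qed

section \<open>Exact probability of a fragment up to isomorphism\<close>

lemma fragment_iso_prob:
  assumes "d \<ge> 1" "H \<in> unicyclic_family d" "0 \<le> p" "p \<le> 1" "card (verts H) \<le> n"
  shows "measure_pmf.prob (binomial_hypergraph d n p) {G. fragment d G \<simeq> H} =
    falling n (card (verts H)) / real (aut H) * (p ^ card (edges H) *
      ((1 - p) ^ ((n choose d) - (n - card (verts H) choose d) - card (edges H))
      * bexp (dsub d {1..n - card (verts H)}) p (\<lambda>R. of_bool (unicycle_free d {1..n - card (verts H)} R))))"
proof -
  let ?V = "{1..n}"
  let ?v = "card (verts H)"
  let ?\<Omega> = "dsub d ?V"
  let ?q = "p ^ card (edges H) * ((1 - p) ^ ((n choose d) - (n - ?v choose d) - card (edges H))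
      * bexp (dsub d {1..n - ?v}) p (\<lambda>R. of_bool (unicycle_free d {1..n - ?v} R)))"
  note E = unicyclic_family_edges[OF assms(2,1)]
  have cop: "finite (copies H ?V)"
    unfolding copies_def using E(2) by (auto intro!: finite_imageI finite_PiE)
  have aut: "aut H \<noteq> 0"
  proof -
    have "id \<in> {\<pi>. \<pi> permutes verts H \<and> (\<lambda>e. \<pi> ` e) ` edges H = edges H}" by (simp add: permutes_id)
    moreover have "finite {\<pi>. \<pi> permutes verts H \<and> (\<lambda>e. \<pi> ` e) ` edges H = edges H}"
      using finite_permutations[OF E(2)] by (rule rev_finite_subset) auto
    ultimately show ?thesis unfolding aut_def card_eq_0_iff by blast
  qed
  have "measure_pmf.prob (binomial_hypergraph d n p) {G. fragment d G \<simeq> H} =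
      measure_pmf.expectation (Pi_pmf ?\<Omega> False (\<lambda>_. bernoulli_pmf p))
        (\<lambda>b. of_bool (fragment d (Hypergraph ?V {e \<in> ?\<Omega>. b e}) \<simeq> H))"
  proof -
    have "(\<lambda>b. of_bool (fragment d (Hypergraph ?V {e \<in> ?\<Omega>. b e}) \<simeq> H) :: real) =
        indicator {b. fragment d (Hypergraph ?V {e \<in> ?\<Omega>. b e}) \<simeq> H}"
      by (auto simp: indicator_def)
    then show ?thesis
      unfolding binomial_hypergraph_def d_subsets_eq_dsub by (simp add: vimage_def)
  qed
  also have "\<dots> = bexp ?\<Omega> p (\<lambda>R. of_bool (fragment d (Hypergraph ?V R) \<simeq> H))"
    using expectation_Pi_bernoulli[of ?\<Omega> p "\<lambda>R. of_bool (fragment d (Hypergraph ?V R) \<simeq> H)"] assms by simp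
  also have "\<dots> = bexp ?\<Omega> p (\<lambda>R. \<Sum>G\<in>copies H ?V. of_bool (fragment d (Hypergraph ?V R) = G))"
  proof (rule bexp_cong)
    fix R assume "R \<subseteq> ?\<Omega>"
    let ?F = "fragment d (Hypergraph ?V R)"
    have "edges ?F \<subseteq> Pow (verts ?F)" "verts ?F \<subseteq> ?V"
      using component_props[of _ "Hypergraph ?V R"] by (fastforce simp: fragment_def)+
    then have "?F \<simeq> H \<longleftrightarrow> ?F \<in> copies H ?V" using E(1) by (intro iso_iff_copies) auto
    then show "of_bool (?F \<simeq> H) = (\<Sum>G\<in>copies H ?V. of_bool (?F = G) :: real)"
      using cop by (simp add: of_bool_def sum.delta)
  qed
  also have "\<dots> = (\<Sum>G\<in>copies H ?V. bexp ?\<Omega> p (\<lambda>R. of_bool (fragment d (Hypergraph ?V R) = G)))"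
    by (rule bexp_sum)
  also have "\<dots> = (\<Sum>G\<in>copies H ?V. ?q)"
  proof (intro sum.cong refl)
    fix G assume "G \<in> copies H ?V"
    then obtain f where f: "f \<in> verts H \<rightarrow>\<^sub>E ?V" "inj_on f (verts H)" "G = relabel f H" by (auto simp: copies_def)
    have G: "G \<in> unicyclic_family d" unfolding f(3) using assms(2) f(2) by (rule unicyclic_family_relabel)
    have GV: "verts G \<subseteq> ?V" using f by auto
    have cv: "card (verts G) = ?v" using f by (simp add: card_image)
    have ce: "card (edges G) = card (edges H)"
      unfolding f(3) edges_relabel using E(1) by (intro card_image inj_on_subset[OF inj_on_image_Pow[OF f(2)]]) auto
    have "finite (verts G)" using GV finite_subset by blast
    then have "card (?V - verts G) = n - ?v" using GV cv by (simp add: card_Diff_subset)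
    then have "bexp (dsub d (?V - verts G)) p (\<lambda>R. of_bool (unicycle_free d (?V - verts G) R)) =
       bexp (dsub d {1..n - ?v}) p (\<lambda>R. of_bool (unicycle_free d {1..n - ?v} R))"
      by (intro unicycle_free_prob_card) auto
    then show "bexp ?\<Omega> p (\<lambda>R. of_bool (fragment d (Hypergraph ?V R) = G)) = ?q"
      using fragment_eq_prob[OF _ assms(1) G GV, of p] by (simp add: cv ce)
  qed
  also have "\<dots> = real (card (copies H ?V)) * ?q" by simp
  also have "real (card (copies H ?V)) = falling n ?v / real (aut H)"
    using card_copies_mult_aut[of H ?V] E aut by (simp add: field_simps) blast
  finally show ?thesis .
qed

section \<open>The limit\<close>

lemma falling_eq_choose: "falling n k = fact k * real (n choose k)"
proof (cases "k \<le> n")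
  case True
  have "real (n choose k) = (\<Prod>i = 0..<k. real (n - i) / real (k - i))"
    using binomial_altdef_of_nat[OF True, where 'a = real] by simp
  also have "\<dots> = falling n k / (\<Prod>i = 0..<k. real (k - i))"
    by (simp add: falling_def prod_dividef lessThan_atLeast0)
  also have "(\<Prod>i = 0..<k. real (k - i)) = fact k"
    using fact_prod_rev[of k, where 'a = real] by simp
  finally show ?thesis by simp
next
  case False
  then have "falling n k = 0" unfolding falling_def by (intro prod_zero) (auto intro!: bexI[of _ n])
  then show ?thesis using False by simp
qed

text \<open>Pascal's rule, telescoped. It gives the number of potential edges meeting
  \<open>v\<close> vertices as a bounded number of terms of order \<open>m ^ (d - 1)\<close>, so
  that no cancellation of order \<open>m ^ d\<close> has to be estimated.\<close>

lemma choose_diff_eq_sum: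
  assumes "d \<ge> 1"
  shows "(m + v choose d) - (m choose d) = (\<Sum>j<v. m + j choose (d - 1))"
proof -
  have "(m + v choose d) = (m choose d) + (\<Sum>j<v. m + j choose (d - 1))"
  proof (induction v)
    case (Suc v)
    obtain d' where "d = Suc d'" using assms by (cases d) auto
    then show ?case using Suc by simp
  qed simp
  then show ?thesis by simp
qed

lemma tendsto_one_minus_power:
  fixes q :: "nat \<Rightarrow> real" and N :: "nat \<Rightarrow> nat"
  assumes "\<And>n. 0 \<le> q n" "q \<longlonglongrightarrow> 0" "(\<lambda>n. real (N n) * q n) \<longlonglongrightarrow> l"
  shows "(\<lambda>n. (1 - q n) ^ N n) \<longlonglongrightarrow> exp (- l)"
proof (rule tendsto_sandwich)
  have ev: "eventually (\<lambda>n. q n < 1) sequentially" using order_tendstoD(2)[OF assms(2)] by auto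
  show "eventually (\<lambda>n. exp (- (real (N n) * q n / (1 - q n))) \<le> (1 - q n) ^ N n) sequentially"
    using ev
  proof eventually_elim
    case (elim n)
    have "inverse (1 - q n) = 1 + q n / (1 - q n)" using elim by (simp add: field_simps)
    also have "\<dots> \<le> exp (q n / (1 - q n))" by (rule exp_ge_add_one_self)
    finally have "exp (- (q n / (1 - q n))) \<le> 1 - q n"
      using elim by (simp add: exp_minus field_simps)
    then have "exp (- (q n / (1 - q n))) ^ N n \<le> (1 - q n) ^ N n" by (intro power_mono) auto
    then show ?case by (simp flip: exp_of_nat_mult)
  qed
  show "eventually (\<lambda>n. (1 - q n) ^ N n \<le> exp (- (real (N n) * q n))) sequentially"
    using ev
  proof eventually_elim
    case (elim n)
    have "1 - q n \<le> exp (- q n)" using exp_ge_add_one_self[of "- q n"] by simp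
    then have "(1 - q n) ^ N n \<le> exp (- q n) ^ N n" using elim by (intro power_mono) auto
    then show ?case by (simp flip: exp_of_nat_mult)
  qed
  have "(\<lambda>n. exp (- (real (N n) * q n / (1 - q n)))) \<longlonglongrightarrow> exp (- (l / (1 - 0)))"
    by (intro tendsto_intros assms) auto
  then show "(\<lambda>n. exp (- (real (N n) * q n / (1 - q n)))) \<longlonglongrightarrow> exp (- l)" by simp
  show "(\<lambda>n. exp (- (real (N n) * q n))) \<longlonglongrightarrow> exp (- l)"
    by (intro tendsto_intros assms)
qed

theorem theorem22:
  fixes d :: nat and p :: "nat \<Rightarrow> real" and c :: real and H :: "'a hypergraph"
  assumes "d \<ge> 3"
    and "\<And>n. 0 \<le> p n \<and> p n \<le> 1"
    and "p \<sim>[at_top] (\<lambda>n. c / real n ^ (d - 1))"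
    and "0 < c" and "c < fact (d - 2)"
    and "H \<in> unicyclic_family d"
  shows "(\<lambda>n. measure_pmf.prob (binomial_hypergraph d n (p n)) {G. fragment d G \<simeq> H})
           \<longlonglongrightarrow> exp (- f_const d c) *
              ((exp (- c / fact (d - 2)) * c) ^ card (edges H) / real (aut H))"
proof -
  define h where "h = card (edges H)"
  define v where "v = card (verts H)"
  have d1: "d \<ge> 1" using assms(1) by simp
  have v: "v = (d - 1) * h"
    unfolding v_def h_def by (rule unicyclic_family_card[OF assms(6) d1])
  have lim: "(\<lambda>n. real n ^ (d - 1) * p n) \<longlonglongrightarrow> c"
  proof -
    \<comment> \<open>At \<open>n = 0\<close> the reference function is \<open>c / 0 = 0\<close>;
      for positive \<open>n\<close> it is positive, and the case distinction disappears.\<close>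
    have "(\<lambda>n. if p n = 0 \<and> c / real n ^ (d - 1) = 0 then 1 else p n / (c / real n ^ (d - 1))) \<longlonglongrightarrow> 1"
      using assms(3) unfolding asymp_equiv_def .
    moreover have "eventually (\<lambda>n. (if p n = 0 \<and> c / real n ^ (d - 1) = 0 then 1 else p n / (c / real n ^ (d - 1)))
        = real n ^ (d - 1) * p n / c) sequentially"
      using eventually_gt_at_top[of 0] by eventually_elim (use assms(4) in auto)
    ultimately have "(\<lambda>n. real n ^ (d - 1) * p n / c) \<longlonglongrightarrow> 1" by (rule Lim_transform_eventually)
    then have "(\<lambda>n. real n ^ (d - 1) * p n / c * c) \<longlonglongrightarrow> 1 * c" by (intro tendsto_intros)
    then show ?thesis using assms(4) by simp
  qed
  \<comment> \<open>From here on \<open>m = n - v\<close> counts the vertices outside the copy,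
    which removes truncated subtractions from the limits.\<close>
  define q where "q m = p (m + v)" for m
  have q: "0 \<le> q m \<and> q m \<le> 1" for m using assms(2) by (simp add: q_def)
  have limq: "(\<lambda>m. real (m + v) ^ (d - 1) * q m) \<longlonglongrightarrow> c"
    unfolding q_def using LIMSEQ_ignore_initial_segment[OF lim, of v] .
  have ratio: "(\<lambda>m. real (m + j) ^ s / real (m + v) ^ s) \<longlonglongrightarrow> 1" for j s
  proof -
    have "(\<lambda>m. (1 + (real j - real v) / real (m + v)) ^ s) \<longlonglongrightarrow> (1 + 0) ^ s"
      using LIMSEQ_ignore_initial_segment[OF lim_const_over_n[of "real j - real v"], of v]
      by (intro tendsto_intros)
    moreover have "eventually (\<lambda>m. (1 + (real j - real v) / real (m + v)) ^ s = real (m + j) ^ s / real (m + v) ^ s) sequentially"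
      using eventually_gt_at_top[of 0]
      by eventually_elim (simp add: field_simps flip: power_divide)
    ultimately show ?thesis by (simp add: Lim_transform_eventually)
  qed
  have limq': "(\<lambda>m. real m ^ (d - 1) * q m) \<longlonglongrightarrow> c"
  proof -
    have "(\<lambda>m. real (m + 0) ^ (d - 1) / real (m + v) ^ (d - 1) * (real (m + v) ^ (d - 1) * q m)) \<longlonglongrightarrow> 1 * c"
      by (intro tendsto_mult ratio limq)
    moreover have "eventually (\<lambda>m. real (m + 0) ^ (d - 1) / real (m + v) ^ (d - 1) * (real (m + v) ^ (d - 1) * q m)
        = real m ^ (d - 1) * q m) sequentially"
      using eventually_gt_at_top[of 0] by eventually_elim simp
    ultimately show ?thesis by (simp add: Lim_transform_eventually)
  qed
  have limq0: "q \<longlonglongrightarrow> 0"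
  proof -
    have "(\<lambda>m. real m ^ (d - 1) * q m * (1 / real m) ^ (d - 1)) \<longlonglongrightarrow> c * 0 ^ (d - 1)"
      by (intro tendsto_mult limq' tendsto_power lim_const_over_n)
    moreover have "eventually (\<lambda>m. real m ^ (d - 1) * q m * (1 / real m) ^ (d - 1) = q m) sequentially"
      using eventually_gt_at_top[of 0] by eventually_elim (simp add: power_divide)
    ultimately have "q \<longlonglongrightarrow> c * 0 ^ (d - 1)" by (rule Lim_transform_eventually)
    then show ?thesis using assms(1) by (simp add: power_0_left)
  qed
  define N where "N m = (m + v choose d) - (m choose d) - h" for m
  have limchoose: "(\<lambda>m. real (m + j choose (d - 1)) * q m) \<longlonglongrightarrow> c / fact (d - 1)" for j
  proof -
    have "(\<lambda>m. falling (m + j) (d - 1) / real (m + j) ^ (d - 1) * (real (m + j) ^ (d - 1) / real (m + v) ^ (d - 1))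
        * (real (m + v) ^ (d - 1) * q m) / fact (d - 1)) \<longlonglongrightarrow> 1 * 1 * c / fact (d - 1)"
      using LIMSEQ_ignore_initial_segment[OF tendsto_falling[of 0 "d - 1"], of j]
      by (intro tendsto_intros ratio limq) auto
    moreover have "eventually (\<lambda>m. falling (m + j) (d - 1) / real (m + j) ^ (d - 1) * (real (m + j) ^ (d - 1) / real (m + v) ^ (d - 1))
        * (real (m + v) ^ (d - 1) * q m) / fact (d - 1) = real (m + j choose (d - 1)) * q m) sequentially"
      using eventually_gt_at_top[of 0]
    proof eventually_elim
      case (elim m)
      have "real (m + j) \<noteq> 0" "real (m + v) \<noteq> 0" using elim by auto
      then show ?case by (simp add: falling_eq_choose)
    qed
    ultimately show ?thesis by (simp add: Lim_transform_eventually)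
  qed
  \<comment> \<open>Each of the \<open>v\<close> terms contributes \<open>c / fact (d - 1)\<close>,
    and \<open>v = (d - 1) * h\<close> turns this into \<open>c / fact (d - 2)\<close> for each edge
    of \<open>H\<close>.\<close>
  have limN: "(\<lambda>m. real (N m) * q m) \<longlonglongrightarrow> real h * (c / fact (d - 2))"
  proof -
    have "(\<lambda>m. (\<Sum>j<v. real (m + j choose (d - 1)) * q m) - real h * q m) \<longlonglongrightarrow> (\<Sum>j<v. c / fact (d - 1)) - real h * 0"
      by (intro tendsto_intros limchoose limq0)
    moreover have "(\<Sum>j<v. c / fact (d - 1)) - real h * 0 = real h * (c / fact (d - 2))"
    proof -
      have "fact (d - 1) = real (d - 1) * fact (d - 2)"
        using assms(1) fact_reduce[of "d - 1", where 'a = real] by (simp add: numeral_2_eq_2)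
      then show ?thesis using assms(1) by (simp add: v)
    qed
    moreover have "eventually (\<lambda>m. (\<Sum>j<v. real (m + j choose (d - 1)) * q m) - real h * q m = real (N m) * q m) sequentially"
      using eventually_ge_at_top[of d]
    proof eventually_elim
      case (elim m)
      \<comment> \<open>Shows that the last subtraction in \<open>N\<close> is exact: for
        \<open>m \<ge> d\<close> each of the \<open>v \<ge> h\<close> binomial coefficients is at
        least 1.\<close>
      have "h \<le> (\<Sum>j<v. m + j choose (d - 1))"
      proof -
        have "h \<le> v" using assms(1) by (cases "d - 1") (simp_all add: v)
        also have "v = (\<Sum>j<v. 1)" by simp
        also have "\<dots> \<le> (\<Sum>j<v. m + j choose (d - 1))"
          using elim by (intro sum_mono) (simp add: Suc_le_eq zero_less_binomial)
        finally show ?thesis .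
      qed
      then have "real (N m) = real (\<Sum>j<v. m + j choose (d - 1)) - real h"
        unfolding N_def choose_diff_eq_sum[OF d1] by (rule of_nat_diff)
      then show ?case by (simp add: left_diff_distrib sum_distrib_right)
    qed
    ultimately show ?thesis by (simp add: Lim_transform_eventually)
  qed
  define Q where "Q m = bexp (dsub d {1..m}) (q m) (\<lambda>R. of_bool (unicycle_free d {1..m} R))" for m
  have limQ: "Q \<longlonglongrightarrow> exp (- f_const d c)"
    unfolding Q_def using assms(1,4,5) q limq' by (intro unicycle_free_limit) auto
  have "(\<lambda>m. falling (m + v) ((d - 1) * h) * q m ^ h) \<longlonglongrightarrow> c ^ h"
    unfolding q_def using LIMSEQ_ignore_initial_segment[OF tendsto_falling_times_power[OF lim, of h], of v] .
  moreover have "(\<lambda>m. (1 - q m) ^ N m) \<longlonglongrightarrow> exp (- (real h * (c / fact (d - 2))))"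
    using q limq0 limN by (intro tendsto_one_minus_power) auto
  ultimately have "(\<lambda>m. falling (m + v) ((d - 1) * h) * q m ^ h / real (aut H) * ((1 - q m) ^ N m * Q m))
      \<longlonglongrightarrow> c ^ h / real (aut H) * (exp (- (real h * (c / fact (d - 2)))) * exp (- f_const d c))"
    unfolding divide_inverse by (intro tendsto_mult tendsto_const limQ)
  also have "c ^ h / real (aut H) * (exp (- (real h * (c / fact (d - 2)))) * exp (- f_const d c)) =
      exp (- f_const d c) * ((exp (- c / fact (d - 2)) * c) ^ h / real (aut H))"
  proof -
    have "exp (- (real h * (c / fact (d - 2)))) = exp (- c / fact (d - 2)) ^ h"
      by (simp flip: exp_of_nat_mult)
    then show ?thesis by (simp add: power_mult_distrib)
  qed
  also have "(\<lambda>m. falling (m + v) ((d - 1) * h) * q m ^ h / real (aut H) * ((1 - q m) ^ N m * Q m)) =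
      (\<lambda>m. measure_pmf.prob (binomial_hypergraph d (m + v) (p (m + v))) {G. fragment d G \<simeq> H})"
  proof
    fix m
    show "falling (m + v) ((d - 1) * h) * q m ^ h / real (aut H) * ((1 - q m) ^ N m * Q m) =
        measure_pmf.prob (binomial_hypergraph d (m + v) (p (m + v))) {G. fragment d G \<simeq> H}"
      using fragment_iso_prob[OF d1 assms(6), of "p (m + v)" "m + v"] assms(2)[of "m + v"]
      unfolding v_def[symmetric] h_def[symmetric] q_def[symmetric] Q_def N_def
      by (simp add: v)
  qed
  finally show ?thesis unfolding h_def by (rule LIMSEQ_offset)
qed

end
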